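(* For every finite field $\mathbb{F}_q$ of order $q$ and every integer $n \geq 2$, one has $B_0(\mathrm{PSL}(n,\mathbb{F}_q)) = 0$.
   Context: For a group $G$, $H^2(G,\mathbb{Q}/\mathbb{Z})$ denotes group cohomology with $\mathbb{Q}/\mathbb{Z}$ a trivial $G$-module; it classifies central extensions of $G$ by $\mathbb{Q}/\mathbb{Z}$. The subgroup $B_0(G)\subset H^2(G,\mathbb{Q}/\mathbb{Z})$ is defined by $B_0(G)=\{\gamma\in H^2(G,\mathbb{Q}/\mathbb{Z}) : \gamma|_H=0 \text{ for every abelian subgroup } H\subset G\}$, where $\gamma|_H\in H^2(H,\mathbb{Q}/\mathbb{Z})$ is the restriction. $\mathrm{PSL}(n,\mathbb{F}_q)$ is the quotient of $\mathrm{SL}(n,\mathbb{F}_q)$ by its center (the scalar matrices in it). *)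

theory Defs
  imports
    "HOL-Algebra.Coset"
    "Jordan_Normal_Form.Determinant"
    "HOL-Library.FuncSet"
begin

section \<open>The coefficient group of rationals modulo integers\<close>

definition rat_group :: "rat monoid" where
  "rat_group = \<lparr>carrier = UNIV, monoid.mult = (+), one = 0\<rparr>"

definition rat_mod_int :: "rat set monoid" where
  "rat_mod_int = rat_group Mod \<int>"

lemma comm_group_rat_group: "comm_group rat_group"
  by (rule comm_groupI) (auto simp: rat_group_def add.assoc add.commute intro: exI[of _ "- x" for x])

lemma inv_rat_group: "inv\<^bsub>rat_group\<^esub> x = - x"
proof -
  interpret comm_group rat_group by (rule comm_group_rat_group)
  show ?thesis by (rule inv_equality) (auto simp: rat_group_def)
qed

lemma subgroup_Ints_rat_group: "subgroup \<int> rat_group"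
proof -
  interpret comm_group rat_group by (rule comm_group_rat_group)
  show ?thesis
    by (rule subgroup.intro) (auto simp: inv_rat_group, auto simp: rat_group_def)
qed

lemma comm_group_rat_mod_int: "comm_group rat_mod_int"
  unfolding rat_mod_int_def
  by (rule comm_group.abelian_FactGroup[OF comm_group_rat_group subgroup_Ints_rat_group])


section \<open>Second cohomology with trivial coefficients\<close>

text \<open>
  Inhomogeneous 2-cochains of \<open>G\<close> with values in the trivial module \<open>A\<close>, written
  multiplicatively; they are extensional, so that equality of cochains is equality on
  \<open>carrier G\<close>.
\<close>

definition cocycles2 :: "('g, 'm) monoid_scheme \<Rightarrow> ('a, 'n) monoid_scheme \<Rightarrow> ('g \<times> 'g \<Rightarrow> 'a) set" where
  "cocycles2 G A = {f \<in> carrier G \<times> carrier G \<rightarrow>\<^sub>E carrier A.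
     \<forall>x\<in>carrier G. \<forall>y\<in>carrier G. \<forall>z\<in>carrier G.
       f (y, z) \<otimes>\<^bsub>A\<^esub> f (x, y \<otimes>\<^bsub>G\<^esub> z) = f (x \<otimes>\<^bsub>G\<^esub> y, z) \<otimes>\<^bsub>A\<^esub> f (x, y)}"

definition coboundary2 ::
  "('g, 'm) monoid_scheme \<Rightarrow> ('a, 'n) monoid_scheme \<Rightarrow> ('g \<Rightarrow> 'a) \<Rightarrow> 'g \<times> 'g \<Rightarrow> 'a" where
  "coboundary2 G A c =
     (\<lambda>(x, y)\<in>carrier G \<times> carrier G. c y \<otimes>\<^bsub>A\<^esub> inv\<^bsub>A\<^esub> c (x \<otimes>\<^bsub>G\<^esub> y) \<otimes>\<^bsub>A\<^esub> c x)"

definition coboundaries2 :: "('g, 'm) monoid_scheme \<Rightarrow> ('a, 'n) monoid_scheme \<Rightarrow> ('g \<times> 'g \<Rightarrow> 'a) set" where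
  "coboundaries2 G A = coboundary2 G A ` (carrier G \<rightarrow> carrier A)"

definition cocycle_group2 ::
  "('g, 'm) monoid_scheme \<Rightarrow> ('a, 'n) monoid_scheme \<Rightarrow> ('g \<times> 'g \<Rightarrow> 'a) monoid" where
  "cocycle_group2 G A =
     \<lparr>carrier = cocycles2 G A,
      monoid.mult = (\<lambda>f g. \<lambda>p\<in>carrier G \<times> carrier G. f p \<otimes>\<^bsub>A\<^esub> g p),
      one = (\<lambda>p\<in>carrier G \<times> carrier G. \<one>\<^bsub>A\<^esub>)\<rparr>"

definition H2 ::
  "('g, 'm) monoid_scheme \<Rightarrow> ('a, 'n) monoid_scheme \<Rightarrow> ('g \<times> 'g \<Rightarrow> 'a) set monoid" where
  "H2 G A = cocycle_group2 G A Mod coboundaries2 G A"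

text \<open>
  Restriction of a class to a subgroup \<open>H\<close>. Classes are cosets of cocycles; the
  union over all representatives \<open>f\<close> of \<open>\<gamma>\<close> avoids choosing one, all
  members of the union being the same coset (\<open>res2_rcoset\<close>).
\<close>

definition res2 ::
  "('g, 'm) monoid_scheme \<Rightarrow> ('a, 'n) monoid_scheme \<Rightarrow> 'g set
     \<Rightarrow> ('g \<times> 'g \<Rightarrow> 'a) set \<Rightarrow> ('g \<times> 'g \<Rightarrow> 'a) set" where
  "res2 G A H \<gamma> = (\<Union>f\<in>\<gamma>. coboundaries2 (G\<lparr>carrier := H\<rparr>) A
     #>\<^bsub>cocycle_group2 (G\<lparr>carrier := H\<rparr>) A\<^esub> restrict f (H \<times> H))"

definition B0 :: "('g, 'm) monoid_scheme \<Rightarrow> ('g \<times> 'g \<Rightarrow> rat set) set set" where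
  "B0 G = {\<gamma> \<in> carrier (H2 G rat_mod_int).
     \<forall>H. subgroup H G \<and> comm_group (G\<lparr>carrier := H\<rparr>) \<longrightarrow>
       res2 G rat_mod_int H \<gamma> = \<one>\<^bsub>H2 (G\<lparr>carrier := H\<rparr>) rat_mod_int\<^esub>}"


subsection \<open>The definitions are coherent\<close>

locale trivial_module = G: group G + A: comm_group A
  for G :: "('g, 'm) monoid_scheme" (structure) and A :: "('a, 'n) monoid_scheme"
begin

lemma cocycles2D:
  assumes "f \<in> cocycles2 G A"
  shows "f \<in> carrier G \<times> carrier G \<rightarrow>\<^sub>E carrier A"
    and "\<lbrakk>x \<in> carrier G; y \<in> carrier G\<rbrakk> \<Longrightarrow> f (x, y) \<in> carrier A"
    and "\<lbrakk>x \<in> carrier G; y \<in> carrier G; z \<in> carrier G\<rbrakk> \<Longrightarrow>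
      f (y, z) \<otimes>\<^bsub>A\<^esub> f (x, y \<otimes> z) = f (x \<otimes> y, z) \<otimes>\<^bsub>A\<^esub> f (x, y)"
  using assms by (auto simp: cocycles2_def)

lemma mult_cocycle:
  assumes f: "f \<in> cocycles2 G A" and g: "g \<in> cocycles2 G A"
  shows "(\<lambda>p\<in>carrier G \<times> carrier G. f p \<otimes>\<^bsub>A\<^esub> g p) \<in> cocycles2 G A"
proof -
  have "(f (y, z) \<otimes>\<^bsub>A\<^esub> g (y, z)) \<otimes>\<^bsub>A\<^esub> (f (x, y \<otimes> z) \<otimes>\<^bsub>A\<^esub> g (x, y \<otimes> z))
      = (f (x \<otimes> y, z) \<otimes>\<^bsub>A\<^esub> g (x \<otimes> y, z)) \<otimes>\<^bsub>A\<^esub> (f (x, y) \<otimes>\<^bsub>A\<^esub> g (x, y))" (is "?l = ?r")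
    if x: "x \<in> carrier G" and y: "y \<in> carrier G" and z: "z \<in> carrier G" for x y z
  proof -
    note cl = x y z cocycles2D(2)[OF f] cocycles2D(2)[OF g]
    have "?l = (f (y, z) \<otimes>\<^bsub>A\<^esub> f (x, y \<otimes> z)) \<otimes>\<^bsub>A\<^esub> (g (y, z) \<otimes>\<^bsub>A\<^esub> g (x, y \<otimes> z))"
      using cl by (simp add: A.m_ac)
    also have "\<dots> = (f (x \<otimes> y, z) \<otimes>\<^bsub>A\<^esub> f (x, y)) \<otimes>\<^bsub>A\<^esub> (g (x \<otimes> y, z) \<otimes>\<^bsub>A\<^esub> g (x, y))"
      by (simp only: cocycles2D(3)[OF f x y z] cocycles2D(3)[OF g x y z])
    also have "\<dots> = ?r"
      using cl by (simp add: A.m_ac)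
    finally show ?thesis .
  qed
  then show ?thesis
    using cocycles2D(2)[OF f] cocycles2D(2)[OF g] by (auto simp: cocycles2_def)
qed

lemma one_cocycle: "(\<lambda>p\<in>carrier G \<times> carrier G. \<one>\<^bsub>A\<^esub>) \<in> cocycles2 G A"
  by (auto simp: cocycles2_def)

lemma inv_cocycle:
  assumes f: "f \<in> cocycles2 G A"
  shows "(\<lambda>p\<in>carrier G \<times> carrier G. inv\<^bsub>A\<^esub> f p) \<in> cocycles2 G A"
proof -
  have "inv\<^bsub>A\<^esub> f (y, z) \<otimes>\<^bsub>A\<^esub> inv\<^bsub>A\<^esub> f (x, y \<otimes> z) = inv\<^bsub>A\<^esub> f (x \<otimes> y, z) \<otimes>\<^bsub>A\<^esub> inv\<^bsub>A\<^esub> f (x, y)"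
    if x: "x \<in> carrier G" and y: "y \<in> carrier G" and z: "z \<in> carrier G" for x y z
    using x y z cocycles2D(2)[OF f] cocycles2D(3)[OF f x y z]
    by (simp flip: A.inv_mult)
  then show ?thesis
    using cocycles2D(2)[OF f] by (auto simp: cocycles2_def)
qed

lemma comm_group_cocycle_group2: "comm_group (cocycle_group2 G A)"
proof (rule comm_groupI)
  fix f assume "f \<in> carrier (cocycle_group2 G A)"
  then have f: "f \<in> cocycles2 G A" by (simp add: cocycle_group2_def)
  note f' = cocycles2D(1,2)[OF f]
  show "\<one>\<^bsub>cocycle_group2 G A\<^esub> \<otimes>\<^bsub>cocycle_group2 G A\<^esub> f = f"
  proof
    fix p show "(\<one>\<^bsub>cocycle_group2 G A\<^esub> \<otimes>\<^bsub>cocycle_group2 G A\<^esub> f) p = f p"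
      using PiE_mem[OF f'(1), of p] PiE_arb[OF f'(1), of p]
      by (cases "p \<in> carrier G \<times> carrier G") (simp_all add: cocycle_group2_def)
  qed
  show "\<exists>g\<in>carrier (cocycle_group2 G A). g \<otimes>\<^bsub>cocycle_group2 G A\<^esub> f = \<one>\<^bsub>cocycle_group2 G A\<^esub>"
    by (rule bexI[of _ "\<lambda>p\<in>carrier G \<times> carrier G. inv\<^bsub>A\<^esub> f p"])
      (use inv_cocycle[OF f] f'(2) in \<open>auto simp: cocycle_group2_def fun_eq_iff restrict_def\<close>)
next
  fix f g assume "f \<in> carrier (cocycle_group2 G A)" "g \<in> carrier (cocycle_group2 G A)"
  then have fg: "f \<in> cocycles2 G A" "g \<in> cocycles2 G A" by (simp_all add: cocycle_group2_def)
  show "f \<otimes>\<^bsub>cocycle_group2 G A\<^esub> g \<in> carrier (cocycle_group2 G A)"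
    using mult_cocycle[OF fg] by (simp add: cocycle_group2_def)
  show "f \<otimes>\<^bsub>cocycle_group2 G A\<^esub> g = g \<otimes>\<^bsub>cocycle_group2 G A\<^esub> f"
    using fg[THEN cocycles2D(2)] by (auto simp: cocycle_group2_def fun_eq_iff restrict_def A.m_comm)
next
  fix f g h
  assume "f \<in> carrier (cocycle_group2 G A)" "g \<in> carrier (cocycle_group2 G A)"
    "h \<in> carrier (cocycle_group2 G A)"
  then have fgh: "f \<in> cocycles2 G A" "g \<in> cocycles2 G A" "h \<in> cocycles2 G A"
    by (simp_all add: cocycle_group2_def)
  show "f \<otimes>\<^bsub>cocycle_group2 G A\<^esub> g \<otimes>\<^bsub>cocycle_group2 G A\<^esub> h
      = f \<otimes>\<^bsub>cocycle_group2 G A\<^esub> (g \<otimes>\<^bsub>cocycle_group2 G A\<^esub> h)"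
    using fgh[THEN cocycles2D(2)] by (auto simp: cocycle_group2_def fun_eq_iff restrict_def A.m_assoc)
qed (use one_cocycle in \<open>auto simp: cocycle_group2_def\<close>)

lemma inv_cocycle_group2:
  assumes f: "f \<in> cocycles2 G A"
  shows "inv\<^bsub>cocycle_group2 G A\<^esub> f = (\<lambda>p\<in>carrier G \<times> carrier G. inv\<^bsub>A\<^esub> f p)"
proof -
  interpret Z: comm_group "cocycle_group2 G A" by (rule comm_group_cocycle_group2)
  show ?thesis
    by (rule Z.inv_equality)
      (use f inv_cocycle[OF f] cocycles2D(2)[OF f] in
        \<open>auto simp: cocycle_group2_def fun_eq_iff restrict_def\<close>)
qed

lemma coboundary2_cocycle:
  assumes c: "c \<in> carrier G \<rightarrow> carrier A"
  shows "coboundary2 G A c \<in> cocycles2 G A"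
proof -
  have "(c z \<otimes>\<^bsub>A\<^esub> inv\<^bsub>A\<^esub> c (y \<otimes> z) \<otimes>\<^bsub>A\<^esub> c y)
        \<otimes>\<^bsub>A\<^esub> (c (y \<otimes> z) \<otimes>\<^bsub>A\<^esub> inv\<^bsub>A\<^esub> c (x \<otimes> y \<otimes> z) \<otimes>\<^bsub>A\<^esub> c x)
      = (c z \<otimes>\<^bsub>A\<^esub> inv\<^bsub>A\<^esub> c (x \<otimes> y \<otimes> z) \<otimes>\<^bsub>A\<^esub> c (x \<otimes> y))
        \<otimes>\<^bsub>A\<^esub> (c y \<otimes>\<^bsub>A\<^esub> inv\<^bsub>A\<^esub> c (x \<otimes> y) \<otimes>\<^bsub>A\<^esub> c x)" (is "?l = ?r")
    if x: "x \<in> carrier G" and y: "y \<in> carrier G" and z: "z \<in> carrier G" for x y z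
  proof -
    have cl: "c x \<in> carrier A" "c y \<in> carrier A" "c z \<in> carrier A" "c (y \<otimes> z) \<in> carrier A"
      "c (x \<otimes> y) \<in> carrier A" "c (x \<otimes> y \<otimes> z) \<in> carrier A"
      using c x y z by auto
    have "?l = (c (y \<otimes> z) \<otimes>\<^bsub>A\<^esub> inv\<^bsub>A\<^esub> c (y \<otimes> z))
        \<otimes>\<^bsub>A\<^esub> (c x \<otimes>\<^bsub>A\<^esub> c y \<otimes>\<^bsub>A\<^esub> c z \<otimes>\<^bsub>A\<^esub> inv\<^bsub>A\<^esub> c (x \<otimes> y \<otimes> z))"
      using cl by (simp only: A.m_ac A.m_closed A.inv_closed)
    also have "\<dots> = (c (x \<otimes> y) \<otimes>\<^bsub>A\<^esub> inv\<^bsub>A\<^esub> c (x \<otimes> y))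
        \<otimes>\<^bsub>A\<^esub> (c x \<otimes>\<^bsub>A\<^esub> c y \<otimes>\<^bsub>A\<^esub> c z \<otimes>\<^bsub>A\<^esub> inv\<^bsub>A\<^esub> c (x \<otimes> y \<otimes> z))"
      using cl by (simp only: A.r_inv)
    also have "\<dots> = ?r"
      using cl by (simp only: A.m_ac A.m_closed A.inv_closed)
    finally show ?thesis .
  qed
  moreover have "coboundary2 G A c \<in> carrier G \<times> carrier G \<rightarrow>\<^sub>E carrier A"
    using c by (auto simp: coboundary2_def Pi_iff)
  ultimately show ?thesis
    by (simp add: cocycles2_def coboundary2_def G.m_assoc)
qed

lemma coboundary2_mult:
  assumes c: "c \<in> carrier G \<rightarrow> carrier A" and d: "d \<in> carrier G \<rightarrow> carrier A"
  shows "coboundary2 G A c \<otimes>\<^bsub>cocycle_group2 G A\<^esub> coboundary2 G A d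
    = coboundary2 G A (\<lambda>x. c x \<otimes>\<^bsub>A\<^esub> d x)"
proof -
  have "(c y \<otimes>\<^bsub>A\<^esub> inv\<^bsub>A\<^esub> c (x \<otimes> y) \<otimes>\<^bsub>A\<^esub> c x) \<otimes>\<^bsub>A\<^esub> (d y \<otimes>\<^bsub>A\<^esub> inv\<^bsub>A\<^esub> d (x \<otimes> y) \<otimes>\<^bsub>A\<^esub> d x)
     = (c y \<otimes>\<^bsub>A\<^esub> d y) \<otimes>\<^bsub>A\<^esub> inv\<^bsub>A\<^esub> (c (x \<otimes> y) \<otimes>\<^bsub>A\<^esub> d (x \<otimes> y)) \<otimes>\<^bsub>A\<^esub> (c x \<otimes>\<^bsub>A\<^esub> d x)"
    if x: "x \<in> carrier G" and y: "y \<in> carrier G" for x y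
  proof -
    have "c x \<in> carrier A" "c y \<in> carrier A" "c (x \<otimes> y) \<in> carrier A"
      "d x \<in> carrier A" "d y \<in> carrier A" "d (x \<otimes> y) \<in> carrier A"
      using c d x y by auto
    then show ?thesis by (simp add: A.inv_mult A.m_ac)
  qed
  then show ?thesis
    by (auto simp: cocycle_group2_def coboundary2_def fun_eq_iff restrict_def)
qed

lemma coboundary2_inv:
  assumes c: "c \<in> carrier G \<rightarrow> carrier A"
  shows "inv\<^bsub>cocycle_group2 G A\<^esub> (coboundary2 G A c) = coboundary2 G A (\<lambda>x. inv\<^bsub>A\<^esub> c x)"
proof -
  have "inv\<^bsub>A\<^esub> (c y \<otimes>\<^bsub>A\<^esub> inv\<^bsub>A\<^esub> c (x \<otimes> y) \<otimes>\<^bsub>A\<^esub> c x)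
      = inv\<^bsub>A\<^esub> c y \<otimes>\<^bsub>A\<^esub> inv\<^bsub>A\<^esub> (inv\<^bsub>A\<^esub> c (x \<otimes> y)) \<otimes>\<^bsub>A\<^esub> inv\<^bsub>A\<^esub> c x"
    if x: "x \<in> carrier G" and y: "y \<in> carrier G" for x y
  proof -
    have "c x \<in> carrier A" "c y \<in> carrier A" "c (x \<otimes> y) \<in> carrier A"
      using c x y by auto
    then show ?thesis by (simp add: A.inv_mult)
  qed
  then show ?thesis
    by (subst inv_cocycle_group2[OF coboundary2_cocycle[OF c]])
      (auto simp: coboundary2_def fun_eq_iff restrict_def)
qed

lemma subgroup_coboundaries2: "subgroup (coboundaries2 G A) (cocycle_group2 G A)"
proof
  show "coboundaries2 G A \<subseteq> carrier (cocycle_group2 G A)"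
    using coboundary2_cocycle by (auto simp: coboundaries2_def cocycle_group2_def)
next
  fix f g assume "f \<in> coboundaries2 G A" "g \<in> coboundaries2 G A"
  then obtain c d where cd: "c \<in> carrier G \<rightarrow> carrier A" "d \<in> carrier G \<rightarrow> carrier A"
    "f = coboundary2 G A c" "g = coboundary2 G A d"
    by (auto simp: coboundaries2_def)
  have "(\<lambda>x. c x \<otimes>\<^bsub>A\<^esub> d x) \<in> carrier G \<rightarrow> carrier A" using cd by (auto simp: Pi_iff)
  then show "f \<otimes>\<^bsub>cocycle_group2 G A\<^esub> g \<in> coboundaries2 G A"
    using cd by (simp add: coboundary2_mult coboundaries2_def)
next
  have "coboundary2 G A (\<lambda>x. \<one>\<^bsub>A\<^esub>) = \<one>\<^bsub>cocycle_group2 G A\<^esub>"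
    by (auto simp: cocycle_group2_def coboundary2_def fun_eq_iff restrict_def)
  moreover have "(\<lambda>x. \<one>\<^bsub>A\<^esub>) \<in> carrier G \<rightarrow> carrier A" by auto
  ultimately show "\<one>\<^bsub>cocycle_group2 G A\<^esub> \<in> coboundaries2 G A"
    unfolding coboundaries2_def by (metis image_eqI)
next
  fix f assume "f \<in> coboundaries2 G A"
  then obtain c where c: "c \<in> carrier G \<rightarrow> carrier A" "f = coboundary2 G A c"
    by (auto simp: coboundaries2_def)
  have "(\<lambda>x. inv\<^bsub>A\<^esub> c x) \<in> carrier G \<rightarrow> carrier A" using c by (auto simp: Pi_iff)
  then show "inv\<^bsub>cocycle_group2 G A\<^esub> f \<in> coboundaries2 G A"
    using c by (simp add: coboundary2_inv coboundaries2_def)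
qed

lemma comm_group_H2: "comm_group (H2 G A)"
  unfolding H2_def
  by (rule comm_group.abelian_FactGroup[OF comm_group_cocycle_group2 subgroup_coboundaries2])

lemma one_H2: "\<one>\<^bsub>H2 G A\<^esub> = coboundaries2 G A"
  by (simp add: H2_def)

lemma carrier_H2:
  "carrier (H2 G A) = (\<lambda>f. coboundaries2 G A #>\<^bsub>cocycle_group2 G A\<^esub> f) ` cocycles2 G A"
  by (auto simp: H2_def FactGroup_def RCOSETS_def cocycle_group2_def)

lemma restrict_cocycle:
  assumes H: "subgroup H G" and f: "f \<in> cocycles2 G A"
  shows "restrict f (H \<times> H) \<in> cocycles2 (G\<lparr>carrier := H\<rparr>) A"
  using cocycles2D(2,3)[OF f] subgroup.subset[OF H] subgroup.m_closed[OF H]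
  by (auto simp: cocycles2_def subset_eq)

lemma restrict_mult:
  assumes H: "subgroup H G"
  shows "restrict (f \<otimes>\<^bsub>cocycle_group2 G A\<^esub> g) (H \<times> H)
    = restrict f (H \<times> H) \<otimes>\<^bsub>cocycle_group2 (G\<lparr>carrier := H\<rparr>) A\<^esub> restrict g (H \<times> H)"
  using subgroup.subset[OF H] by (auto simp: cocycle_group2_def fun_eq_iff restrict_def)

lemma restrict_coboundary:
  assumes H: "subgroup H G" and b: "b \<in> coboundaries2 G A"
  shows "restrict b (H \<times> H) \<in> coboundaries2 (G\<lparr>carrier := H\<rparr>) A"
proof -
  obtain c where c: "c \<in> carrier G \<rightarrow> carrier A" "b = coboundary2 G A c"
    using b by (auto simp: coboundaries2_def)
  have "restrict b (H \<times> H) = coboundary2 (G\<lparr>carrier := H\<rparr>) A c"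
    using subgroup.subset[OF H] c(2) by (auto simp: coboundary2_def fun_eq_iff restrict_def)
  moreover have "c \<in> H \<rightarrow> carrier A" using c(1) subgroup.subset[OF H] by auto
  ultimately show ?thesis by (auto simp: coboundaries2_def)
qed

lemma res2_rcoset:
  assumes H: "subgroup H G" and f: "f \<in> cocycles2 G A"
  shows "res2 G A H (coboundaries2 G A #>\<^bsub>cocycle_group2 G A\<^esub> f)
    = coboundaries2 (G\<lparr>carrier := H\<rparr>) A
        #>\<^bsub>cocycle_group2 (G\<lparr>carrier := H\<rparr>) A\<^esub> restrict f (H \<times> H)"
proof -
  let ?H = "G\<lparr>carrier := H\<rparr>"
  interpret TH: trivial_module ?H A
    by (intro trivial_module.intro A.comm_group_axioms subgroup.subgroup_is_group[OF H G.group_axioms])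
  interpret Z: comm_group "cocycle_group2 G A" by (rule comm_group_cocycle_group2)
  interpret ZH: comm_group "cocycle_group2 ?H A" by (rule TH.comm_group_cocycle_group2)
  have fH: "restrict f (H \<times> H) \<in> carrier (cocycle_group2 ?H A)"
    using restrict_cocycle[OF H f] by (simp add: cocycle_group2_def)
  have sub: "coboundaries2 ?H A \<subseteq> carrier (cocycle_group2 ?H A)"
    by (rule subgroup.subset[OF TH.subgroup_coboundaries2])
  have eq: "coboundaries2 ?H A #>\<^bsub>cocycle_group2 ?H A\<^esub> restrict g (H \<times> H)
      = coboundaries2 ?H A #>\<^bsub>cocycle_group2 ?H A\<^esub> restrict f (H \<times> H)"
    if g: "g \<in> coboundaries2 G A #>\<^bsub>cocycle_group2 G A\<^esub> f" for g
  proof -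
    obtain b where b: "b \<in> coboundaries2 G A" "g = b \<otimes>\<^bsub>cocycle_group2 G A\<^esub> f"
      using g by (auto simp: r_coset_def)
    have bH: "restrict b (H \<times> H) \<in> coboundaries2 ?H A" by (rule restrict_coboundary[OF H b(1)])
    have "coboundaries2 ?H A #>\<^bsub>cocycle_group2 ?H A\<^esub> restrict g (H \<times> H)
      = (coboundaries2 ?H A #>\<^bsub>cocycle_group2 ?H A\<^esub> restrict b (H \<times> H))
          #>\<^bsub>cocycle_group2 ?H A\<^esub> restrict f (H \<times> H)"
      using b(2) restrict_mult[OF H] ZH.coset_mult_assoc[OF sub _ fH] bH sub by auto
    also have "coboundaries2 ?H A #>\<^bsub>cocycle_group2 ?H A\<^esub> restrict b (H \<times> H) = coboundaries2 ?H A"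
      using ZH.coset_join2[OF _ TH.subgroup_coboundaries2 bH] bH sub by auto
    finally show ?thesis .
  qed
  have "coboundaries2 G A #>\<^bsub>cocycle_group2 G A\<^esub> f \<noteq> {}"
    using Z.rcos_self[OF _ subgroup_coboundaries2] f by (force simp: cocycle_group2_def)
  then show ?thesis unfolding res2_def using eq by auto
qed

lemma res2_hom:
  assumes H: "subgroup H G"
  shows "res2 G A H \<in> hom (H2 G A) (H2 (G\<lparr>carrier := H\<rparr>) A)"
proof -
  let ?H = "G\<lparr>carrier := H\<rparr>"
  interpret TH: trivial_module ?H A
    by (intro trivial_module.intro A.comm_group_axioms subgroup.subgroup_is_group[OF H G.group_axioms])
  interpret Z: comm_group "cocycle_group2 G A" by (rule comm_group_cocycle_group2)
  interpret ZH: comm_group "cocycle_group2 ?H A" by (rule TH.comm_group_cocycle_group2)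
  interpret N: normal "coboundaries2 G A" "cocycle_group2 G A"
    using subgroup_coboundaries2 Z.normal_iff_subgroup by blast
  interpret NH: normal "coboundaries2 ?H A" "cocycle_group2 ?H A"
    using TH.subgroup_coboundaries2 ZH.normal_iff_subgroup by blast
  have cZ: "f \<in> carrier (cocycle_group2 G A) \<longleftrightarrow> f \<in> cocycles2 G A" for f
    by (simp add: cocycle_group2_def)
  have cZH: "f \<in> carrier (cocycle_group2 ?H A) \<longleftrightarrow> f \<in> cocycles2 ?H A" for f
    by (simp add: cocycle_group2_def)
  show ?thesis
  proof (rule homI)
    fix u assume "u \<in> carrier (H2 G A)"
    then obtain f where "f \<in> cocycles2 G A" "u = coboundaries2 G A #>\<^bsub>cocycle_group2 G A\<^esub> f"
      by (auto simp: carrier_H2)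
    then show "res2 G A H u \<in> carrier (H2 ?H A)"
      using restrict_cocycle[OF H] by (auto simp: res2_rcoset[OF H] TH.carrier_H2)
  next
    fix u v assume "u \<in> carrier (H2 G A)" "v \<in> carrier (H2 G A)"
    then obtain f g where
      f: "f \<in> cocycles2 G A" "u = coboundaries2 G A #>\<^bsub>cocycle_group2 G A\<^esub> f" and
      g: "g \<in> cocycles2 G A" "v = coboundaries2 G A #>\<^bsub>cocycle_group2 G A\<^esub> g"
      by (auto simp: carrier_H2)
    have fg: "f \<otimes>\<^bsub>cocycle_group2 G A\<^esub> g \<in> cocycles2 G A"
      using f g Z.m_closed by (simp add: cZ)
    have "u \<otimes>\<^bsub>H2 G A\<^esub> v
        = coboundaries2 G A #>\<^bsub>cocycle_group2 G A\<^esub> (f \<otimes>\<^bsub>cocycle_group2 G A\<^esub> g)"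
      using f g by (simp add: H2_def FactGroup_def N.rcos_sum cZ)
    then show "res2 G A H (u \<otimes>\<^bsub>H2 G A\<^esub> v) = res2 G A H u \<otimes>\<^bsub>H2 ?H A\<^esub> res2 G A H v"
      using f g restrict_cocycle[OF H]
      by (simp add: res2_rcoset[OF H] fg restrict_mult[OF H])
        (simp add: H2_def FactGroup_def NH.rcos_sum cZH)
  qed
qed

end

lemma subgroup_B0:
  assumes "group G"
  shows "subgroup (B0 G) (H2 G rat_mod_int)"
proof -
  interpret trivial_module G rat_mod_int
    by (intro trivial_module.intro assms comm_group_rat_mod_int)
  interpret H2: comm_group "H2 G rat_mod_int" by (rule comm_group_H2)
  have hom: "group_hom (H2 G rat_mod_int) (H2 (G\<lparr>carrier := H\<rparr>) rat_mod_int) (res2 G rat_mod_int H)"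
    if H: "subgroup H G" for H
  proof -
    interpret TH: trivial_module "G\<lparr>carrier := H\<rparr>" rat_mod_int
      by (intro trivial_module.intro comm_group_rat_mod_int
          subgroup.subgroup_is_group[OF H assms])
    interpret H2H: comm_group "H2 (G\<lparr>carrier := H\<rparr>) rat_mod_int" by (rule TH.comm_group_H2)
    show ?thesis
      by (intro group_hom.intro group_hom_axioms.intro res2_hom[OF H]
          H2.group_axioms H2H.group_axioms)
  qed
  have B0_kernel: "B0 G = carrier (H2 G rat_mod_int) \<inter>
      (\<Inter>H\<in>{H. subgroup H G \<and> comm_group (G\<lparr>carrier := H\<rparr>)}.
        kernel (H2 G rat_mod_int) (H2 (G\<lparr>carrier := H\<rparr>) rat_mod_int) (res2 G rat_mod_int H))"
    by (auto simp: B0_def kernel_def)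
  also have "\<dots> = \<Inter>(insert (carrier (H2 G rat_mod_int))
      ((\<lambda>H. kernel (H2 G rat_mod_int) (H2 (G\<lparr>carrier := H\<rparr>) rat_mod_int) (res2 G rat_mod_int H))
        ` {H. subgroup H G \<and> comm_group (G\<lparr>carrier := H\<rparr>)}))"
    by auto
  also have "subgroup \<dots> (H2 G rat_mod_int)"
    by (rule H2.subgroups_Inter) (auto intro: H2.subgroup_self group_hom.subgroup_kernel[OF hom])
  finally show ?thesis .
qed


section \<open>The projective special linear group\<close>

definition group_center :: "('g, 'm) monoid_scheme \<Rightarrow> 'g set" where
  "group_center G = {z \<in> carrier G. \<forall>g\<in>carrier G. z \<otimes>\<^bsub>G\<^esub> g = g \<otimes>\<^bsub>G\<^esub> z}"

definition SL :: "'a::comm_ring_1 itself \<Rightarrow> nat \<Rightarrow> 'a mat monoid" where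
  "SL _ n = \<lparr>carrier = {M \<in> carrier_mat n n. det M = 1}, monoid.mult = (*), one = 1\<^sub>m n\<rparr>"

definition PSL :: "'a::comm_ring_1 itself \<Rightarrow> nat \<Rightarrow> 'a mat set monoid" where
  "PSL F n = SL F n Mod group_center (SL F n)"

lemma group_centerI:
  "z \<in> carrier G \<Longrightarrow> (\<And>g. g \<in> carrier G \<Longrightarrow> z \<otimes>\<^bsub>G\<^esub> g = g \<otimes>\<^bsub>G\<^esub> z) \<Longrightarrow> z \<in> group_center G"
  unfolding group_center_def by blast

lemma group_centerD:
  "z \<in> group_center G \<Longrightarrow> z \<in> carrier G"
  "z \<in> group_center G \<Longrightarrow> g \<in> carrier G \<Longrightarrow> z \<otimes>\<^bsub>G\<^esub> g = g \<otimes>\<^bsub>G\<^esub> z"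
  unfolding group_center_def by blast+

lemma (in group) normal_group_center: "group_center G \<lhd> G"
proof (rule normalI)
  show "subgroup (group_center G) G"
  proof
    fix x y assume xy: "x \<in> group_center G" "y \<in> group_center G"
    have "x \<otimes> y \<otimes> g = g \<otimes> (x \<otimes> y)" if g: "g \<in> carrier G" for g
    proof -
      have xy': "x \<in> carrier G" "y \<in> carrier G" "x \<otimes> g = g \<otimes> x" "y \<otimes> g = g \<otimes> y"
        using xy g by (blast dest: group_centerD)+
      have "x \<otimes> y \<otimes> g = x \<otimes> g \<otimes> y" using xy'(1,2,4) g by (simp add: m_assoc)
      also have "\<dots> = g \<otimes> (x \<otimes> y)" using xy'(1,2) g by (simp only: xy'(3) m_assoc)
      finally show ?thesis .
    qed
    then show "x \<otimes> y \<in> group_center G"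
      using xy by (intro group_centerI m_closed) (auto dest: group_centerD(1))
  next
    fix x assume x: "x \<in> group_center G"
    have "inv x \<otimes> g = g \<otimes> inv x" if g: "g \<in> carrier G" for g
    proof -
      have x': "x \<in> carrier G" "x \<otimes> g = g \<otimes> x"
        using x g by (blast dest: group_centerD)+
      have "inv x \<otimes> g = inv x \<otimes> (g \<otimes> x) \<otimes> inv x"
        using x'(1) g by (simp add: m_assoc)
      also have "\<dots> = inv x \<otimes> (x \<otimes> g) \<otimes> inv x" by (simp only: x'(2))
      also have "\<dots> = g \<otimes> inv x" using x'(1) g by (simp flip: m_assoc)
      finally show ?thesis .
    qed
    then show "inv x \<in> group_center G"
      using x by (intro group_centerI inv_closed) (auto dest: group_centerD(1))
  qed (auto intro: group_centerI dest: group_centerD(1))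
  show "\<forall>x\<in>carrier G. group_center G #> x = x <# group_center G"
    unfolding r_coset_def l_coset_def
    by (intro ballI SUP_cong refl arg_cong[of _ _ "\<lambda>u. {u}"] group_centerD(2))
qed

lemma group_SL: "group (SL F n)"
proof (rule groupI)
  fix M assume "M \<in> carrier (SL F n)"
  then have M: "M \<in> carrier_mat n n" "det M = 1" by (auto simp: SL_def)
  note adj = adj_mat[OF M(1)]
  have "adj_mat M * M = 1\<^sub>m n" using adj(3) M(2) by (intro eq_matI) auto
  moreover from this have "det (adj_mat M) = 1"
    using det_mult[OF adj(1) M(1)] M(2) by simp
  ultimately show "\<exists>N\<in>carrier (SL F n). N \<otimes>\<^bsub>SL F n\<^esub> M = \<one>\<^bsub>SL F n\<^esub>"
    using adj(1) by (auto simp: SL_def)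
qed (auto simp: SL_def det_mult)

lemma group_PSL: "group (PSL F n)"
  unfolding PSL_def
  by (rule normal.factorgroup_is_group[OF group.normal_group_center[OF group_SL]])

lemma group_center_SL:
  "group_center (SL (F :: 'a::field itself) n) = {a \<cdot>\<^sub>m 1\<^sub>m n | a. a ^ n = 1}"
proof (intro equalityI subsetI)
  fix M assume "M \<in> group_center (SL F n)"
  then have M: "M \<in> carrier_mat n n" "det M = 1"
    and comm: "\<And>N. N \<in> carrier_mat n n \<Longrightarrow> det N = 1 \<Longrightarrow> M * N = N * M"
    by (auto simp: group_center_def SL_def)
  have E: "M $$ (i, k) = 0 \<and> M $$ (k, k) = M $$ (l, l)"
    if k: "k < n" and l: "l < n" and kl: "k \<noteq> l" and i: "i < n" "i \<noteq> k" for i k l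
  proof -
    let ?E = "addrow_mat n (1::'a) k l"
    have Eeq: "?E $$ (i, j) = (if i = j then 1 else 0) + (if i = k \<and> j = l then 1 else 0)"
      if "i < n" "j < n" for i j
      using that by auto
    have right: "(M * ?E) $$ (i, l) = M $$ (i, l) + M $$ (i, k)" if "i < n" for i
    proof -
      have "(M * ?E) $$ (i, l) = (\<Sum>j = 0..<n. M $$ (i, j) * ?E $$ (j, l))"
        using that l M(1) by (auto simp: scalar_prod_def)
      also have "\<dots> = (\<Sum>j = 0..<n. (if j = l then M $$ (i, j) else 0) + (if j = k then M $$ (i, j) else 0))"
        using l kl by (intro sum.cong) (auto simp: Eeq)
      also have "\<dots> = M $$ (i, l) + M $$ (i, k)"
        using k l by (simp add: sum.distrib)
      finally show ?thesis .
    qed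
    have left: "(?E * M) $$ (i, l) = M $$ (i, l) + (if i = k then M $$ (l, l) else 0)" if "i < n" for i
    proof -
      have "(?E * M) $$ (i, l) = (\<Sum>j = 0..<n. ?E $$ (i, j) * M $$ (j, l))"
        using that l M(1) by (auto simp: scalar_prod_def)
      also have "\<dots> = (\<Sum>j = 0..<n. (if j = i then M $$ (j, l) else 0)
          + (if j = l then (if i = k then M $$ (l, l) else 0) else 0))"
        using that l kl by (intro sum.cong) (auto simp: Eeq)
      also have "\<dots> = M $$ (i, l) + (if i = k then M $$ (l, l) else 0)"
        using that l by (simp add: sum.distrib)
      finally show ?thesis .
    qed
    have "M * ?E = ?E * M" using kl by (intro comm) (auto simp: det_addrow_mat)
    then show ?thesis using left[OF i(1)] right[OF i(1)] left[OF k] right[OF k] i(2) by simp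
  qed
  define a where "a = (if n = 0 then 1 else M $$ (0, 0))"
  have "M = a \<cdot>\<^sub>m 1\<^sub>m n"
  proof (rule eq_matI)
    fix i j assume "i < dim_row (a \<cdot>\<^sub>m 1\<^sub>m n)" "j < dim_col (a \<cdot>\<^sub>m 1\<^sub>m n)"
    then have ij: "i < n" "j < n" by auto
    show "M $$ (i, j) = (a \<cdot>\<^sub>m 1\<^sub>m n) $$ (i, j)"
    proof (cases "i = j")
      case True
      have "M $$ (j, j) = M $$ (0, 0)"
        using E[of 0 j j] ij by (cases "j = 0") auto
      then show ?thesis using True ij by (simp add: a_def)
    next
      case False
      then show ?thesis using E[of j i i] ij by auto
    qed
  qed (use M in auto)
  then show "M \<in> {a \<cdot>\<^sub>m 1\<^sub>m n | a. a ^ n = 1}"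
    using M(2) by (auto simp: det_smult)
next
  fix M :: "'a mat" assume "M \<in> {a \<cdot>\<^sub>m 1\<^sub>m n | a. a ^ n = 1}"
  then obtain a where a: "M = a \<cdot>\<^sub>m 1\<^sub>m n" "a ^ n = 1" by auto
  have "M * N = N * M" if N: "N \<in> carrier_mat n n" for N
    using mult_smult_distrib[OF N one_carrier_mat] mult_smult_assoc_mat[OF one_carrier_mat N] N
    by (simp add: a(1))
  then show "M \<in> group_center (SL F n)"
    using a by (auto simp: group_center_def SL_def det_smult)
qed

end

theory Submission
  imports Defs
begin

text \<open>
  A class in \<open>B\<^sub>0\<close> is represented by a cocycle \<open>\<phi>\<close> that is symmetric on commuting pairs: in the
  central extension it defines, commuting elements lift to commuting elements. Pull the extension
  back to \<open>SL\<^sub>n\<close>. For \<open>n \<ge> 3\<close> the commutator \<open>[L(e\<^sub>i\<^sub>j(t)), L(e\<^sub>j\<^sub>k(1))]\<close> of arbitrary lifts is a canonical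
  lift of \<open>e\<^sub>i\<^sub>k(t)\<close>, and the commuting property turns Steinberg's arguments into a proof of all Steinberg
  relations without exceptions for small fields; for \<open>n = 2\<close> commutators with the torus play this
  role. The symbols \<open>h(u) h(v) h(uv)\<^sup>-\<^sup>1\<close> vanish because the torus lifts to a commutative group and
  because \<open>h(t) h(1 - t) = h(t (1 - t))\<close>. Induction over the index set, using a double coset
  decomposition, shows that the group generated by the lifts meets the kernel trivially, so the
  extension splits over \<open>SL\<^sub>n\<close>. Finally, for a scalar matrix \<open>z\<close> in \<open>SL\<^sub>n\<close> there are \<open>X\<close>, \<open>P\<close> with
  \<open>X P = z P X\<close>; their images in \<open>PSL\<^sub>n\<close> commute, so the splitting kills \<open>z\<close> and descends to \<open>PSL\<^sub>n\<close>.
\<close>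

section \<open>Groups as a type class\<close>

text \<open>The usual description of the central extensions of SL_n(F_q) by Steinberg's relations
  breaks down for a few small fields with exceptional Schur multiplier, and SL_2(F_2), SL_2(F_3) are
  not even perfect. These cases shape the proof. For n at least 3, products of elementary matrices
  that commute although their factors do not take the place of auxiliary scalars; for the two
  imperfect groups, square and cube roots in the coefficients do. The symmetry of the cocycle
  concerns pairs commuting in PSL_n. Pulling back to SL_n keeps those that commute there, which is
  enough to split over SL_n, but a class may die in SL_n and still be nonzero in PSL_n. The pairs
  commuting only up to a scalar make up for this. Finding them with determinant 1 for every central
  scalar z is delicate: the clock matrix fails when n is even and z^(n/2) = -1 differs from 1.
  Finiteness of the field enters twice through sums of two squares: in killing the symbols and in
  adjusting a determinant in the delicate case.\<close>

class group_mult = monoid_mult + inverse +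
  assumes left_inverse_mult [simp]: "inverse a * a = 1"
begin

lemma inverse_mult_cancel [simp]: "inverse a * (a * b) = b"
  by (simp flip: mult.assoc)

lemma right_inverse_mult [simp]: "a * inverse a = 1"
  by (metis inverse_mult_cancel mult_1_right mult.assoc left_inverse_mult)

lemma mult_inverse_cancel [simp]: "a * (inverse a * b) = b"
  by (simp flip: mult.assoc)

lemma mult_left_cancel_group: "a * b = a * c \<longleftrightarrow> b = c"
  by (metis inverse_mult_cancel)

lemma mult_right_cancel_group: "b * a = c * a \<longleftrightarrow> b = c"
  by (metis mult.assoc mult_1_right right_inverse_mult)

lemma inverse_unique_mult: "a * b = 1 \<Longrightarrow> inverse a = b"
  by (metis inverse_mult_cancel mult_1_right)

lemma inverse_one_mult [simp]: "inverse 1 = 1"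
  by (rule inverse_unique_mult) simp

lemma inverse_mult_distrib: "inverse (a * b) = inverse b * inverse a"
  by (rule inverse_unique_mult) (simp add: mult.assoc)

end

text \<open>Words are simplified in right-associated form, where a relation between two adjacent
  letters applies only if it is also available with a tail \<open>z\<close>.\<close>

lemma mult_tail: "a * b = c \<Longrightarrow> a * (b * z) = c * (z :: 'g :: semigroup_mult)"
  by (simp flip: mult.assoc)

text \<open>Only a submonoid: the generating sets below consist of root elements \<open>x t\<close>
  with inverse \<open>x (-t)\<close>, so it is already the subgroup, and inductions need just left
  multiplication by a generator.\<close>

inductive_set gen :: "'g :: monoid_mult set \<Rightarrow> 'g set" for S where
  gen_one: "1 \<in> gen S"
| gen_step: "s \<in> S \<Longrightarrow> k \<in> gen S \<Longrightarrow> s * k \<in> gen S"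

lemma gen_incl: "s \<in> S \<Longrightarrow> s \<in> gen S"
  using gen_step[OF _ gen_one] by simp

lemma gen_mult: "k \<in> gen S \<Longrightarrow> l \<in> gen S \<Longrightarrow> k * l \<in> gen S"
  by (induction rule: gen.induct) (auto simp: mult.assoc intro: gen_step)

lemma gen_inverse:
  assumes "\<And>s. s \<in> S \<Longrightarrow> inverse s \<in> gen S" and "k \<in> gen S"
  shows "inverse (k :: 'g :: group_mult) \<in> gen S"
  using assms(2)
  by (induction rule: gen.induct) (auto simp: inverse_mult_distrib intro: gen_one gen_mult assms(1))

lemma gen_least:
  assumes "S \<subseteq> gen T" shows "gen S \<subseteq> gen T"
proof
  fix k assume "k \<in> gen S" then show "k \<in> gen T"
    by (induction rule: gen.induct) (use assms in \<open>auto intro: gen_one gen_mult\<close>)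
qed

lemma gen_mono: "S \<subseteq> T \<Longrightarrow> gen S \<subseteq> gen T"
  by (rule gen_least) (auto intro: gen_incl)

text \<open>Pigeonhole: more than half of the field consists of squares, so the affine images
  \<open>u * S\<close> and \<open>c - v * S\<close> of the set \<open>S\<close> of squares must
  meet.\<close>

lemma finite_field_two_squares:
  fixes u v c :: "'a :: {field, finite}"
  assumes "u \<noteq> 0" "v \<noteq> 0"
  obtains a b where "u * a\<^sup>2 + v * b\<^sup>2 = c"
proof -
  define S where "S = range (\<lambda>a :: 'a. a\<^sup>2)"
  have S: "card (UNIV :: 'a set) < 2 * card S"
  proof -
    \<comment> \<open>The single square root of 0 is what makes the inequality strict, in
      characteristic 2 as well.\<close>
    have fibre: "card {a. a\<^sup>2 = s} \<le> (if s = 0 then 1 else 2)" if s: "s \<in> S" for s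
    proof -
      obtain a where a: "s = a\<^sup>2" using s by (auto simp: S_def)
      have "{b. b\<^sup>2 = s} = {a, - a}" by (auto simp: a power2_eq_iff)
      then show ?thesis by (cases "a = 0") (auto simp: a card_insert_if)
    qed
    have "(UNIV :: 'a set) = (\<Union>s\<in>S. {a. a\<^sup>2 = s})" by (auto simp: S_def)
    then have "card (UNIV :: 'a set) \<le> (\<Sum>s\<in>S. card {a. a\<^sup>2 = s})"
      using card_UN_le[of S "\<lambda>s. {a. a\<^sup>2 = s}"] by simp
    also have "\<dots> \<le> (\<Sum>s\<in>S. if s = 0 then 1 else 2)"
      by (rule sum_mono) (rule fibre)
    also have "\<dots> = 1 + (\<Sum>s\<in>S-{0}. 2)"
      by (subst sum.remove[of S 0]) (auto simp: S_def image_iff intro!: sum.cong exI[of _ "0::'a"])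
    also have "\<dots> < 2 * card S"
    proof -
      have "0 \<in> S" by (auto simp: S_def image_iff intro!: exI[of _ "0::'a"])
      then show ?thesis using card_Suc_Diff1[of S 0] by simp
    qed
    finally show ?thesis .
  qed
  have "card ((\<lambda>s. u * s) ` S) = card S" "card ((\<lambda>s. c - v * s) ` S) = card S"
    using assms by (auto intro!: card_image inj_onI)
  with S have less: "card (UNIV :: 'a set) < card ((\<lambda>s. u * s) ` S) + card ((\<lambda>s. c - v * s) ` S)" by simp
  have "card A + card B \<le> card (UNIV :: 'a set)" if "A \<inter> B = {}" for A B :: "'a set"
    using that by (metis card_Un_disjoint card_mono finite subset_UNIV)
  with less have "(\<lambda>s. u * s) ` S \<inter> (\<lambda>s. c - v * s) ` S \<noteq> {}"
    using leD by blast
  then obtain a b where "u * a\<^sup>2 = c - v * b\<^sup>2" by (auto simp: S_def)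
  then show thesis using that[of a b] by (simp add: algebra_simps)
qed

section \<open>Rank one: the relations of SL_2, its torus and its Bruhat decomposition\<close>

locale rank_one =
  fixes x y :: "'a :: field \<Rightarrow> 'g :: group_mult"
  assumes x_add: "x s * x t = x (s + t)"
    and y_add: "y s * y t = y (s + t)"
    and weyl: "u \<noteq> 0 \<Longrightarrow> x u * y (-1/u) * x u * x t = y (-t/u\<^sup>2) * (x u * y (-1/u) * x u)"
begin

text \<open>With \<open>x t\<close>, \<open>y t\<close> the upper and lower elementary matrices of
  SL_2, \<open>w u\<close> is the monomial matrix (0, u; -1/u, 0) and \<open>h u\<close> is diag(u,
  1/u).\<close>

definition w where "w u = x u * y (-1/u) * x u"
definition h where "h u = w u * w (-1)"

lemma x_zero [simp]: "x 0 = 1"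
  using x_add[of 0 0] by (metis add_0 mult_1_right mult_left_cancel_group)

lemma y_zero [simp]: "y 0 = 1"
  using y_add[of 0 0] by (metis add_0 mult_1_right mult_left_cancel_group)

lemma inverse_x: "inverse (x t) = x (-t)"
  by (rule inverse_unique_mult) (simp add: x_add)

lemma inverse_y: "inverse (y t) = y (-t)"
  by (rule inverse_unique_mult) (simp add: y_add)

lemma inverse_w: "inverse (w u) = w (-u)"
  by (simp add: w_def inverse_mult_distrib inverse_x inverse_y mult.assoc)

lemma w_minus: "w u * w (-u) = 1" "w (-u) * w u = 1"
  by (simp_all flip: inverse_w)

lemma w_x: "u \<noteq> 0 \<Longrightarrow> w u * x t = y (-t/u\<^sup>2) * w u"
  unfolding w_def by (rule weyl)

lemma w_y:
  assumes "u \<noteq> 0" shows "w u * y t = x (-t * u\<^sup>2) * w u"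
proof -
  have "w (-u) * x (-t * u\<^sup>2) = y t * w (-u)"
    using assms by (simp add: w_x)
  then have "w u * (w (-u) * x (-t * u\<^sup>2)) * w u = w u * (y t * w (-u)) * w u" by simp
  then show ?thesis by (simp flip: inverse_w add: mult.assoc)
qed

text \<open>As \<open>w u\<close> turns \<open>x u\<close> into \<open>y (-1/u)\<close>, one letter
  can be slid through the word and cancelled. This makes the roles of the two root groups
  symmetric.\<close>

lemma w_alt:
  assumes "u \<noteq> 0" shows "w u = y (-1/u) * x u * y (-1/u)"
proof -
  have "w u * x u = y (-1/u) * w u" using w_x[OF assms, of u] assms by (simp add: power2_eq_square)
  then have "w u * x u = (y (-1/u) * x u * y (-1/u)) * x u" by (simp add: w_def mult.assoc)
  then show ?thesis by (simp add: mult_right_cancel_group)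
qed

lemma w_w:
  assumes "u \<noteq> 0" "v \<noteq> 0" shows "w u * w v = w (u\<^sup>2/v) * w u"
proof -
  have "w u * w v = y (-v/u\<^sup>2) * x (u\<^sup>2/v) * y (-v/u\<^sup>2) * w u"
    using assms by (simp add: w_def[of v] w_x w_y w_x[THEN mult_tail] w_y[THEN mult_tail] mult.assoc)
  then show ?thesis using assms w_alt[of "u\<^sup>2/v"] by simp
qed

lemma w_eq_h: "w u = h u * w 1"
  using w_minus[of 1] by (simp add: h_def mult.assoc)

lemma h_one [simp]: "h 1 = 1"
  by (simp add: h_def w_minus)

lemma h_x:
  assumes "u \<noteq> 0" shows "h u * x t = x (u\<^sup>2 * t) * h u"
  using assms by (simp add: h_def mult.assoc w_x w_y w_x[THEN mult_tail] w_y[THEN mult_tail] mult.commute)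

lemma h_w:
  assumes "u \<noteq> 0" "v \<noteq> 0" shows "h u * w v = w (u\<^sup>2 * v) * h u"
proof -
  have "h u * w v = w u * (w (-1) * w v)" by (simp add: h_def mult.assoc)
  also have "w (-1) * w v = w (1/v) * w (-1)" using w_w[of "-1" v] assms by simp
  also have "w u * (w (1/v) * w (-1)) = (w u * w (1/v)) * w (-1)" by (simp add: mult.assoc)
  also have "w u * w (1/v) = w (u\<^sup>2 * v) * w u" using w_w[of u "1/v"] assms by simp
  finally show ?thesis by (simp add: h_def mult.assoc)
qed

text \<open>Write \<open>x u\<close> as \<open>w u * x (-u) * y (1/u)\<close>: the last factor
  commutes with \<open>y s\<close>, and conjugation by \<open>w u\<close> exchanges the two root
  groups.\<close>

lemma x_conj_y:
  assumes "u \<noteq> 0" shows "x u * y s * x (-u) = y (1/u) * x (-s * u\<^sup>2) * y (-1/u)"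
proof -
  have "x u = w u * (x (-u) * y (1/u))"
    by (simp add: w_def mult.assoc x_add[THEN mult_tail] y_add x_add)
  moreover from this have "inverse (x u) = inverse (w u * (x (-u) * y (1/u)))" by simp
  then have "x (-u) = y (-1/u) * (x u * w (-u))"
    by (simp add: inverse_mult_distrib inverse_x inverse_y inverse_w mult.assoc)
  ultimately have "x u * y s * x (-u)
      = w u * (x (-u) * (y (1/u) * (y s * (y (-1/u) * (x u * w (-u))))))"
    by (metis mult.assoc)
  also have "\<dots> = w u * (x (-u) * (y s * (x u * w (-u))))"
    by (simp add: y_add y_add[THEN mult_tail])
  also have "\<dots> = (w u * x (-u)) * (y s * (x u * w (-u)))" by (simp only: mult.assoc)
  also have "w u * x (-u) = y (1/u) * w u" using w_x[OF assms, of "-u"] assms by (simp add: power2_eq_square)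
  also have "y (1/u) * w u * (y s * (x u * w (-u))) = y (1/u) * ((w u * y s) * (x u * w (-u)))"
    by (simp only: mult.assoc)
  also have "w u * y s = x (-s * u\<^sup>2) * w u" by (rule w_y[OF assms])
  also have "y (1/u) * (x (-s * u\<^sup>2) * w u * (x u * w (-u))) = y (1/u) * (x (-s * u\<^sup>2) * ((w u * x u) * w (-u)))"
    by (simp only: mult.assoc)
  also have "w u * x u = y (-1/u) * w u" using w_x[OF assms, of u] assms by (simp add: power2_eq_square)
  finally show ?thesis by (simp add: w_minus mult.assoc)
qed

end

context rank_one
begin

text \<open>Milnor's form of the Steinberg symbol identity \<open>c(t, 1 - t) = 1\<close>.\<close>

lemma h_mult_sum_one:
  assumes "t + u = 1" "t \<noteq> 0" "u \<noteq> 0" shows "h t * h u = h (t * u)"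
proof -
  have "1 - 1/t = (t - 1)/t" "1 - 1/u = (u - 1)/u"
    using assms by (simp_all add: diff_divide_distrib)
  moreover have "t - 1 = -u" "u - 1 = -t" using assms(1) by (simp_all add: algebra_simps)
  moreover have "1/t + 1/u = 1/(t*u)" using assms by (simp add: add_frac_eq add.commute)
  moreover have "-1/t - 1/u = - (1/t + 1/u)" by simp
  ultimately have tu: "1 - 1/t = -u/t" "1 - 1/u = -t/u" "-1/t - 1/u = -1/(t*u)"
    by simp_all
  have "w t * w (-1) * w u
      = (y (-1/t) * x t * y (-1/t)) * (y 1 * x (-1) * y 1) * (y (-1/u) * x u * y (-1/u))"
    using w_alt[of t] w_alt[of u] w_alt[of "-1"] assms by simp
  also have "\<dots> = y (-1/t) * (x t * (y (-u/t) * (x (-1) * (y (-t/u) * (x u * y (-1/u))))))"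
    by (simp add: mult.assoc y_add y_add[THEN mult_tail] tu)
  \<comment> \<open>Splitting the middle letter along \<open>t + u = 1\<close> turns the word into a
    product of two conjugates, each evaluated by \<open>x_conj_y\<close>.\<close>
  also have "x (-1) = x (-(t + u))" by (simp only: assms(1))
  also have "\<dots> = x (-t) * x (-u)" by (simp add: x_add)
  also have "y (-1/t) * (x t * (y (-u/t) * (x (-t) * x (-u) * (y (-t/u) * (x u * y (-1/u))))))
     = y (-1/t) * ((x t * y (-u/t) * x (-t)) * ((x (-u) * y (-t/u) * x (-(-u))) * y (-1/u)))"
    by (simp add: mult.assoc)
  also have "x t * y (-u/t) * x (-t) = y (1/t) * x (t*u) * y (-1/t)"
    using x_conj_y[of t "-u/t"] assms by (simp add: power2_eq_square mult.commute)
  also have "x (-u) * y (-t/u) * x (-(-u)) = y (-1/u) * x (t*u) * y (1/u)"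
    using x_conj_y[of "-u" "-t/u"] assms by (simp add: power2_eq_square)
  also have "y (-1/t) * ((y (1/t) * x (t*u) * y (-1/t)) * ((y (-1/u) * x (t*u) * y (1/u)) * y (-1/u)))
      = x (t*u) * (y (-1/(t*u)) * x (t*u))"
    using tu(3) by (simp add: mult.assoc y_add y_add[THEN mult_tail])
  finally have "w t * w (-1) * w u = w (t * u)" by (simp add: w_def mult.assoc)
  then have "w t * w (-1) * w u * w (-1) = w (t * u) * w (-1)" by simp
  then show ?thesis by (simp add: h_def mult.assoc)
qed

lemma rank_one_swap: "rank_one y x"
proof
  fix u t :: 'a assume u: "u \<noteq> 0"
  have "y u * x (-1/u) * y u = w (-1/u)" using w_alt[of "-1/u"] u by simp
  then show "y u * x (-1/u) * y u * y t = x (-t/u\<^sup>2) * (y u * x (-1/u) * y u)"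
    using w_y[of "-1/u" t] u by (simp add: power_divide)
qed (simp_all add: x_add y_add)

end

text \<open>For lifts of matrices, \<open>h_commute\<close> comes from the commuting property,
  because diagonal matrices commute.\<close>

locale rank_one_finite = rank_one x y for x y :: "'a :: {field, finite} \<Rightarrow> 'g :: group_mult" +
  assumes h_commute: "u \<noteq> 0 \<Longrightarrow> v \<noteq> 0 \<Longrightarrow> h u * h v = h v * h u"
begin

text \<open>Conjugation by \<open>h u\<close> scales the parameters of both letters
  \<open>w v\<close> and \<open>w (-1)\<close> of \<open>h v\<close> by \<open>u\<^sup>2\<close>,
  yet fixes \<open>h v\<close>. Comparing the two words gives the claim.\<close>

lemma h_mult_square:
  assumes "u \<noteq> 0" "v \<noteq> 0" shows "h v * h (u\<^sup>2) = h (u\<^sup>2 * v)"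
proof -
  have "h u * h v = h u * w v * w (-1)" by (simp add: h_def[of v] mult.assoc)
  also have "\<dots> = w (u\<^sup>2 * v) * (h u * w (-1))" using assms by (simp add: h_w mult.assoc)
  also have "h u * w (-1) = w (-u\<^sup>2) * h u" using assms h_w[of u "-1"] by simp
  finally have "h v * h u = w (u\<^sup>2 * v) * w (-u\<^sup>2) * h u"
    using h_commute[OF assms] by (simp add: mult.assoc)
  then have "h v = w (u\<^sup>2 * v) * w (-u\<^sup>2)" by (simp add: mult_right_cancel_group)
  then show ?thesis using w_minus[of "u\<^sup>2"] by (simp add: h_def mult.assoc mult_tail)
qed

text \<open>
  Solving \<open>u * a\<^sup>2 + v * b\<^sup>2 = 1\<close> reduces the claim to \<open>h_mult_sum_one\<close>, since square factors can be
  split off.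
\<close>

lemma h_mult:
  assumes "u \<noteq> 0" "v \<noteq> 0" shows "h u * h v = h (u * v)"
proof -
  obtain a b where ab: "u * a\<^sup>2 + v * b\<^sup>2 = 1"
    using finite_field_two_squares[OF assms] .
  consider "b = 0" | "a = 0" | "a \<noteq> 0" "b \<noteq> 0" by blast
  then show ?thesis
  proof cases
    case 1
    then have "a \<noteq> 0" using ab by auto
    then have "u = (1/a)\<^sup>2" using 1 ab by (simp add: power_divide eq_divide_eq)
    then show ?thesis using h_mult_square[of "1/a" v] h_commute[OF assms] assms \<open>a \<noteq> 0\<close> by simp
  next
    case 2
    then have "b \<noteq> 0" using ab by auto
    then have "v = (1/b)\<^sup>2" using 2 ab by (simp add: power_divide eq_divide_eq)
    then show ?thesis using h_mult_square[of "1/b" u] assms \<open>b \<noteq> 0\<close> by (simp add: mult.commute)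
  next
    case 3
    have sq: "h (u * a\<^sup>2) = h u * h (a\<^sup>2)" "h (v * b\<^sup>2) = h v * h (b\<^sup>2)"
      "h (u * a\<^sup>2 * (v * b\<^sup>2)) = h (u * v) * h ((a * b)\<^sup>2)" "h ((a * b)\<^sup>2) = h (a\<^sup>2) * h (b\<^sup>2)"
      using h_mult_square[of a u] h_mult_square[of b v] h_mult_square[of "a * b" "u * v"]
        h_mult_square[of b "a\<^sup>2"] 3 assms
      by (simp_all add: power_mult_distrib mult_ac)
    have "h u * h (a\<^sup>2) * (h v * h (b\<^sup>2)) = h (u * v) * (h (a\<^sup>2) * h (b\<^sup>2))"
      using h_mult_sum_one[OF ab] 3 assms by (simp add: sq)
    moreover have "h u * h (a\<^sup>2) * (h v * h (b\<^sup>2)) = h u * h v * (h (a\<^sup>2) * h (b\<^sup>2))"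
      using h_commute[of "a\<^sup>2" v] 3 assms by (simp add: mult.assoc) (simp flip: mult.assoc)
    ultimately show ?thesis by (simp add: mult_right_cancel_group)
  qed
qed

lemma w_mult:
  assumes "u \<noteq> 0" "v \<noteq> 0" shows "w u * w v = h (- u / v)"
proof -
  have "h (-v) * h (-1/v) = 1" using h_mult[of "-v" "-1/v"] assms by simp
  then have "inverse (h (-v)) = h (-1/v)" by (rule inverse_unique_mult)
  then have "w 1 * w v = h (-1/v)"
    by (simp add: h_def inverse_mult_distrib inverse_w)
  then have "h u * (w 1 * w v) = h (-u/v)" using h_mult[of u "-1/v"] assms by simp
  then show ?thesis by (simp add: w_eq_h[of u] mult.assoc)
qed

text \<open>The Bruhat decomposition: the two forms are the matrices whose upper left entry is
  nonzero and zero, respectively. Multiplicativity of \<open>h\<close> is what closes their union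
  under left multiplication.\<close>

lemma gen_normal_form:
  assumes "k \<in> gen (range x \<union> range y)"
  shows "(\<exists>e a b. a \<noteq> 0 \<and> k = y e * h a * x b) \<or> (\<exists>c b. c \<noteq> 0 \<and> k = w c * x b)"
  using assms
proof induction
  case gen_one
  show ?case by (rule disjI1, rule exI[of _ 0], rule exI[of _ 1], rule exI[of _ 0]) simp
next
  case (gen_step s k)
  have yw: "y t * w c = w c * x (-t * c\<^sup>2)" if c: "c \<noteq> 0" for t c
    using w_x[OF c, of "-t * c\<^sup>2"] c by simp
  have xh: "x t * h a = h a * x (t/a\<^sup>2)" if a: "a \<noteq> 0" for t a
    using h_x[OF a, of "t/a\<^sup>2"] a by simp
  have wh: "w c * h a = w (c/a)" if "c \<noteq> 0" "a \<noteq> 0" for c a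
  proof -
    have "w c * h a = h (-c/a) * w (-1)"
      using w_mult[OF that] by (simp add: h_def[of a] flip: mult.assoc)
    also have "w (-1) = h (-1) * w 1" by (rule w_eq_h)
    finally show ?thesis using h_mult[of "-c/a" "-1"] that w_eq_h[of "c/a"] by (simp flip: mult.assoc)
  qed
  have x_eq: "x t = y (1/t) * w t * y (1/t)" if "t \<noteq> 0" for t
    using w_alt[OF that] by (simp add: mult.assoc y_add y_add[THEN mult_tail])
  have y_eq: "y t = x (1/t) * w (-1/t) * x (1/t)" if "t \<noteq> 0" for t
    using that by (simp add: w_def mult.assoc x_add x_add[THEN mult_tail])
  \<comment> \<open>For nonzero \<open>t\<close>, writing \<open>x t\<close> in the form
    \<open>x_eq\<close> exposes \<open>w t\<close>, and \<open>w t * w c\<close> is a torus element,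
    so the product falls into the first cell.\<close>
  have xw: "x t * w c * x b' \<in> {k. (\<exists>e a b. a \<noteq> 0 \<and> k = y e * h a * x b) \<or> (\<exists>c b. c \<noteq> 0 \<and> k = w c * x b)}"
    if c: "c \<noteq> 0" for t c b'
  proof (cases "t = 0")
    case True
    then show ?thesis using c by auto
  next
    case False
    have "x t * w c * x b' = y (1/t) * h (-t/c) * x (-(1/t) * c\<^sup>2 + b')"
      using w_mult[OF False c] c
      by (simp add: x_eq[OF False] mult.assoc yw x_add w_mult[OF False c, THEN mult_tail] del: minus_divide_left)
    moreover have "-t/c \<noteq> 0" using False c by simp
    ultimately show ?thesis by blast
  qed
  from gen_step.IH show ?case
  proof (elim disjE exE conjE)
    fix e a b assume a: "a \<noteq> 0" and k: "k = y e * h a * x b"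
    from gen_step.hyps(1) show ?thesis
    proof
      assume "s \<in> range y"
      then obtain t where "s = y t" by auto
      then have "s * k = y (t + e) * h a * x b" by (simp add: k y_add flip: mult.assoc)
      then show ?thesis using a by blast
    next
      assume "s \<in> range x"
      then obtain t where s: "s = x t" by auto
      show ?thesis
      proof (cases "e = 0")
        case True
        then have "s * k = y 0 * h a * x (t/a\<^sup>2 + b)"
          using a by (simp add: k s xh[THEN mult_tail] mult.assoc x_add)
        then show ?thesis using a by blast
      next
        case False
        have "s * k = x (t + 1/e) * w (-1/(e * a)) * x ((1/e)/a\<^sup>2 + b)"
          using False a wh[of "-1/e" a]
          by (simp add: k s y_eq[OF False] mult.assoc xh xh[THEN mult_tail] x_add x_add[THEN mult_tail] mult_tail[OF wh])
        moreover have "-1/(e*a) \<noteq> 0" using False a by simp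
        ultimately show ?thesis using xw by simp
      qed
    qed
  next
    fix c b assume c: "c \<noteq> 0" and k: "k = w c * x b"
    from gen_step.hyps(1) show ?thesis
    proof
      assume "s \<in> range y"
      then obtain t where "s = y t" by auto
      then have "s * k = w c * x (-t * c\<^sup>2 + b)"
        using yw[OF c, THEN mult_tail] by (simp add: k x_add mult.assoc)
      then show ?thesis using c by blast
    next
      assume "s \<in> range x"
      then obtain t where "s = x t" by auto
      then have "s * k = x t * w c * x b" by (simp add: k mult.assoc)
      then show ?thesis using xw[OF c, of t b] by simp
    qed
  qed
qed

end

section \<open>Groups satisfying the Steinberg relations\<close>

text \<open>Gives coordinates on the abelian unipotent radicals: root elements are collected in the
  order \<open>js\<close>, and the action on vectors can later read off \<open>f\<close>.\<close>

lemma commuting_prod_list: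
  fixes g :: "'j \<Rightarrow> 'a :: comm_monoid_add \<Rightarrow> 'g :: monoid_mult"
  assumes add: "\<And>j s t. j \<in> J \<Longrightarrow> g j s * g j t = g j (s + t)"
    and zero: "\<And>j. j \<in> J \<Longrightarrow> g j 0 = 1"
    and comm: "\<And>i j s t. i \<in> J \<Longrightarrow> j \<in> J \<Longrightarrow> g i s * g j t = g j t * g i s"
    and js: "set js = J" "distinct js"
    and k: "k \<in> gen {g j t | j t. j \<in> J}"
  shows "\<exists>f. k = prod_list (map (\<lambda>j. g j (f j)) js)"
  using k
proof induction
  case gen_one
  have "prod_list (map (\<lambda>j. g j 0) js) = 1" if "set js \<subseteq> J" for js
    using that by (induction js) (auto simp: zero)
  from this[of js] show ?case using js by (intro exI[of _ "\<lambda>_. 0"]) simp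
next
  case (gen_step s k)
  then obtain i t f where s: "i \<in> J" "s = g i t" and k: "k = prod_list (map (\<lambda>j. g j (f j)) js)"
    by auto
  have "g i t * prod_list (map (\<lambda>j. g j (f j)) js)
      = prod_list (map (\<lambda>j. g j ((f(i := t + f i)) j)) js)" if "i \<in> set js" "set js \<subseteq> J" "distinct js" for js
    using that
  proof (induction js)
    case (Cons j js)
    show ?case
    proof (cases "j = i")
      case True
      then have "prod_list (map (\<lambda>j. g j ((f(i := t + f i)) j)) js) = prod_list (map (\<lambda>j. g j (f j)) js)"
        using Cons.prems by (intro arg_cong[of _ _ prod_list] map_cong) auto
      moreover have "g i t * (g i (f i) * z) = g i (t + f i) * z" for z
        using s(1) by (simp add: add flip: mult.assoc)
      ultimately show ?thesis using True by (simp del: fun_upd_apply) simp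
    next
      case False
      then have "g i t * g j (f j) = g j (f j) * g i t" using Cons.prems comm s(1) by auto
      then show ?thesis using False Cons by (simp add: mult_tail mult.assoc)
    qed
  qed simp
  from this[of js] show ?case using s js k by auto
qed

text \<open>The action of an elementary matrix on column vectors. Vectors are functions on all of
  \<open>nat\<close>, so that one action serves every index set.\<close>

definition transv :: "nat \<Rightarrow> nat \<Rightarrow> 'a \<Rightarrow> (nat \<Rightarrow> 'a) \<Rightarrow> nat \<Rightarrow> 'a :: semiring_0" where
  "transv i j t v = v(i := v i + t * v j)"

text \<open>
  The relations of Steinberg's presentation. Instead of the vanishing of the symbols, only
  commutativity of the elements \<open>h u\<close> is required (inside \<open>rank_one_finite\<close>); \<open>\<rho>\<close> is the action on
  vectors, with respect to which the presented group turns out to be faithful.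
\<close>

locale steinberg_lift =
  fixes I :: "nat set" and x :: "nat \<Rightarrow> nat \<Rightarrow> 'a :: {field, finite} \<Rightarrow> 'g :: group_mult"
    and \<rho> :: "'g \<Rightarrow> (nat \<Rightarrow> 'a) \<Rightarrow> nat \<Rightarrow> 'a"
  assumes finite_I: "finite I"
    and add: "i \<in> I \<Longrightarrow> j \<in> I \<Longrightarrow> i \<noteq> j \<Longrightarrow> x i j s * x i j t = x i j (s + t)"
    and commute: "\<lbrakk>i \<in> I; j \<in> I; k \<in> I; l \<in> I; i \<noteq> j; k \<noteq> l; i \<noteq> l; j \<noteq> k\<rbrakk>
      \<Longrightarrow> x i j s * x k l t = x k l t * x i j s"
    and steinberg: "\<lbrakk>i \<in> I; j \<in> I; k \<in> I; i \<noteq> j; j \<noteq> k; i \<noteq> k\<rbrakk>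
      \<Longrightarrow> x i j s * x j k t = x i k (s * t) * x j k t * x i j s"
    and rank_one: "i \<in> I \<Longrightarrow> j \<in> I \<Longrightarrow> i \<noteq> j \<Longrightarrow> rank_one_finite (x i j) (x j i)"
    and rho_one: "\<rho> 1 = id"
    and rho_mult: "\<lbrakk>g \<in> gen {x i j t | i j t. i \<in> I \<and> j \<in> I \<and> i \<noteq> j};
      g' \<in> gen {x i j t | i j t. i \<in> I \<and> j \<in> I \<and> i \<noteq> j}\<rbrakk> \<Longrightarrow> \<rho> (g * g') = \<rho> g \<circ> \<rho> g'"
    and rho_x: "i \<in> I \<Longrightarrow> j \<in> I \<Longrightarrow> i \<noteq> j \<Longrightarrow> \<rho> (x i j t) = transv i j t"
begin

definition K where "K J = gen {x i j t | i j t. i \<in> J \<and> j \<in> J \<and> i \<noteq> j}"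

lemma x_zero: "i \<in> I \<Longrightarrow> j \<in> I \<Longrightarrow> i \<noteq> j \<Longrightarrow> x i j 0 = 1"
  using rank_one_finite.axioms(1)[OF rank_one] by (rule rank_one.x_zero)

lemma inverse_x: "i \<in> I \<Longrightarrow> j \<in> I \<Longrightarrow> i \<noteq> j \<Longrightarrow> inverse (x i j t) = x i j (-t)"
  using rank_one_finite.axioms(1)[OF rank_one] by (rule rank_one.inverse_x)

lemma K_mono: "J \<subseteq> J' \<Longrightarrow> K J \<subseteq> K J'"
  unfolding K_def by (rule gen_mono) auto

lemma x_in_K: "i \<in> J \<Longrightarrow> j \<in> J \<Longrightarrow> i \<noteq> j \<Longrightarrow> x i j t \<in> K J"
  unfolding K_def by (rule gen_incl) auto

lemma K_mult: "k \<in> K J \<Longrightarrow> l \<in> K J \<Longrightarrow> k * l \<in> K J"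
  unfolding K_def by (rule gen_mult)

lemma K_one: "1 \<in> K J"
  unfolding K_def by (rule gen_one)

lemma K_inverse: "J \<subseteq> I \<Longrightarrow> k \<in> K J \<Longrightarrow> inverse k \<in> K J"
  unfolding K_def by (rule gen_inverse) (fastforce intro!: gen_incl simp: inverse_x subset_eq)+

lemma rho_K: "k \<in> K I \<Longrightarrow> k' \<in> K I \<Longrightarrow> \<rho> (k * k') v = \<rho> k (\<rho> k' v)"
  using rho_mult[of k k'] by (simp add: K_def)

lemma K_induct [consumes 2, case_names one step]:
  assumes "k \<in> K J" "J \<subseteq> I" "P 1"
    and "\<And>i j t k. \<lbrakk>i \<in> J; j \<in> J; i \<noteq> j; k \<in> K J; J \<subseteq> I; P k\<rbrakk> \<Longrightarrow> P (x i j t * k)"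
  shows "P k"
  using assms(1,2,3) unfolding K_def
  by (induction rule: gen.induct) (auto simp: K_def intro: assms(4))

lemma rho_step:
  "\<lbrakk>i \<in> J; j \<in> J; i \<noteq> j; k \<in> K J; J \<subseteq> I\<rbrakk> \<Longrightarrow> \<rho> (x i j t * k) v = transv i j t (\<rho> k v)"
  using rho_K[of "x i j t" k v] x_in_K[of i I j t] subsetD[OF K_mono[of J I], of k] rho_x[of i j t]
  by (auto simp: subset_eq)

lemma rho_outside:
  assumes "k \<in> K J" "J \<subseteq> I" "i \<notin> J" shows "\<rho> k v i = v i"
  using assms by (induction arbitrary: v rule: K_induct) (auto simp: rho_one rho_step transv_def)

lemma rho_fix:
  assumes "k \<in> K J" "J \<subseteq> I" "\<And>j. j \<in> J \<Longrightarrow> v j = 0" shows "\<rho> k v = v"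
  using assms by (induction rule: K_induct) (auto simp: rho_one rho_step transv_def)

lemma rho_add:
  assumes "k \<in> K J" "J \<subseteq> I" shows "\<rho> k (\<lambda>i. u i + v i) = (\<lambda>i. \<rho> k u i + \<rho> k v i)"
  using assms by (induction rule: K_induct) (auto simp: rho_one rho_step transv_def fun_eq_iff algebra_simps)

lemma rho_inverse:
  assumes "k \<in> K I" shows "\<rho> (inverse k) (\<rho> k v) = v" "\<rho> k (\<rho> (inverse k) v) = v"
  using rho_K[of "inverse k" k v] rho_K[of k "inverse k" v] K_inverse[OF order_refl assms] assms
  by (simp_all add: rho_one)

text \<open>Coordinate \<open>j\<close> is a nonzero pivot that already has its final value; a
  transvection from \<open>j\<close> corrects each coordinate in \<open>T\<close>.\<close>

lemma transitive_aux:
  assumes J: "J \<subseteq> I" "j \<in> J" "T \<subseteq> J - {j}" and v: "v j = f j" "f j \<noteq> 0"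
  shows "\<exists>k\<in>K J. \<rho> k v = (\<lambda>i. if i \<in> T then f i else v i)"
proof -
  have "finite T" using J finite_I by (meson finite_Diff finite_subset)
  then show ?thesis using J(3)
  proof (induction T)
    case empty
    show ?case using K_one by (auto simp: rho_one intro!: bexI[of _ 1])
  next
    case (insert l T)
    then obtain k where k: "k \<in> K J" "\<rho> k v = (\<lambda>i. if i \<in> T then f i else v i)" by auto
    have l: "l \<in> J" "l \<noteq> j" "j \<notin> T" using insert by auto
    show ?case
    proof (rule bexI)
      show "\<rho> (x l j ((f l - v l) / f j) * k) v = (\<lambda>i. if i \<in> insert l T then f i else v i)"
        using l J k v insert.hyps by (subst rho_step[where J = J]) (auto simp: transv_def fun_eq_iff)
      show "x l j ((f l - v l) / f j) * k \<in> K J"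
        using l J k by (intro K_mult x_in_K) auto
    qed
  qed
qed

lemma transitive:
  assumes J: "J \<subseteq> I" "r \<in> J" "J \<noteq> {r}" and f: "\<And>i. i \<notin> J \<Longrightarrow> f i = 0" "\<exists>i. f i \<noteq> 0"
  shows "\<exists>k\<in>K J. \<rho> k (\<lambda>i. if i = r then 1 else 0) = f"
proof -
  let ?e = "\<lambda>i. if i = r then 1 else (0 :: 'a)"
  have main: "\<exists>k\<in>K J. \<rho> k ?e = g" if j: "j \<in> J" "j \<noteq> r" "g j \<noteq> 0" and g: "\<And>i. i \<notin> J \<Longrightarrow> g i = 0" for g j
  proof -
    have e: "\<rho> (x j r (g j)) ?e = (\<lambda>i. if i = j then g j else ?e i)" (is "_ = ?v")
      using j J rho_x[of j r "g j"] by (subst rho_x) (auto simp: transv_def fun_eq_iff)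
    obtain k where k: "k \<in> K J" "\<rho> k ?v = (\<lambda>i. if i \<in> J - {j} then g i else ?v i)"
      using transitive_aux[of J j "J - {j}" ?v g] j J by auto
    have "\<rho> (k * x j r (g j)) ?e = \<rho> k (\<rho> (x j r (g j)) ?e)"
      using k j J K_mono[of J I] x_in_K[of j J r "g j"] by (intro rho_K) auto
    also have "\<dots> = g" unfolding e k(2) using g J by (auto simp: fun_eq_iff)
    finally have "\<rho> (k * x j r (g j)) ?e = g" .
    then show ?thesis using k j J by (intro bexI[of _ "k * x j r (g j)"] K_mult x_in_K) auto
  qed
  show ?thesis
  proof (cases "\<exists>j\<in>J. j \<noteq> r \<and> f j \<noteq> 0")
    case True
    then show ?thesis using main f by blast
  next
    case False
    then have fr: "f r \<noteq> 0" using f J by metis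
    obtain j where j: "j \<in> J" "j \<noteq> r" using J by auto
    \<comment> \<open>The target is a multiple of the basis vector at \<open>r\<close>, so there is
      no pivot away from \<open>r\<close>. A detour through \<open>g\<close> creates one at
      \<open>j\<close>, which is then cleared again.\<close>
    define g where "g = (\<lambda>i. if i = j then 1 else f i)"
    have "\<And>i. i \<notin> J \<Longrightarrow> g i = 0" using j f by (auto simp: g_def)
    then obtain k where k: "k \<in> K J" "\<rho> k ?e = g" using main[of j g] j by (auto simp: g_def)
    have "\<rho> (x j r (-1 / f r) * k) ?e = f"
      using k j J fr False by (subst rho_step[where J = J]) (auto simp: transv_def g_def fun_eq_iff)
    then show ?thesis using k j J by (intro bexI[of _ "x j r (-1 / f r) * k"] K_mult x_in_K) auto
  qed
qed

end

text \<open>Normalisation in one direction can be tested on generators, without inverses: each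
  letter of \<open>g\<close> is moved to the left through all letters of \<open>n\<close>.\<close>

lemma gen_swap:
  fixes S T :: "'g :: monoid_mult set"
  assumes swap: "\<And>s t. s \<in> S \<Longrightarrow> t \<in> T \<Longrightarrow> \<exists>n\<in>gen S. s * t = t * n"
    and "n \<in> gen S" "g \<in> gen T"
  shows "\<exists>n'\<in>gen S. n * g = g * n'"
  using assms(3,2)
proof (induction arbitrary: n)
  case gen_one
  then show ?case by auto
next
  case (gen_step t g)
  have "\<exists>n'\<in>gen S. n * t = t * n'" using \<open>n \<in> gen S\<close>
  proof induction
    case gen_one
    show ?case by (auto intro: gen.gen_one intro!: bexI[of _ 1])
  next
    case (gen_step s n)
    then obtain n1 n2 where n: "n1 \<in> gen S" "n * t = t * n1" "n2 \<in> gen S" "s * t = t * n2"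
      using swap \<open>t \<in> T\<close> by meson
    then have "s * n * t = t * (n2 * n1)" by (simp add: mult.assoc) (simp flip: mult.assoc)
    then show ?case using n by (blast intro: gen_mult)
  qed
  then obtain n1 where n1: "n1 \<in> gen S" "n * t = t * n1" by blast
  then obtain n2 where n2: "n2 \<in> gen S" "n1 * g = g * n2" using gen_step.IH by blast
  have "n * (t * g) = t * g * n2" using n1 n2 by (metis mult.assoc)
  then show ?case using n2 by blast
qed

context steinberg_lift
begin

text \<open>
  \<open>K1\<close> plays the role of the stabiliser of the basis vector \<open>e\<^sub>p\<close>, and \<open>N\<close>, \<open>Y\<close> are the unipotent
  radicals of the two opposite maximal parabolic subgroups. The aim is the decomposition
  \<open>K J = K (J - {p}) * K {p, r} * K1\<close>, which reduces the kernel to rank one and to \<open>J - {p}\<close>.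
\<close>

context
  fixes J p r
  assumes J: "J \<subseteq> I" "p \<in> J" "r \<in> J" "p \<noteq> r"
begin

interpretation R: rank_one_finite "x p r" "x r p"
  using rank_one J by auto

private definition "K1 = gen {x i j t | i j t. i \<in> J \<and> j \<in> J - {p} \<and> i \<noteq> j}"
private definition "N = gen {x p j t | j t. j \<in> J - {p}}"
private definition "Y = gen {x i p t | i t. i \<in> J - {p}}"

lemma in_I: "i \<in> J \<Longrightarrow> i \<in> I"
  using J by auto

lemma K'_K1: "K (J - {p}) \<subseteq> K1"
  unfolding K_def K1_def by (rule gen_mono) auto

lemma K1_mult: "k \<in> K1 \<Longrightarrow> l \<in> K1 \<Longrightarrow> k * l \<in> K1"
  unfolding K1_def by (rule gen_mult)

lemma x_in_K1: "i \<in> J \<Longrightarrow> j \<in> J \<Longrightarrow> j \<noteq> p \<Longrightarrow> i \<noteq> j \<Longrightarrow> x i j t \<in> K1"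
  unfolding K1_def by (rule gen_incl) auto

lemma one_in_K1: "1 \<in> K1"
  unfolding K1_def by (rule gen_one)

lemma N_swap:
  assumes "n \<in> N" "k \<in> K (J - {p})" shows "\<exists>n'\<in>N. n * k = k * n'"
proof -
  have "\<exists>n\<in>gen {x p j t | j t. j \<in> J - {p}}. s * t = t * n"
    if "s \<in> {x p j t | j t. j \<in> J - {p}}"
      "t \<in> {x i j t | i j t. i \<in> J - {p} \<and> j \<in> J - {p} \<and> i \<noteq> j}" for s t
  proof -
    from that obtain j a k l b where s: "s = x p j a" "j \<in> J" "j \<noteq> p" and
      t: "t = x k l b" "k \<in> J" "k \<noteq> p" "l \<in> J" "l \<noteq> p" "k \<noteq> l" by auto
    have sN: "s \<in> gen {x p j t | j t. j \<in> J - {p}}" using s by (intro gen_incl) auto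
    show ?thesis
    proof (cases "j = k")
      case True
      have "s * t = x p l (a * b) * t * s"
        using steinberg[of p k l a b] s t True J in_I by auto
      also have "x p l (a * b) * t = t * x p l (a * b)"
        using commute[of p l k l] s t True J in_I by auto
      finally have "s * t = t * (x p l (a * b) * s)" by (simp add: mult.assoc)
      moreover have "x p l (a * b) \<in> gen {x p j t | j t. j \<in> J - {p}}"
        using t by (intro gen_incl) auto
      ultimately show ?thesis using gen_mult sN by blast
    next
      case False
      then have "s * t = t * s" using commute[of p j k l] s t J in_I by auto
      then show ?thesis using sN by blast
    qed
  qed
  from gen_swap[OF this] show ?thesis using assms unfolding N_def K_def by blast
qed

lemma N_swap':
  assumes "n \<in> N" "k \<in> K (J - {p})" shows "\<exists>n'\<in>N. k * n = n' * k"
proof -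
  have "inverse k \<in> K (J - {p})" using assms(2) J by (intro K_inverse) auto
  then obtain n' where n': "n' \<in> N" "n * inverse k = inverse k * n'" using N_swap assms(1) by blast
  have "k * (n * inverse k) * k = k * (inverse k * n') * k" by (simp only: n')
  then have "k * n = n' * k" by (simp add: mult.assoc)
  then show ?thesis using n' by blast
qed

lemma Y_swap:
  assumes "n \<in> Y" "k \<in> K (J - {p})" shows "\<exists>n'\<in>Y. n * k = k * n'"
proof -
  have "\<exists>n\<in>gen {x i p t | i t. i \<in> J - {p}}. s * t = t * n"
    if "s \<in> {x i p t | i t. i \<in> J - {p}}"
      "t \<in> {x i j t | i j t. i \<in> J - {p} \<and> j \<in> J - {p} \<and> i \<noteq> j}" for s t
  proof -
    from that obtain i a k l b where s: "s = x i p a" "i \<in> J" "i \<noteq> p" and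
      t: "t = x k l b" "k \<in> J" "k \<noteq> p" "l \<in> J" "l \<noteq> p" "k \<noteq> l" by auto
    have sN: "s \<in> gen {x i p t | i t. i \<in> J - {p}}" using s by (intro gen_incl) auto
    show ?thesis
    proof (cases "i = l")
      case True
      have "t * s = x k p (b * a) * s * t"
        using steinberg[of k l p b a] s t True J in_I by auto
      then have "x k p (- (b * a)) * (t * s) = x k p (- (b * a)) * (x k p (b * a) * s * t)" by simp
      also have "\<dots> = s * t"
        using add[of k p "- (b * a)" "b * a"] x_zero[of k p] t J in_I by (simp flip: mult.assoc)
      also have "x k p (- (b * a)) * (t * s) = t * (x k p (- (b * a)) * s)"
        using commute[of k p k l "- (b * a)" b] t J in_I by (simp flip: mult.assoc)
      finally have "s * t = t * (x k p (- (b * a)) * s)" by simp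
      moreover have "x k p (- (b * a)) \<in> gen {x i p t | i t. i \<in> J - {p}}"
        using t by (intro gen_incl) auto
      ultimately show ?thesis using gen_mult sN by blast
    next
      case False
      then have "s * t = t * s" using commute[of i p k l] s t J in_I by auto
      then show ?thesis using sN by blast
    qed
  qed
  from gen_swap[OF this] show ?thesis using assms unfolding Y_def K_def by blast
qed

lemma K_pr: "K {p, r} = gen (range (x p r) \<union> range (x r p))"
  unfolding K_def using J by (intro arg_cong[of _ _ gen]) auto

text \<open>Rows \<open>p\<close>, \<open>r\<close> and columns outside form the radical of a
  parabolic with Levi factor \<open>K {p, r}\<close>. It lies in \<open>K1\<close>, so whatever is
  moved past \<open>K {p, r}\<close> in this way gets absorbed there.\<close>

lemma V_swap:
  assumes "n \<in> gen {x i j t | i j t. i \<in> {p, r} \<and> j \<in> J - {p, r}}" "s \<in> K {p, r}"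
  shows "\<exists>n'\<in>gen {x i j t | i j t. i \<in> {p, r} \<and> j \<in> J - {p, r}}. n * s = s * n'"
proof -
  let ?V = "{x i j t | i j t. i \<in> {p, r} \<and> j \<in> J - {p, r}}"
  have "\<exists>n\<in>gen ?V. s * t = t * n"
    if "s \<in> ?V" "t \<in> {x i j t | i j t. i \<in> {p, r} \<and> j \<in> {p, r} \<and> i \<noteq> j}" for s t
  proof -
    from that obtain i j a k l b where s: "s = x i j a" "i \<in> {p, r}" "j \<in> J" "j \<notin> {p, r}" and
      t: "t = x k l b" "k \<in> {p, r}" "l \<in> {p, r}" "k \<noteq> l" by blast
    have sN: "s \<in> gen ?V" using that(1) by (rule gen_incl)
    have inI: "i \<in> I" "j \<in> I" "k \<in> I" "l \<in> I" using s t J in_I by auto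
    show ?thesis
    proof (cases "i = l")
      case True
      have kj: "k \<noteq> j" "i \<noteq> j" using s t by auto
      have "t * s = x k j (b * a) * s * t"
        using steinberg[of k l j b a] s(1) t(1,4) True inI kj by auto
      then have "x k j (- (b * a)) * (t * s) = x k j (- (b * a)) * (x k j (b * a) * s * t)" by simp
      also have "\<dots> = s * t"
        using add[of k j "- (b * a)" "b * a"] x_zero[of k j] inI kj by (simp flip: mult.assoc)
      also have "x k j (- (b * a)) * (t * s) = t * (x k j (- (b * a)) * s)"
        using commute[of k j k l "- (b * a)" b] t inI kj by (simp flip: mult.assoc)
      finally have "s * t = t * (x k j (- (b * a)) * s)" by simp
      moreover have "x k j (- (b * a)) \<in> gen ?V"
        using s t by (intro gen_incl) auto
      ultimately show ?thesis using gen_mult sN by blast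
    next
      case False
      then have "s * t = t * s" using commute[of i j k l] s t inI by auto
      then show ?thesis using sN by blast
    qed
  qed
  from gen_swap[OF this] show ?thesis using assms unfolding K_def by blast
qed

text \<open>Of the letters of \<open>n\<close>, those in column \<open>r\<close> belong to
  \<open>K {p, r}\<close> and the others pass through it into \<open>K1\<close> by
  \<open>V_swap\<close>.\<close>

lemma N_S:
  assumes "n \<in> N" "s \<in> K {p, r}" "k \<in> K1"
  shows "\<exists>s'\<in>K {p, r}. \<exists>k'\<in>K1. n * (s * k) = s' * k'"
  using assms unfolding N_def
proof (induction arbitrary: s k rule: gen.induct)
  case gen_one
  then show ?case by auto
next
  case (gen_step g n)
  then obtain s' k' where sk: "s' \<in> K {p, r}" "k' \<in> K1" "n * (s * k) = s' * k'" by blast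
  from gen_step obtain j t where g: "g = x p j t" "j \<in> J" "j \<noteq> p" by auto
  show ?case
  proof (cases "j = r")
    case True
    then have "g * s' \<in> K {p, r}" using g sk J by (intro K_mult) (auto intro: x_in_K)
    moreover have "g * n * (s * k) = g * s' * k'" using sk by (simp add: mult.assoc)
    ultimately show ?thesis using sk by blast
  next
    case False
    have V: "gen {x i j t | i j t. i \<in> {p, r} \<and> j \<in> J - {p, r}} \<subseteq> K1"
      unfolding K1_def by (rule gen_mono) (use J in auto)
    have "g \<in> gen {x i j t | i j t. i \<in> {p, r} \<and> j \<in> J - {p, r}}"
      using g False by (intro gen_incl) auto
    then obtain n' where n': "n' \<in> K1" "g * s' = s' * n'" using V_swap[OF _ sk(1)] V by blast
    have "g * n * (s * k) = g * s' * k'" using sk by (simp add: mult.assoc)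
    then have "g * n * (s * k) = s' * (n' * k')" using n' by (simp add: mult.assoc)
    then show ?thesis using sk n' K1_mult by blast
  qed
qed

text \<open>A Weyl element exchanges columns \<open>p\<close> and \<open>r\<close> up to scalars.
  This must be derived letter by letter from the relations, since faithfulness of the action is
  still to be shown.\<close>

lemma column_w:
  assumes j: "j \<in> J" "j \<noteq> p" "j \<noteq> r" and c: "c \<noteq> 0"
  shows "x j p t * R.w c = R.w c * x j r (t * c)"
    and "x j r t * R.w c = R.w c * x j p (- t / c)"
proof -
  define A B where "A = x p r c" and "B = x r p (-1/c)"
  have I: "j \<in> I" "p \<in> I" "r \<in> I" using in_I j J by auto
  have 1: "x j p s * A = x j r (s * c) * (A * x j p s)" for s
    unfolding A_def using steinberg[of j p r s c] I j J by (simp add: mult.assoc)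
  have 2: "x j r s * A = A * x j r s" for s
    unfolding A_def using commute[of j r p r] I j J by simp
  have 3: "x j p s * B = B * x j p s" for s
    unfolding B_def using commute[of j p r p] I j J by simp
  have 4: "x j r s * B = x j p (s * (-1/c)) * (B * x j r s)" for s
    unfolding B_def using steinberg[of j r p s "-1/c"] I j J by (simp add: mult.assoc)
  have 5: "x j p s * x j r u = x j r u * x j p s" for s u
    using commute[of j p j r] I j J by simp
  have 6: "x j p s * x j p u = x j p (s + u)" "x j r s * x j r u = x j r (s + u)" for s u
    using add I j J by auto
  have 7: "x j p 0 = 1" "x j r 0 = 1" using x_zero I j by auto
  note rules = 1 2 3 4 5 6
  have w: "R.w c = A * (B * A)" by (simp add: R.w_def A_def B_def mult.assoc)
  show "x j p t * R.w c = R.w c * x j r (t * c)"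
    using c by (simp add: w mult.assoc rules rules[THEN mult_tail] 7)
  show "x j r t * R.w c = R.w c * x j p (- t / c)"
    using c by (simp add: w mult.assoc rules rules[THEN mult_tail] 7)
qed

text \<open>After the exchange of columns, no letter of \<open>y\<close> has second index
  \<open>p\<close> any more.\<close>

lemma Y_w:
  assumes "y \<in> Y" "c \<noteq> 0" shows "\<exists>k\<in>K1. y * R.w c = R.w c * k"
  using assms(1) unfolding Y_def
proof induction
  case gen_one
  then show ?case using one_in_K1 by (auto intro: bexI[of _ 1])
next
  case (gen_step s y)
  then obtain k where k: "k \<in> K1" "y * R.w c = R.w c * k" by blast
  from gen_step obtain i t where s: "s = x i p t" "i \<in> J" "i \<noteq> p" by auto
  have "\<exists>k'\<in>K1. s * R.w c = R.w c * k'"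
  proof (cases "i = r")
    case True
    have "s * R.w c = R.w c * x p r (- t * c\<^sup>2)"
      using R.w_x[OF assms(2), of "- t * c\<^sup>2"] True s assms(2) by simp
    then show ?thesis using x_in_K1[of p r] J by blast
  next
    case False
    then show ?thesis using column_w(1)[of i c t] x_in_K1[of i r] s J assms(2) by blast
  qed
  then obtain k' where k': "k' \<in> K1" "s * R.w c = R.w c * k'" by blast
  have "s * y * R.w c = R.w c * (k' * k)"
    using k k'(2)[THEN mult_tail, of k] by (simp add: mult.assoc)
  then show ?case using K1_mult k k' by blast
qed

text \<open>Membership in \<open>K1\<close> is all that the double coset argument asks for; this
  lets \<open>V_swap\<close> deal with row \<open>r\<close>, while column \<open>r\<close> needs
  \<open>column_w\<close> twice.\<close>

lemma K'_h:
  assumes "k \<in> K (J - {p})" "a \<noteq> 0" shows "\<exists>k'\<in>K1. k * R.h a = R.h a * k'"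
proof -
  have "J - {p} \<subseteq> I" using J by auto
  with assms(1) show ?thesis
  proof (induction rule: K_induct)
    case one
    then show ?case using one_in_K1 by (auto intro: bexI[of _ 1])
  next
    case (step i j t k)
    then obtain k1 where k1: "k1 \<in> K1" "k * R.h a = R.h a * k1" by blast
    have hK: "R.h a \<in> K {p, r}"
      unfolding R.h_def R.w_def using J by (intro K_mult x_in_K) auto
    have "\<exists>k'\<in>K1. x i j t * R.h a = R.h a * k'"
    proof (cases "j = r")
      case True
      have "x i r t * R.h a = x i r t * R.w a * R.w (-1)" by (simp add: R.h_def mult.assoc)
      also have "x i r t * R.w a = R.w a * x i p (- t / a)"
        using column_w(2)[of i a t] True step assms(2) by simp
      also have "\<dots> * R.w (-1) = R.w a * (x i p (- t / a) * R.w (-1))" by (simp add: mult.assoc)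
      also have "\<dots> = R.h a * x i r (t / a)"
        using column_w(1)[of i "-1" "- t / a"] True step assms(2) by (simp add: R.h_def mult.assoc)
      finally show ?thesis using x_in_K1[of i r] True step J by blast
    next
      case False
      note jr = this
      show ?thesis
      proof (cases "i = r")
        case True
        have "x i j t \<in> gen {x i j t | i j t. i \<in> {p, r} \<and> j \<in> J - {p, r}}"
          using True jr step by (intro gen_incl) auto
        moreover have "gen {x i j t | i j t. i \<in> {p, r} \<and> j \<in> J - {p, r}} \<subseteq> K1"
          unfolding K1_def by (rule gen_mono) (use J in auto)
        ultimately show ?thesis using V_swap[OF _ hK] by blast
      next
        case False
        have "x i j t * x p r c = x p r c * x i j t" "x i j t * x r p c = x r p c * x i j t" for c
          using commute[of i j p r] commute[of i j r p] step jr False J in_I by auto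
        note rules = this
        have "x i j t * R.h a = R.h a * x i j t"
          by (simp add: R.h_def R.w_def mult.assoc rules rules[THEN mult_tail])
        then show ?thesis using x_in_K1[of i j] step by auto
      qed
    qed
    then obtain k' where k': "k' \<in> K1" "x i j t * R.h a = R.h a * k'" by blast
    have "x i j t * k * R.h a = R.h a * (k' * k1)"
      using k1 k'(2)[THEN mult_tail, of k1] by (simp add: mult.assoc)
    then show ?case using K1_mult k1 k' by blast
  qed
qed

lemma rho_K_J: "k \<in> K J \<Longrightarrow> l \<in> K J \<Longrightarrow> \<rho> (k * l) v = \<rho> k (\<rho> l v)"
  using rho_K K_mono[OF J(1)] by blast

lemma rho_w:
  assumes "c \<noteq> 0" shows "\<rho> (R.w c) v = v(p := c * v r, r := - v p / c)"
proof -
  have "\<rho> (R.w c) v = transv p r c (transv r p (-1/c) (transv p r c v))"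
    using J rho_x by (simp add: R.w_def rho_K_J K_mult x_in_K in_I)
  then show ?thesis using assms J by (auto simp: transv_def fun_eq_iff field_simps)
qed

lemma w_in_K: "R.w c \<in> K J"
  unfolding R.w_def using J by (intro K_mult x_in_K) auto

lemma rho_h:
  assumes "a \<noteq> 0" shows "\<rho> (R.h a) v = v(p := a * v p, r := v r / a)"
  using assms J by (auto simp: R.h_def rho_K_J w_in_K rho_w fun_eq_iff)

lemma h_in_K: "R.h a \<in> K J"
  unfolding R.h_def by (intro K_mult w_in_K)

lemma row_product:
  assumes "distinct js" "set js \<subseteq> J - {p}"
  shows "prod_list (map (\<lambda>j. x p j (f j)) js) \<in> K J \<and>
    \<rho> (prod_list (map (\<lambda>j. x p j (f j)) js)) v = v(p := v p + (\<Sum>j\<in>set js. f j * v j))"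
  using assms
proof (induction js)
  case Nil
  then show ?case by (simp add: K_one rho_one)
next
  case (Cons j js)
  then have j: "j \<in> J" "p \<noteq> j" by auto
  show ?case using Cons j J x_in_K[OF J(2) j, of "f j"] rho_x[of p j "f j"]
    by (auto simp: rho_K_J K_mult in_I transv_def fun_eq_iff algebra_simps)
qed

lemma column_product:
  assumes "distinct js" "set js \<subseteq> J - {p}"
  shows "prod_list (map (\<lambda>i. x i p (f i)) js) \<in> K J \<and>
    \<rho> (prod_list (map (\<lambda>i. x i p (f i)) js)) v = (\<lambda>i. if i \<in> set js then v i + f i * v p else v i)"
  using assms
proof (induction js)
  case Nil
  then show ?case by (simp add: K_one rho_one)
next
  case (Cons j js)
  then have j: "j \<in> J" "j \<noteq> p" by auto
  show ?case using Cons j J x_in_K[OF j(1) J(2) j(2), of "f j"] rho_x[of j p "f j"]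
    by (auto simp: rho_K_J K_mult in_I transv_def fun_eq_iff)
qed

lemma J_list: obtains js where "distinct js" "set js = J - {p}"
  using finite_distinct_list[of "J - {p}"] finite_subset[OF J(1) finite_I] by auto

lemma N_product:
  assumes "n \<in> N" "distinct js" "set js = J - {p}"
  obtains f where "n = prod_list (map (\<lambda>j. x p j (f j)) js)"
proof -
  have "\<exists>f. n = prod_list (map (\<lambda>j. x p j (f j)) js)"
  proof (rule commuting_prod_list[where J = "J - {p}"])
    show "n \<in> gen {x p j t | j t. j \<in> J - {p}}" using assms(1) by (simp add: N_def)
  qed (use assms J in_I in \<open>auto intro: add x_zero commute\<close>)
  then show thesis using that by blast
qed

lemma Y_product:
  assumes "y \<in> Y" "distinct js" "set js = J - {p}"
  obtains f where "y = prod_list (map (\<lambda>i. x i p (f i)) js)"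
proof -
  have "\<exists>f. y = prod_list (map (\<lambda>i. x i p (f i)) js)"
  proof (rule commuting_prod_list[where J = "J - {p}" and g = "\<lambda>i. x i p"])
    show "y \<in> gen {x i p t | i t. i \<in> J - {p}}" using assms(1) by (simp add: Y_def)
  qed (use assms J in_I in \<open>auto intro: add x_zero commute\<close>)
  then show thesis using that by blast
qed

lemma N_faithful:
  assumes "n \<in> N" "\<rho> n = id" shows "n = 1"
proof -
  obtain js where js: "distinct js" "set js = J - {p}" by (rule J_list)
  obtain f where n: "n = prod_list (map (\<lambda>j. x p j (f j)) js)"
    using N_product[OF assms(1) js] .
  have f: "f j = 0" if "j \<in> J - {p}" for j
  proof -
    let ?e = "\<lambda>i. if i = j then 1 else (0 :: 'a)"
    have "j \<in> set js" using js that by simp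
    then have "(\<Sum>i\<in>set js. f i * ?e i) = f j" by (simp add: if_distrib cong: if_cong)
    moreover have "\<rho> n ?e p = (\<Sum>i\<in>set js. f i * ?e i)"
      using row_product[of js f ?e] js that by (simp add: n)
    ultimately show ?thesis using assms(2) that by (simp split: if_splits)
  qed
  have "prod_list (map (\<lambda>j. x p j (f j)) l) = 1" if "set l \<subseteq> J - {p}" for l
    using that by (induction l) (use J in_I f x_zero in auto)
  then show ?thesis using js n by simp
qed

text \<open>\<open>Y\<close> is the space of vectors on \<open>J - {p}\<close>, acted on by
  \<open>K (J - {p})\<close>. With at least two indices left, the action is transitive on nonzero
  vectors, so a single root element represents each orbit.\<close>

lemma Y_conj:
  assumes "y \<in> Y" "J \<noteq> {p, r}"
  obtains k t where "k \<in> K (J - {p})" "y = k * x r p t * inverse k"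
proof -
  let ?e = "\<lambda>j i. if i = j then 1 else (0 :: 'a)"
  obtain js where js: "distinct js" "set js = J - {p}" by (rule J_list)
  obtain f where y: "y = prod_list (map (\<lambda>i. x i p (f i)) js)"
    using Y_product[OF assms(1) js] .
  define g where "g = (\<lambda>i. if i \<in> J - {p} then f i else 0)"
  show thesis
  proof (cases "\<exists>i. g i \<noteq> 0")
    case False
    have "prod_list (map (\<lambda>i. x i p (f i)) l) = 1" if "set l \<subseteq> J - {p}" for l
      using that
    proof (induction l)
      case (Cons i l)
      then have "g i = f i" by (simp add: g_def)
      then show ?case using Cons False J x_zero[of i p] in_I by auto
    qed simp
    then have "y = 1" using js y by simp
    then show thesis using that[of 1 0] K_one J x_zero[of r p] in_I by auto
  next
    case True
    have "J - {p} \<noteq> {r}" using J assms(2) by auto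
    moreover have "g i = 0" if "i \<notin> J - {p}" for i using that by (auto simp: g_def)
    ultimately obtain k where k: "k \<in> K (J - {p})" "\<rho> k (?e r) = g"
      using transitive[of "J - {p}" r g] J True by auto
    have kJ: "k \<in> K J" "inverse k \<in> K J"
      using k K_mono[of "J - {p}" J] K_inverse[OF J(1)] by auto
    have "x r p 1 \<in> Y" unfolding Y_def by (rule gen_incl) (use J in auto)
    moreover have k': "inverse k \<in> K (J - {p})" using k J by (intro K_inverse) auto
    ultimately obtain z where z: "z \<in> Y" "x r p 1 * inverse k = inverse k * z"
      using Y_swap by blast
    then have zk: "k * x r p 1 * inverse k = z" by (simp add: mult.assoc)
    obtain f' where f': "z = prod_list (map (\<lambda>i. x i p (f' i)) js)"
      using Y_product[OF z(1) js] .
    \<comment> \<open>Elements of \<open>Y\<close> are determined by the image of the basis vector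
      at \<open>p\<close>; here the added vector is \<open>g\<close>, as for
      \<open>y\<close>.\<close>
    have "\<rho> z (?e p) = \<rho> k (\<rho> (x r p 1) (\<rho> (inverse k) (?e p)))"
      using kJ J x_in_K[of r J p 1] by (simp add: rho_K_J K_mult flip: zk)
    also have "\<rho> (inverse k) (?e p) = ?e p"
      using k' J by (intro rho_fix[where J = "J - {p}"]) auto
    also have "\<rho> (x r p 1) (?e p) = (\<lambda>i. ?e p i + ?e r i)"
      using J in_I rho_x[of r p 1] by (auto simp: transv_def fun_eq_iff)
    also have "\<rho> k \<dots> = (\<lambda>i. \<rho> k (?e p) i + g i)"
      using rho_add[OF k(1), of "?e p" "?e r"] J k(2) by blast
    also have "\<rho> k (?e p) = ?e p"
      using k J by (intro rho_fix[where J = "J - {p}"]) auto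
    finally have "f' i = f i" if "i \<in> set js" for i
      using column_product[of js f' "?e p"] js that by (auto simp: f' g_def fun_eq_iff split: if_splits)
    then have "z = y" unfolding f' y by (intro arg_cong[of _ _ prod_list] map_cong) auto
    then show thesis using that k zk by blast
  qed
qed

text \<open>The hard case is a letter in column \<open>p\<close>. If \<open>s\<close> lies in the
  Weyl cell, \<open>Y_w\<close> pushes the letter into \<open>K1\<close>; otherwise the whole
  \<open>Y\<close> part has to be conjugated back into \<open>K {p, r}\<close>.\<close>

lemma double_coset_closed:
  assumes "J \<noteq> {p, r}" "i \<in> J" "j \<in> J" "i \<noteq> j"
    and "k \<in> K (J - {p})" "s \<in> K {p, r}" "k1 \<in> K1"
  shows "\<exists>k'\<in>K (J - {p}). \<exists>s'\<in>K {p, r}. \<exists>k1'\<in>K1. x i j t * (k * s * k1) = k' * s' * k1'"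
proof -
  consider "i \<noteq> p" "j \<noteq> p" | "i = p" "j \<noteq> p" | "i \<noteq> p" "j = p" using assms by blast
  then show ?thesis
  proof cases
    case 1
    then have "x i j t * k \<in> K (J - {p})" using assms by (intro K_mult x_in_K) auto
    moreover have "x i j t * (k * s * k1) = (x i j t * k) * s * k1" by (simp add: mult.assoc)
    ultimately show ?thesis using assms by blast
  next
    case 2
    then have "x i j t \<in> N" unfolding N_def using assms by (intro gen_incl) auto
    then obtain n where n: "n \<in> N" "x i j t * k = k * n" using N_swap assms by blast
    then obtain s' k' where sk: "s' \<in> K {p, r}" "k' \<in> K1" "n * (s * k1) = s' * k'"
      using N_S assms by blast
    have "x i j t * (k * s * k1) = k * (n * (s * k1))"
      using n(2)[THEN mult_tail] by (simp add: mult.assoc)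
    then have "x i j t * (k * s * k1) = k * s' * k'" by (simp add: sk mult.assoc)
    then show ?thesis using assms sk by blast
  next
    case 3
    then have "x i j t \<in> Y" unfolding Y_def using assms by (intro gen_incl) auto
    then obtain y where y: "y \<in> Y" "x i j t * k = k * y" using Y_swap assms by blast
    have xk: "x i j t * (k * s * k1) = k * (y * s * k1)"
      using y(2)[THEN mult_tail] by (simp add: mult.assoc)
    from R.gen_normal_form[of s] assms(6) K_pr
    consider e a b where "a \<noteq> 0" "s = x r p e * R.h a * x p r b"
      | c b where "c \<noteq> 0" "s = R.w c * x p r b" by blast
    then show ?thesis
    proof cases
      case 1
      \<comment> \<open>The \<open>Y\<close> part of \<open>s\<close> is merged with
        \<open>y\<close> and conjugated to one root element by \<open>Y_conj\<close>; the conjugator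
        \<open>l\<close> joins \<open>k\<close>, and its inverse passes \<open>R.h a\<close> into
        \<open>K1\<close>.\<close>
      have "x r p e \<in> Y" unfolding Y_def using J by (intro gen_incl) auto
      then have "y * x r p e \<in> Y" using y by (simp add: Y_def gen_mult)
      then obtain l u where l: "l \<in> K (J - {p})" "y * x r p e = l * x r p u * inverse l"
        using Y_conj assms(1) by blast
      have "inverse l \<in> K (J - {p})" using l J by (intro K_inverse) auto
      then obtain l1 where l1: "l1 \<in> K1" "inverse l * R.h a = R.h a * l1"
        using K'_h 1 by blast
      have "k * (y * s * k1) = k * ((y * x r p e) * (R.h a * (x p r b * k1)))"
        by (simp add: 1 mult.assoc)
      also have "\<dots> = k * (l * (x r p u * ((inverse l * R.h a) * (x p r b * k1))))"
        by (simp only: l mult.assoc)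
      also have "\<dots> = (k * l) * (x r p u * R.h a) * (l1 * (x p r b * k1))"
        by (simp only: l1 mult.assoc)
      finally have "x i j t * (k * s * k1) = (k * l) * (x r p u * R.h a) * (l1 * (x p r b * k1))"
        by (simp only: xk)
      moreover have "x r p u * R.h a \<in> K {p, r}"
        unfolding R.h_def R.w_def using J by (intro K_mult x_in_K) auto
      moreover have "l1 * (x p r b * k1) \<in> K1"
        using l1 assms J by (intro K1_mult x_in_K1) auto
      ultimately show ?thesis using K_mult[OF assms(5) l(1)] by blast
    next
      case 2
      then obtain k' where k': "k' \<in> K1" "y * R.w c = R.w c * k'" using Y_w y by blast
      have "x i j t * (k * s * k1) = k * ((y * R.w c) * (x p r b * k1))"
        unfolding xk by (simp add: 2 mult.assoc)
      also have "\<dots> = k * R.w c * (k' * (x p r b * k1))"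
        by (simp only: k' mult.assoc)
      finally have "x i j t * (k * s * k1) = k * R.w c * (k' * (x p r b * k1))" .
      moreover have "R.w c \<in> K {p, r}"
        unfolding R.w_def using J by (intro K_mult x_in_K) auto
      moreover have "k' * (x p r b * k1) \<in> K1"
        using k' assms J by (intro K1_mult x_in_K1) auto
      ultimately show ?thesis using assms by blast
    qed
  qed
qed

lemma double_coset:
  assumes "k \<in> K J"
  obtains k' s k1 where "k' \<in> K (J - {p})" "s \<in> K {p, r}" "k1 \<in> K1" "k = k' * s * k1"
proof (cases "J = {p, r}")
  case True
  then show thesis using that[of 1 k 1] assms K_one one_in_K1 by auto
next
  case False
  from assms J(1) have "\<exists>k'\<in>K (J - {p}). \<exists>s\<in>K {p, r}. \<exists>k1\<in>K1. k = k' * s * k1"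
  proof (induction rule: K_induct)
    case one
    show ?case
      by (intro bexI[of _ 1]) (auto simp: K_one one_in_K1)
  next
    case (step i j t k)
    then show ?case using double_coset_closed[OF False] by fast
  qed
  then show thesis using that by blast
qed

text \<open>A parabolic subgroup is its radical \<open>N\<close> times the Levi factor, which
  normalises \<open>N\<close>.\<close>

lemma K1_decomp:
  assumes "k \<in> K1" obtains n k' where "n \<in> N" "k' \<in> K (J - {p})" "k = n * k'"
proof -
  from assms have "\<exists>n\<in>N. \<exists>k'\<in>K (J - {p}). k = n * k'"
    unfolding K1_def
  proof induction
    case gen_one
    have "1 \<in> N" by (simp add: N_def gen.gen_one)
    then show ?case using K_one by force
  next
    case (gen_step s k)
    then obtain n k' where nk: "n \<in> N" "k' \<in> K (J - {p})" "k = n * k'" by blast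
    from gen_step obtain i j t where s: "s = x i j t" "i \<in> J" "j \<in> J" "j \<noteq> p" "i \<noteq> j" by auto
    show ?case
    proof (cases "i = p")
      case True
      then have "s * n \<in> N" using s nk unfolding N_def by (intro gen.gen_step) auto
      moreover have "s * k = (s * n) * k'" by (simp add: nk mult.assoc)
      ultimately show ?thesis using nk by blast
    next
      case False
      then have sK: "s \<in> K (J - {p})" using s by (auto intro: x_in_K)
      then obtain n' where n': "n' \<in> N" "s * n = n' * s" using N_swap' nk by blast
      then have "s * k = n' * (s * k')" using n'(2)[THEN mult_tail] by (simp add: nk mult.assoc)
      then show ?thesis using n' K_mult[OF sK nk(2)] by blast
    qed
  qed
  then show thesis using that by blast
qed

text \<open>Fixing the basis vector at \<open>p\<close> forces \<open>k\<close> into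
  \<open>K1\<close>; there the radical and the Levi factor act on different coordinates and can be
  treated separately.\<close>

lemma kernel_step:
  assumes IH: "\<And>k. k \<in> K (J - {p}) \<Longrightarrow> \<rho> k = id \<Longrightarrow> k = 1"
    and k: "k \<in> K J" "\<rho> k = id"
  shows "k = 1"
proof -
  let ?e = "\<lambda>j i. if i = j then 1 else (0 :: 'a)"
  obtain k' s k1 where d: "k' \<in> K (J - {p})" "s \<in> K {p, r}" "k1 \<in> K1" "k = k' * s * k1"
    using double_coset[OF k(1)] .
  have J': "J - {p} \<subseteq> I" using J by auto
  have sub: "K (J - {p}) \<subseteq> K J" "K {p, r} \<subseteq> K J" "K1 \<subseteq> K J"
    unfolding K1_def using J by (auto intro!: K_mono gen_mono simp: K_def)
  have dJ: "k' \<in> K J" "s \<in> K J" "k1 \<in> K J" using d sub by auto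
  have k1: "\<rho> k1 (?e p) = ?e p"
    using d(3) unfolding K1_def
  proof induction
    case (gen_step g l)
    then obtain i j t where g: "g = x i j t" "i \<in> J" "j \<in> J" "j \<noteq> p" "i \<noteq> j" by auto
    then have "\<rho> (g * l) (?e p) = \<rho> g (\<rho> l (?e p))"
      using gen_step sub by (intro rho_K_J) (auto simp: K1_def intro: x_in_K)
    then show ?case using gen_step g in_I rho_x[of i j t] by (auto simp: transv_def)
  qed (simp add: rho_one)
  have eq: "\<rho> k' (\<rho> s (?e p)) = ?e p"
  proof -
    have "\<rho> (k' * s * k1) (?e p) = \<rho> k' (\<rho> s (\<rho> k1 (?e p)))"
      using dJ by (simp only: rho_K_J K_mult)
    then show ?thesis using k(2) by (simp add: k1 flip: d(4))
  qed
  \<comment> \<open>\<open>k'\<close> does not touch coordinate \<open>p\<close>. The value 1 there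
    excludes the Weyl cell and forces \<open>a = 1\<close> in the other one.\<close>
  have s: "\<rho> s (?e p) p = 1"
    using rho_outside[OF d(1) J', of p "\<rho> s (?e p)"] eq by simp
  from R.gen_normal_form[of s] d(2) K_pr
  consider e a b where "a \<noteq> 0" "s = x r p e * R.h a * x p r b"
    | c b where "c \<noteq> 0" "s = R.w c * x p r b" by blast
  then have "k \<in> K1"
  proof cases
    case 1
    have "\<rho> s (?e p) = transv r p e (\<rho> (R.h a) (transv p r b (?e p)))"
      using J rho_x by (simp add: 1 rho_K_J K_mult x_in_K h_in_K in_I)
    also have "\<dots> = (\<lambda>i. if i = p then a else if i = r then e * a else 0)"
      using J 1 by (auto simp: rho_h transv_def fun_eq_iff)
    finally have s_e: "\<rho> s (?e p) = (\<lambda>i. if i = p then a else if i = r then e * a else 0)" .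
    then have a: "a = 1" using s by simp
    have "\<rho> s (?e p) = \<rho> (inverse k') (\<rho> k' (\<rho> s (?e p)))"
      using rho_inverse(1)[of k'] dJ K_mono[OF J(1)] by auto
    also have "\<dots> = ?e p" unfolding eq
      using d(1) J' by (intro rho_fix[where J = "J - {p}"] K_inverse) auto
    finally have "e = 0" using s_e a J by (auto simp: fun_eq_iff split: if_splits)
    then have "k = k' * (x p r b * k1)" using a 1 J x_zero[of r p] in_I by (simp add: d mult.assoc)
    then show ?thesis using d J K'_K1 by (auto intro!: K1_mult x_in_K1)
  next
    case 2
    have "\<rho> s (?e p) p = 0"
      using J rho_x 2 by (simp add: rho_K_J K_mult x_in_K w_in_K in_I rho_w transv_def)
    then show ?thesis using s by simp
  qed
  then obtain n l where nl: "n \<in> N" "l \<in> K (J - {p})" "k = n * l" by (rule K1_decomp)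
  obtain js where js: "distinct js" "set js = J - {p}" by (rule J_list)
  obtain f where n: "n = prod_list (map (\<lambda>j. x p j (f j)) js)"
    using N_product[OF nl(1) js] .
  have nJ: "n \<in> K J" and rho_n: "\<And>v. \<rho> n v = v(p := v p + (\<Sum>j\<in>set js. f j * v j))"
    using row_product[of js f] js n by auto
  \<comment> \<open>\<open>n\<close> changes only coordinate \<open>p\<close> and \<open>l\<close>
    never does, so a trivial composite makes \<open>l\<close> act trivially.\<close>
  have "\<rho> l v = v" for v
  proof
    fix i
    have "\<rho> n (\<rho> l v) = v" using k nl nJ sub rho_K_J[of n l v] by auto
    then have "i \<noteq> p \<Longrightarrow> \<rho> l v i = v i" using rho_n[of "\<rho> l v"] by (metis fun_upd_other)
    moreover have "\<rho> l v p = v p" using rho_outside[OF nl(2) J'] by auto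
    ultimately show "\<rho> l v i = v i" by metis
  qed
  then have "\<rho> l = id" by (simp add: fun_eq_iff)
  then have "l = 1" using IH nl(2) by blast
  then show ?thesis using N_faithful nl k by simp
qed

end

theorem kernel_trivial:
  assumes "J \<subseteq> I" "k \<in> K J" "\<rho> k = id" shows "k = 1"
proof -
  have "finite J" using assms(1) finite_I by (rule finite_subset)
  then show ?thesis using assms
  proof (induction J arbitrary: k rule: finite_psubset_induct)
    case (psubset J)
    show ?case
    proof (cases "\<exists>p r. p \<in> J \<and> r \<in> J \<and> p \<noteq> r")
      case True
      then obtain p r where "p \<in> J" "r \<in> J" "p \<noteq> r" by blast
      then show ?thesis using psubset kernel_step[of J p r k] by blast
    next
      case False
      from psubset(4,3) False show ?thesis
        by (induction rule: K_induct) auto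
    qed
  qed
qed

end

section \<open>Special linear groups and their lifts\<close>

lemma square_mult_carrier [simp]:
  "M \<in> carrier_mat n n \<Longrightarrow> N \<in> carrier_mat n n \<Longrightarrow> M * N \<in> carrier_mat n n"
  by (rule mult_carrier_mat)

text \<open>Coordinates from \<open>n\<close> on are kept rather than set to 0, so that the identity
  matrix acts as \<open>id\<close> and elementary matrices act exactly as
  \<open>transv\<close>.\<close>

definition mact :: "nat \<Rightarrow> 'a :: comm_ring_1 mat \<Rightarrow> (nat \<Rightarrow> 'a) \<Rightarrow> nat \<Rightarrow> 'a" where
  "mact n M v i = (if i < n then \<Sum>j = 0..<n. M $$ (i, j) * v j else v i)"

lemma mact_mult:
  assumes "M \<in> carrier_mat n n" "N \<in> carrier_mat n n"
  shows "mact n (M * N) v = mact n M (mact n N v)"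
proof
  fix i
  show "mact n (M * N) v i = mact n M (mact n N v) i"
  proof (cases "i < n")
    case True
    have "mact n (M * N) v i = (\<Sum>j = 0..<n. (\<Sum>k = 0..<n. M $$ (i, k) * N $$ (k, j)) * v j)"
      using True assms by (auto simp: mact_def scalar_prod_def intro!: sum.cong)
    also have "\<dots> = (\<Sum>k = 0..<n. \<Sum>j = 0..<n. M $$ (i, k) * N $$ (k, j) * v j)"
      by (simp add: sum_distrib_right) (rule sum.swap)
    also have "\<dots> = mact n M (mact n N v) i"
      using True by (simp add: mact_def sum_distrib_left mult.assoc)
    finally show ?thesis .
  qed (simp add: mact_def)
qed

lemma mact_add: "mact n M (\<lambda>i. u i + v i) = (\<lambda>i. mact n M u i + mact n M v i)"
  by (auto simp: mact_def fun_eq_iff algebra_simps sum.distrib)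

lemma mact_unit:
  assumes "j < n" shows "mact n M (\<lambda>i. if i = j then 1 else 0) = (\<lambda>i. if i < n then M $$ (i, j) else 0)"
  using assms by (auto simp: mact_def fun_eq_iff if_distrib cong: if_cong)

lemma mact_one: "mact n (1\<^sub>m n) = id"
proof -
  have "(\<Sum>j = 0..<n. 1\<^sub>m n $$ (i, j) * v j) = v i" if "i < n" for i and v :: "nat \<Rightarrow> 'a"
  proof -
    have "(\<Sum>j = 0..<n. 1\<^sub>m n $$ (i, j) * v j) = (\<Sum>j = 0..<n. if j = i then v j else 0)"
      using that by (intro sum.cong) auto
    also have "\<dots> = v i" using that by simp
    finally show ?thesis .
  qed
  then show ?thesis by (auto simp: mact_def fun_eq_iff)
qed

text \<open>Matrix identities below are checked on an arbitrary vector, where products become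
  compositions of coordinate updates instead of sums over entries.\<close>

lemma mat_eqI_mact:
  assumes "M \<in> carrier_mat n n" "N \<in> carrier_mat n n" "\<And>v. mact n M v = mact n N v"
  shows "M = N"
proof (rule eq_matI)
  fix i j assume "i < dim_row N" "j < dim_col N"
  then have "i < n" "j < n" using assms by auto
  then show "M $$ (i, j) = N $$ (i, j)"
    using fun_cong[OF assms(3)[of "\<lambda>i. if i = j then 1 else 0"], of i] by (simp add: mact_unit)
qed (use assms in auto)

lemma mat_eqI_mact_less:
  assumes "M \<in> carrier_mat n n" "N \<in> carrier_mat n n" "\<And>v i. i < n \<Longrightarrow> mact n M v i = mact n N v i"
  shows "M = N"
  using assms by (intro mat_eqI_mact[of M n N]) (auto simp: mact_def)

lemma mact_addrow_mat:
  assumes "i < n" "j < n" "i \<noteq> j" shows "mact n (addrow_mat n t i j) = transv i j t"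
proof (intro ext)
  fix v k
  have "(\<Sum>l = 0..<n. addrow_mat n t i j $$ (k, l) * v l)
      = (\<Sum>l = 0..<n. (if l = k then v l else 0) + (if l = j then if k = i then t * v l else 0 else 0))"
    if "k < n"
    using that assms by (intro sum.cong) auto
  then show "mact n (addrow_mat n t i j) v k = transv i j t v k"
    using assms by (auto simp: mact_def transv_def sum.distrib)
qed

abbreviation SLc :: "nat \<Rightarrow> 'a :: comm_ring_1 mat set" where
  "SLc n \<equiv> {M \<in> carrier_mat n n. det M = 1}"

lemma SLc_mult: "g \<in> SLc n \<Longrightarrow> h \<in> SLc n \<Longrightarrow> g * h \<in> SLc n"
  by (auto simp: det_mult)

lemma SLc_one: "1\<^sub>m n \<in> SLc n"
  by simp

lemma SLc_inverse:
  assumes "g \<in> SLc n" obtains h where "h \<in> SLc n" "h * g = 1\<^sub>m n" "g * h = 1\<^sub>m n"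
proof -
  have g: "g \<in> carrier_mat n n" "det g = 1" using assms by auto
  note adj = adj_mat[OF g(1)]
  have "adj_mat g * g = 1\<^sub>m n" "g * adj_mat g = 1\<^sub>m n" using adj g(2) by (auto intro!: eq_matI)
  moreover from this have "det (adj_mat g) = 1"
    using det_mult[OF adj(1) g(1)] g(2) by simp
  ultimately show thesis using that adj(1) by auto
qed

lemma addrow_mat_SLc: "i \<noteq> j \<Longrightarrow> addrow_mat n t i j \<in> SLc n"
  by (simp add: det_addrow_mat)

section \<open>Commutator identities under commutation hypotheses\<close>

definition commutator :: "'g :: group_mult \<Rightarrow> 'g \<Rightarrow> 'g" where
  "commutator a b = a * b * inverse a * inverse b"

lemma commutator_eq: "a * b = commutator a b * b * a"
  by (simp add: commutator_def mult.assoc)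

lemma commutator_eqI: "a * b = c * b * a \<Longrightarrow> commutator a b = c"
  by (metis commutator_eq mult.assoc mult_right_cancel_group)

lemma commutator_mult_left:
  assumes "a * commutator a' b = commutator a' b * a"
  shows "commutator (a * a') b = commutator a' b * commutator a b"
proof -
  have "a * a' * b = a * commutator a' b * b * a'" by (simp add: mult.assoc commutator_eq[of a' b])
  also have "\<dots> = commutator a' b * (a * b) * a'" by (simp add: assms mult.assoc)
  also have "a * b = commutator a b * b * a" by (rule commutator_eq)
  finally show ?thesis by (intro commutator_eqI) (simp add: mult.assoc)
qed

lemma commutator_mult_right:
  assumes "b * commutator a b' = commutator a b' * b"
  shows "commutator a (b * b') = commutator a b * commutator a b'"
proof -
  have "a * (b * b') = commutator a b * b * (a * b')"
    using commutator_eq[of a b] by (simp flip: mult.assoc)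
  also have "a * b' = commutator a b' * b' * a" by (rule commutator_eq)
  also have "commutator a b * b * (commutator a b' * b' * a) = commutator a b * (b * commutator a b') * b' * a"
    by (simp add: mult.assoc)
  finally show ?thesis unfolding assms by (intro commutator_eqI) (simp add: mult.assoc)
qed

lemma commutator_conj:
  "w * commutator a b * inverse w = commutator (w * a * inverse w) (w * b * inverse w)"
  by (simp add: commutator_def mult.assoc inverse_mult_distrib)

text \<open>Bring the two equal products to the order a, a', b, b': moving \<open>b\<close> past
  \<open>a'\<close> costs one commutator, moving \<open>b'\<close> past \<open>a\<close> costs the
  other, so the two costs agree.\<close>

lemma commutator_exchange:
  assumes "a * b * (a' * b') = a' * b' * (a * b)" "a * a' = a' * a" "b * b' = b' * b"
    and "a * commutator a' b = commutator a' b * a" "a' * commutator a b' = commutator a b' * a'"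
  shows "commutator a b' = commutator a' b"
proof -
  define c d where "c = commutator a' b" and "d = commutator a b'"
  have "b * a' = inverse c * a' * b" "b' * a = inverse d * a * b'"
    using commutator_eq[of a' b] commutator_eq[of a b'] by (simp_all add: c_def d_def mult.assoc)
  note 1 = this
  have "c * (a * b * (a' * b')) = c * (a * (b * a') * b')" by (simp add: mult.assoc)
  also have "\<dots> = a * c * (inverse c * a' * b) * b'" using assms(4) by (simp add: 1 c_def flip: mult.assoc)
  also have "\<dots> = a * a' * (b * b')" by (simp add: mult.assoc)
  finally have 2: "c * (a * b * (a' * b')) = a * a' * (b * b')" .
  have "d * (a' * b' * (a * b)) = d * (a' * (b' * a) * b)" by (simp add: mult.assoc)
  also have "\<dots> = a' * d * (inverse d * a * b') * b" using assms(5) by (simp add: 1 d_def flip: mult.assoc)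
  also have "\<dots> = a' * a * (b' * b)" by (simp add: mult.assoc)
  finally have "d * (a * b * (a' * b')) = a * a' * (b * b')" using assms by simp
  with 2 have "c * (a * b * (a' * b')) = d * (a * b * (a' * b'))" by simp
  then show ?thesis by (simp add: mult_right_cancel_group c_def d_def)
qed

text \<open>Reordering \<open>b * b' * (a * a')\<close> into itself creates exactly the two
  commutators, as the mixed pairs commute.\<close>

lemma commutator_cancel:
  assumes "a * a' * (b * b') = b * b' * (a * a')" "a * b' = b' * a" "a' * b = b * a'"
    and "a * commutator a' b' = commutator a' b' * a" "b * commutator a' b' = commutator a' b' * b"
  shows "commutator a b * commutator a' b' = 1"
proof -
  define c d where "c = commutator a b" and "d = commutator a' b'"
  have "b * b' * (a * a') = a * (a' * b) * b'" using assms(1) by (simp add: mult.assoc)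
  also have "\<dots> = (a * b) * (a' * b')" by (simp add: assms mult.assoc)
  also have "\<dots> = (c * b * a) * (d * b' * a')" 
    using commutator_eq[of a b] commutator_eq[of a' b'] by (simp add: c_def d_def)
  also have "\<dots> = c * b * (a * d) * b' * a'" by (simp add: mult.assoc)
  also have "\<dots> = c * (b * d) * (a * b') * a'" using assms(4) by (simp add: d_def mult.assoc)
  also have "\<dots> = c * d * (b * b' * (a * a'))" using assms(2,5) by (simp add: d_def mult.assoc)
  finally show ?thesis
    unfolding c_def d_def by (metis mult_1_left mult_right_cancel_group)
qed

text \<open>\<open>L\<close> is a set-theoretic section of a central extension with kernel
  \<open>Z\<close>; \<open>L_faithful\<close> makes the projection to matrices well defined. The
  roots in \<open>Z\<close> serve SL_2 over the fields with two and three elements.\<close>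

locale commuting_lift =
  fixes n :: nat and L :: "'a :: {field, finite} mat \<Rightarrow> 'g :: group_mult" and Z :: "'g set"
  assumes n: "n \<ge> 2"
    and Z_one: "1 \<in> Z" and Z_mult: "z \<in> Z \<Longrightarrow> z' \<in> Z \<Longrightarrow> z * z' \<in> Z"
    and Z_inverse: "z \<in> Z \<Longrightarrow> inverse z \<in> Z"
    and Z_commute: "z \<in> Z \<Longrightarrow> z' \<in> Z \<Longrightarrow> z * z' = z' * z"
    and Z_central: "z \<in> Z \<Longrightarrow> g \<in> SLc n \<Longrightarrow> z * L g = L g * z"
    and L_mult: "g \<in> SLc n \<Longrightarrow> h \<in> SLc n \<Longrightarrow> \<exists>z\<in>Z. L g * L h = z * L (g * h)"
    and L_faithful: "g \<in> SLc n \<Longrightarrow> h \<in> SLc n \<Longrightarrow> z \<in> Z \<Longrightarrow> L g = z * L h \<Longrightarrow> g = h"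
    and L_commute: "g \<in> SLc n \<Longrightarrow> h \<in> SLc n \<Longrightarrow> g * h = h * g \<Longrightarrow> L g * L h = L h * L g"
    and Z_sqrt: "z \<in> Z \<Longrightarrow> \<exists>y\<in>Z. y * y = z"
    and Z_cube_root: "z \<in> Z \<Longrightarrow> \<exists>y\<in>Z. y * y * y = z"
begin

text \<open>The projection of the extension, kept as a relation because the type \<open>'g\<close>
  may have elements outside the extension.\<close>

definition over where "over k g \<longleftrightarrow> g \<in> SLc n \<and> (\<exists>z\<in>Z. k = z * L g)"

lemma over_SLc: "over k g \<Longrightarrow> g \<in> SLc n"
  by (simp add: over_def)

lemma over_L: "g \<in> SLc n \<Longrightarrow> over (L g) g"
  using Z_one by (auto simp: over_def intro!: bexI[of _ 1])

lemma over_Z: "over k g \<Longrightarrow> z \<in> Z \<Longrightarrow> over (z * k) g"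
  using Z_mult by (auto simp: over_def simp flip: mult.assoc)

lemma Z_over: "over k g \<Longrightarrow> z \<in> Z \<Longrightarrow> z * k = k * z"
  unfolding over_def by (metis Z_central Z_commute mult.assoc)

lemma over_mult:
  assumes "over k g" "over l h" shows "over (k * l) (g * h)"
proof -
  obtain z z' where z: "z \<in> Z" "z' \<in> Z" "k = z * L g" "l = z' * L h"
    using assms by (auto simp: over_def)
  note SL = assms[THEN over_SLc]
  obtain y where y: "y \<in> Z" "L g * L h = y * L (g * h)" using L_mult SL by blast
  have "k * l = z * (L g * z') * L h" by (simp add: z mult.assoc)
  also have "L g * z' = z' * L g" using Z_central z SL by simp
  finally have "k * l = (z * z' * y) * L (g * h)" by (simp add: y mult.assoc)
  then show ?thesis using z y Z_mult SLc_mult[OF SL] unfolding over_def by blast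
qed

lemma over_one: "over 1 (1\<^sub>m n)"
proof -
  obtain z where z: "z \<in> Z" "L (1\<^sub>m n) * L (1\<^sub>m n) = z * L (1\<^sub>m n)"
    using L_mult[of "1\<^sub>m n" "1\<^sub>m n"] by auto
  then have "1 = inverse z * L (1\<^sub>m n)" by (simp add: mult_right_cancel_group)
  then show ?thesis using Z_inverse[OF z(1)] by (auto simp: over_def)
qed

lemma over_same:
  assumes "over k g" "over l g" shows "\<exists>z\<in>Z. k = z * l"
proof -
  obtain z z' where z: "z \<in> Z" "z' \<in> Z" "k = z * L g" "l = z' * L g"
    using assms by (auto simp: over_def)
  then have "k = z * inverse z' * l" by (simp add: mult.assoc)
  then show ?thesis using z Z_mult Z_inverse by blast
qed

lemma over_unique:
  assumes "over k g" "over k h" shows "g = h"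
proof -
  obtain z z' where z: "z \<in> Z" "z' \<in> Z" "k = z * L g" "k = z' * L h"
    using assms by (auto simp: over_def)
  then have "L g = inverse z * (z' * L h)" by (metis inverse_mult_cancel)
  then have "L g = (inverse z * z') * L h" by (simp add: mult.assoc)
  then show ?thesis using L_faithful assms[THEN over_SLc] z Z_mult Z_inverse by blast
qed

lemma over_inverse:
  assumes "over k g" "h \<in> SLc n" "g * h = 1\<^sub>m n" shows "over (inverse k) h"
proof -
  have "over (k * L h) (1\<^sub>m n)" using over_mult[OF assms(1) over_L[OF assms(2)]] assms(3) by simp
  then obtain z where z: "z \<in> Z" "k * L h = z * 1" using over_same over_one by blast
  then have "inverse k * z = L h" by (metis inverse_mult_cancel mult_1_right)
  then have "inverse k = L h * inverse z" by (metis mult.assoc mult_1_right right_inverse_mult)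
  then have "inverse k = inverse z * L h" using Z_central Z_inverse z assms(2) by simp
  then show ?thesis using over_Z[OF over_L[OF assms(2)]] Z_inverse z by simp
qed

lemma over_commute:
  assumes "over k g" "over l h" "g * h = h * g" shows "k * l = l * k"
proof -
  obtain z z' where z: "z \<in> Z" "z' \<in> Z" "k = z * L g" "l = z' * L h"
    using assms by (auto simp: over_def)
  note SL = assms(1,2)[THEN over_SLc]
  have "k * l = z * (L g * z') * L h" by (simp add: z mult.assoc)
  also have "L g * z' = z' * L g" using Z_central z SL by simp
  also have "z * (z' * L g) * L h = (z * z') * (L g * L h)" by (simp add: mult.assoc)
  also have "\<dots> = z' * (z * L h) * L g" using Z_commute z L_commute SL assms by (simp add: mult.assoc)
  also have "z * L h = L h * z" using Z_central z SL by simp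
  finally show ?thesis by (simp add: z mult.assoc)
qed

lemma over_conj:
  assumes "over w g" "over k h" "h' \<in> SLc n" "g * h = h' * g"
  shows "over (w * k * inverse w) h'"
proof -
  have "over (w * k) (h' * g)" using over_mult[OF assms(1,2)] assms(4) by simp
  then obtain z where z: "z \<in> Z" "w * k = z * (L h' * w)"
    using over_same over_mult[OF over_L[OF assms(3)] assms(1)] by blast
  then have "w * k * inverse w = z * L h'" by (simp add: mult.assoc)
  then show ?thesis using over_Z over_L assms z by simp
qed

lemma over_commutator:
  assumes "over k g" "over l h" "h' \<in> SLc n" "g * h = h' * h * g"
  shows "over (commutator k l) h'"
proof -
  have "over (k * l) (h' * h * g)" using over_mult[OF assms(1,2)] assms(4) by simp
  moreover have "over (L h' * l * k) (h' * h * g)" using assms by (intro over_mult over_L)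
  ultimately obtain z where z: "z \<in> Z" "k * l = z * (L h' * l * k)"
    using over_same by blast
  then have "commutator k l = z * L h'" by (intro commutator_eqI) (simp add: mult.assoc)
  then show ?thesis using over_Z over_L assms z by simp
qed

lemma over_commutator_ex:
  assumes "over k g" "over l h" shows "\<exists>m. over (commutator k l) m"
proof -
  obtain g' where g': "g' \<in> SLc n" "g' * g = 1\<^sub>m n" "g * g' = 1\<^sub>m n"
    by (rule SLc_inverse[OF over_SLc[OF assms(1)]])
  obtain h' where h': "h' \<in> SLc n" "h' * h = 1\<^sub>m n" "h * h' = 1\<^sub>m n"
    by (rule SLc_inverse[OF over_SLc[OF assms(2)]])
  show ?thesis unfolding commutator_def
    using over_mult[OF over_mult[OF over_mult[OF assms] over_inverse[OF assms(1) g'(1,3)]]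
        over_inverse[OF assms(2) h'(1,3)]] by (rule exI)
qed

text \<open>Two lifts of one matrix differ by a central factor, which drops out of the
  commutator.\<close>

lemma commutator_indep:
  assumes "over k g" "over k' g" "over l h" "over l' h"
  shows "commutator k l = commutator k' l'"
proof -
  obtain z z' where z: "z \<in> Z" "k = z * k'" "z' \<in> Z" "l = z' * l'"
    using over_same assms by meson
  obtain m where m: "over (commutator k' l') m" using over_commutator_ex assms by blast
  have "k * l = z * (k' * z') * l'" by (simp add: z mult.assoc)
  also have "k' * z' = z' * k'" using Z_over assms z by simp
  also have "z * (z' * k') * l' = z * z' * (commutator k' l' * l' * k')"
    using commutator_eq[of k' l'] by (simp add: mult.assoc)
  also have "\<dots> = (z * z') * commutator k' l' * l' * k'" by (simp add: mult.assoc)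
  also have "(z * z') * commutator k' l' = commutator k' l' * (z' * z)"
    using Z_over[OF m] Z_mult z Z_commute by simp
  also have "commutator k' l' * (z' * z) * l' * k' = commutator k' l' * z' * (z * l') * k'"
    by (simp add: mult.assoc)
  also have "z * l' = l' * z" using Z_over assms z by simp
  finally show ?thesis by (intro commutator_eqI) (simp add: z mult.assoc)
qed

end

section \<open>Lifting the elementary matrices\<close>

context commuting_lift
begin

abbreviation E :: "nat \<Rightarrow> nat \<Rightarrow> 'a \<Rightarrow> 'a mat" where "E i j t \<equiv> addrow_mat n t i j"

lemma mact_E: "i < n \<Longrightarrow> j < n \<Longrightarrow> i \<noteq> j \<Longrightarrow> mact n (E i j t) = transv i j t"
  by (rule mact_addrow_mat)

lemma over_E: "i \<noteq> j \<Longrightarrow> over (L (E i j t)) (E i j t)"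
  by (intro over_L addrow_mat_SLc)

lemma E_add:
  assumes "i < n" "j < n" "i \<noteq> j" shows "E i j s * E i j t = E i j (s + t)"
  using assms by (intro mat_eqI_mact[of _ n])
    (auto simp: mact_mult mact_E transv_def fun_eq_iff algebra_simps)

lemma E_commute:
  assumes "i < n" "j < n" "k < n" "l < n" "i \<noteq> j" "k \<noteq> l" "i \<noteq> l" "j \<noteq> k"
  shows "E i j s * E k l t = E k l t * E i j s"
  using assms by (intro mat_eqI_mact[of _ n])
    (auto simp: mact_mult mact_E transv_def fun_eq_iff algebra_simps)

lemma E_steinberg:
  assumes "i < n" "j < n" "k < n" "i \<noteq> j" "j \<noteq> k" "i \<noteq> k"
  shows "E i j s * E j k t = E i k (s * t) * E j k t * E i j s"
  using assms by (intro mat_eqI_mact[of _ n])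
    (auto simp: mact_mult mact_E transv_def fun_eq_iff algebra_simps)

definition W where "W i j u = E i j u * E j i (-1/u) * E i j u"

lemma W_SLc: "i \<noteq> j \<Longrightarrow> W i j u \<in> SLc n"
  unfolding W_def by (intro SLc_mult addrow_mat_SLc) auto

lemma carrier_W [simp]: "W i j u \<in> carrier_mat n n"
  by (simp add: W_def)

lemma mact_W:
  assumes "i < n" "j < n" "i \<noteq> j" "u \<noteq> 0"
  shows "mact n (W i j u) v = v(i := u * v j, j := - v i / u)"
  using assms
  by (auto simp: W_def mact_mult mact_E transv_def fun_eq_iff field_simps)

lemmas mat_eq_simps = mact_mult mact_E mact_W transv_def fun_eq_iff


text \<open>The candidate lift of \<open>E i k (s * t)\<close>. It remains to see that it depends
  neither on the middle index \<open>j\<close> nor on the way the parameter is factored.\<close>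

definition F where "F i j k s t = commutator (L (E i j s)) (L (E j k t))"

context
  fixes i j k assumes ijk: "i < n" "j < n" "k < n" "i \<noteq> j" "j \<noteq> k" "i \<noteq> k"
begin

lemma over_F: "over (F i j k s t) (E i k (s * t))"
  unfolding F_def using ijk
  by (intro over_commutator[OF over_E over_E addrow_mat_SLc E_steinberg])

lemma F_eq: "over a (E i j s) \<Longrightarrow> over b (E j k t) \<Longrightarrow> commutator a b = F i j k s t"
  unfolding F_def using ijk commutator_indep over_E by blast

lemma F_add: "F i j k (s + s') t = F i j k s' t * F i j k s t"
proof -
  have "over (L (E i j s) * L (E i j s')) (E i j (s + s'))"
    using over_mult[OF over_E over_E] ijk E_add by metis
  from F_eq[OF this over_E] have "F i j k (s + s') t = commutator (L (E i j s) * L (E i j s')) (L (E j k t))"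
    using ijk by simp
  also have "\<dots> = F i j k s' t * F i j k s t"
    unfolding F_def
    by (intro commutator_mult_left over_commute[OF over_E over_F[unfolded F_def]] E_commute) (use ijk in auto)
  finally show ?thesis .
qed

lemma F_zero: "F i j k 0 t = 1"
  using F_add[of 0 0 t] by (metis add_0 mult_1_right mult_left_cancel_group)

text \<open>\<open>E i j s * E j k 1\<close> and \<open>E i j (s * t) * E j k t\<close> commute.\<close>

lemma F_one: "F i j k s t = F i j k (s * t) 1"
proof -
  let ?a = "L (E i j s)" and ?b = "L (E j k 1)" and ?a' = "L (E i j (s * t))" and ?b' = "L (E j k t)"
  have "commutator ?a ?b' = commutator ?a' ?b"
  proof (rule commutator_exchange)
    show "?a * ?b * (?a' * ?b') = ?a' * ?b' * (?a * ?b)"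
    proof (rule over_commute)
      show "over (?a * ?b) (E i j s * E j k 1)" "over (?a' * ?b') (E i j (s * t) * E j k t)"
        using ijk by (auto intro!: over_mult over_E)
      show "E i j s * E j k 1 * (E i j (s * t) * E j k t) = E i j (s * t) * E j k t * (E i j s * E j k 1)"
        using ijk by (intro mat_eqI_mact[of _ n]) (auto simp: mat_eq_simps algebra_simps)
    qed
    show "?a * ?a' = ?a' * ?a" "?b * ?b' = ?b' * ?b"
      using ijk by (auto intro!: over_commute[OF over_E over_E] E_commute)
    show "?a * commutator ?a' ?b = commutator ?a' ?b * ?a"
      "?a' * commutator ?a ?b' = commutator ?a ?b' * ?a'"
      using ijk by (auto intro!: over_commute[OF over_E over_F[unfolded F_def]] E_commute)
  qed
  then show ?thesis by (simp add: F_def)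
qed

end

text \<open>\<open>E i j s * E i l s\<close> and \<open>E j k 1 * E l k (-1)\<close> commute.\<close>

lemma F_middle:
  assumes ijk: "i < n" "j < n" "k < n" "i \<noteq> j" "j \<noteq> k" "i \<noteq> k"
    and l: "l < n" "i \<noteq> l" "l \<noteq> k"
  shows "F i j k s 1 = F i l k s 1"
proof (cases "l = j")
  case False
  let ?a = "L (E i j s)" and ?b = "L (E j k 1)" and ?a' = "L (E i l s)" and ?b' = "L (E l k (-1))"
  have "commutator ?a ?b * commutator ?a' ?b' = 1"
  proof (rule commutator_cancel)
    show "?a * ?a' * (?b * ?b') = ?b * ?b' * (?a * ?a')"
    proof (rule over_commute)
      show "over (?a * ?a') (E i j s * E i l s)" "over (?b * ?b') (E j k 1 * E l k (-1))"
        using ijk l by (auto intro!: over_mult over_E)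
      show "E i j s * E i l s * (E j k 1 * E l k (-1)) = E j k 1 * E l k (-1) * (E i j s * E i l s)"
        using ijk l False by (intro mat_eqI_mact[of _ n]) (auto simp: mat_eq_simps algebra_simps)
    qed
    show "?a * ?b' = ?b' * ?a" "?a' * ?b = ?b * ?a'"
      using ijk l False by (auto intro!: over_commute[OF over_E over_E] E_commute)
    show "?a * commutator ?a' ?b' = commutator ?a' ?b' * ?a"
      "?b * commutator ?a' ?b' = commutator ?a' ?b' * ?b"
      using ijk l False by (auto intro!: over_commute[OF over_E over_F[unfolded F_def]] E_commute)
  qed
  then have "F i j k s 1 * F i l k (-s) 1 = 1"
    using F_one[of i l k s "-1"] ijk l by (simp add: F_def)
  moreover have "F i l k s 1 * F i l k (-s) 1 = 1"
    using F_add[of i l k "-s" s 1] F_zero[of i l k 1] ijk l by simp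
  ultimately show ?thesis by (metis mult_right_cancel_group)
qed simp

text \<open>Collects the relations that need a construction. The remaining ones, including
  commutativity of the torus, follow from \<open>over_commute\<close> for any choice of
  lifts.\<close>

definition is_lift where
  "is_lift x \<longleftrightarrow> (\<forall>i j. i < n \<longrightarrow> j < n \<longrightarrow> i \<noteq> j \<longrightarrow>
     rank_one (x i j) (x j i) \<and> (\<forall>t. over (x i j t) (E i j t)) \<and>
     (\<forall>k s t. k < n \<longrightarrow> j \<noteq> k \<longrightarrow> i \<noteq> k \<longrightarrow> x i j s * x j k t = x i k (s * t) * x j k t * x i j s))"

lemma is_lift_ge_3:
  assumes n3: "n \<ge> 3" shows "\<exists>x. is_lift x"
proof -
  define third where "third i k = (SOME j. j < n \<and> j \<noteq> i \<and> j \<noteq> k)" for i k :: nat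
  have third: "third i k < n" "third i k \<noteq> i" "third i k \<noteq> k" for i k
  proof -
    have "\<exists>j\<in>{0, 1, 2}. j \<noteq> i \<and> j \<noteq> k" by auto
    then have "\<exists>j. j < n \<and> j \<noteq> i \<and> j \<noteq> k" using n3 by force
    from someI_ex[OF this] show "third i k < n" "third i k \<noteq> i" "third i k \<noteq> k"
      unfolding third_def by blast+
  qed
  note third = third third(2,3)[symmetric]
  define x where "x i k t = F i (third i k) k t 1" for i k t
  have x: "x i k t = F i j k t 1" if "i < n" "j < n" "k < n" "i \<noteq> j" "j \<noteq> k" "i \<noteq> k" for i j k t
    unfolding x_def using that third by (intro F_middle) auto
  have over_x: "over (x i k t) (E i k t)" if "i < n" "k < n" "i \<noteq> k" for i k t
    using over_F[of i "third i k" k t 1] that third by (auto simp: x_def)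
  have add: "x i k s * x i k t = x i k (s + t)" if "i < n" "k < n" "i \<noteq> k" for i k s t
    using F_add[of i "third i k" k t s 1] that third[of i k] by (simp add: x_def add.commute)
  have steinberg: "x i j s * x j k t = x i k (s * t) * x j k t * x i j s"
    if "i < n" "j < n" "k < n" "i \<noteq> j" "j \<noteq> k" "i \<noteq> k" for i j k s t
  proof -
    have "commutator (x i j s) (x j k t) = x i k (s * t)"
      using F_eq[of i j k "x i j s" s "x j k t" t] F_one[of i j k s t] x[of i j k "s * t"] over_x that by simp
    then show ?thesis using commutator_eq[of "x i j s" "x j k t"] by simp
  qed
  have weyl: "x i j u * x j i (-1/u) * x i j u * x i j t = x j i (-t/u\<^sup>2) * (x i j u * x j i (-1/u) * x i j u)"
    if ij: "i < n" "j < n" "i \<noteq> j" and u: "u \<noteq> 0" for i j t u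
  proof -
    define k where "k = third i j"
    have k: "k < n" "k \<noteq> i" "k \<noteq> j" using third by (auto simp: k_def)
    define w where "w = x i j u * x j i (-1/u) * x i j u"
    have w: "over w (W i j u)" unfolding w_def W_def using ij by (intro over_mult over_x) auto
    let ?a = "L (E i k t)" and ?b = "L (E k j 1)"
    \<comment> \<open>Through the third index \<open>k\<close>: conjugation by \<open>w\<close>
      exchanges \<open>i\<close> and \<open>j\<close> up to scalars and keeps \<open>k\<close>, and
      the commutator does not see which lifts result.\<close>
    have "x i j t = commutator ?a ?b" using x[of i k j t] k ij by (simp add: F_def)
    then have "w * x i j t * inverse w = commutator (w * ?a * inverse w) (w * ?b * inverse w)"
      by (simp add: commutator_conj)
    also have "\<dots> = F j k i (-t/u) (1/u)"
    proof (rule F_eq)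
      show "over (w * ?a * inverse w) (E j k (-t/u))"
      proof (rule over_conj[OF w over_E addrow_mat_SLc])
        show "W i j u * E i k t = E j k (- t / u) * W i j u"
          using ij u k by (intro mat_eqI_mact[of _ n]) (auto simp: mat_eq_simps field_simps)
      qed (use k in auto)
      show "over (w * ?b * inverse w) (E k i (1/u))"
      proof (rule over_conj[OF w over_E addrow_mat_SLc])
        show "W i j u * E k j 1 = E k i (1/u) * W i j u"
          using ij u k by (intro mat_eqI_mact[of _ n]) (auto simp: mat_eq_simps field_simps)
      qed (use k in auto)
    qed (use ij k in auto)
    also have "\<dots> = x j i (-t/u\<^sup>2)"
      using F_one[of j k i "-t/u" "1/u"] x[of j k i "-t/u\<^sup>2"] ij k by (simp add: power2_eq_square)
    finally have "w * x i j t * inverse w * w = x j i (-t/u\<^sup>2) * w" by simp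
    then have "w * x i j t = x j i (-t/u\<^sup>2) * w" by (simp add: mult.assoc)
    then show ?thesis by (simp only: w_def)
  qed
  have rank_one: "rank_one (x i j) (x j i)" if "i < n" "j < n" "i \<noteq> j" for i j
    by (rule rank_one.intro) (rule add weyl; use that in simp)+
  have "is_lift x"
    unfolding is_lift_def
    by (intro allI impI conjI rank_one over_x steinberg) auto
  then show ?thesis by blast
qed

text \<open>With two indices there is no room for a third, so the commutator relation is
  vacuous.\<close>

lemma is_lift_2I:
  assumes "n = 2" "rank_one X Y" "\<And>t. over (X t) (E 0 1 t)" "\<And>t. over (Y t) (E 1 0 t)"
  shows "\<exists>x. is_lift x"
proof -
  have "is_lift (\<lambda>i j. if i = 0 then X else Y)"
    unfolding is_lift_def
  proof (intro allI impI)
    fix i j assume "i < n" "j < n" "i \<noteq> j"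
    then consider "i = 0" "j = 1" | "i = 1" "j = 0" using assms(1) by linarith
    then show "rank_one (if i = 0 then X else Y) (if j = 0 then X else Y) \<and>
      (\<forall>t. over ((if i = 0 then X else Y) t) (E i j t)) \<and>
      (\<forall>k s t. k < n \<longrightarrow> j \<noteq> k \<longrightarrow> i \<noteq> k \<longrightarrow>
        (if i = 0 then X else Y) s * (if j = 0 then X else Y) t =
        (if i = 0 then X else Y) (s * t) * (if j = 0 then X else Y) t * (if i = 0 then X else Y) s)"
      by cases (use assms rank_one.rank_one_swap in auto)
  qed
  then show ?thesis by blast
qed

text \<open>The torus element \<open>d = diag(a, 1/a)\<close> satisfies \<open>[d, E 0 1 s] = E 0 1 ((a\<^sup>2 - 1) * s)\<close>.\<close>

lemma is_lift_2_large:
  fixes a :: 'a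
  assumes n2: "n = 2" and a: "a \<noteq> 0" "a\<^sup>2 \<noteq> 1" shows "\<exists>x. is_lift x"
proof -
  have nn: "0 < n" "1 < n" using n by auto
  have a1: "a\<^sup>2 - 1 \<noteq> 0" using a by simp
  define d where "d b = W 0 1 b * W 0 1 (-1)" for b :: 'a
  have d: "d b \<in> SLc n" for b unfolding d_def by (intro SLc_mult W_SLc) auto
  have dc [simp]: "d b \<in> carrier_mat n n" for b by (simp add: d_def)
  have mact_d: "mact n (d b) v = v(0 := b * v 0, 1 := v 1 / b)" if "b \<noteq> 0" for b v
    unfolding d_def using that nn by (auto simp: mat_eq_simps)
  define X where "X t = commutator (L (d a)) (L (E 0 1 (t / (a\<^sup>2 - 1))))" for t
  \<comment> \<open>diag(1/a, a) scales the lower root group by the same factor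
    \<open>a\<^sup>2\<close>, and it is the conjugate of \<open>d a\<close> under a Weyl element,
    which gives the relation between \<open>X\<close> and \<open>Y\<close>.\<close>
  define Y where "Y t = commutator (L (d (1/a))) (L (E 1 0 (t / (a\<^sup>2 - 1))))" for t
  have over_X: "over (X t) (E 0 1 t)" for t
    unfolding X_def
  proof (rule over_commutator[OF over_L[OF d] over_E addrow_mat_SLc])
    show "d a * E 0 1 (t / (a\<^sup>2 - 1)) = E 0 1 t * E 0 1 (t / (a\<^sup>2 - 1)) * d a"
      using nn a a1 by (intro mat_eqI_mact[of _ n]) (auto simp: mat_eq_simps mact_d field_simps power2_eq_square)
  qed auto
  have over_Y: "over (Y t) (E 1 0 t)" for t
    unfolding Y_def
  proof (rule over_commutator[OF over_L[OF d] over_E addrow_mat_SLc])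
    show "d (1/a) * E 1 0 (t / (a\<^sup>2 - 1)) = E 1 0 t * E 1 0 (t / (a\<^sup>2 - 1)) * d (1/a)"
      using nn a a1 by (intro mat_eqI_mact[of _ n]) (auto simp: mat_eq_simps mact_d field_simps power2_eq_square)
  qed auto
  have add_X: "X s * X t = X (s + t)" for s t
  proof -
    let ?b = "L (E 0 1 (s / (a\<^sup>2 - 1)))" and ?b' = "L (E 0 1 (t / (a\<^sup>2 - 1)))"
    have "over (?b * ?b') (E 0 1 (s / (a\<^sup>2 - 1)) * E 0 1 (t / (a\<^sup>2 - 1)))"
      by (intro over_mult over_E) auto
    then have bb: "over (?b * ?b') (E 0 1 ((s + t) / (a\<^sup>2 - 1)))"
      using nn by (simp add: E_add add_divide_distrib)
    have "X (s + t) = commutator (L (d a)) (?b * ?b')"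
      unfolding X_def by (rule commutator_indep[OF over_L[OF d] over_L[OF d] over_E bb]) simp
    also have "\<dots> = X s * X t"
      unfolding X_def
      by (intro commutator_mult_right over_commute[OF over_E over_X[unfolded X_def]] E_commute) (use nn in auto)
    finally show ?thesis by simp
  qed
  have add_Y: "Y s * Y t = Y (s + t)" for s t
  proof -
    let ?b = "L (E 1 0 (s / (a\<^sup>2 - 1)))" and ?b' = "L (E 1 0 (t / (a\<^sup>2 - 1)))"
    have "over (?b * ?b') (E 1 0 (s / (a\<^sup>2 - 1)) * E 1 0 (t / (a\<^sup>2 - 1)))"
      by (intro over_mult over_E) auto
    then have bb: "over (?b * ?b') (E 1 0 ((s + t) / (a\<^sup>2 - 1)))"
      using nn by (simp add: E_add add_divide_distrib)
    have "Y (s + t) = commutator (L (d (1/a))) (?b * ?b')"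
      unfolding Y_def by (rule commutator_indep[OF over_L[OF d] over_L[OF d] over_E bb]) simp
    also have "\<dots> = Y s * Y t"
      unfolding Y_def
      by (intro commutator_mult_right over_commute[OF over_E over_Y[unfolded Y_def]] E_commute) (use nn in auto)
    finally show ?thesis by simp
  qed
  have "rank_one X Y"
  proof
    fix u t :: 'a assume u: "u \<noteq> 0"
    define w where "w = X u * Y (-1/u) * X u"
    have w: "over w (W 0 1 u)" unfolding w_def W_def by (intro over_mult over_X over_Y)
    have "w * X t * inverse w
        = commutator (w * L (d a) * inverse w) (w * L (E 0 1 (t / (a\<^sup>2 - 1))) * inverse w)"
      by (simp add: X_def commutator_conj)
    also have "\<dots> = Y (-t/u\<^sup>2)"
      unfolding Y_def
    proof (rule commutator_indep[OF _ over_L[OF d] _ over_E])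
      show "over (w * L (d a) * inverse w) (d (1/a))"
      proof (rule over_conj[OF w over_L[OF d] d])
        show "W 0 1 u * d a = d (1/a) * W 0 1 u"
          using nn a u by (intro mat_eqI_mact[of _ n]) (auto simp: mat_eq_simps mact_d field_simps)
      qed
      show "over (w * L (E 0 1 (t / (a\<^sup>2 - 1))) * inverse w) (E 1 0 (- t / u\<^sup>2 / (a\<^sup>2 - 1)))"
      proof (rule over_conj[OF w over_E addrow_mat_SLc])
        show "W 0 1 u * E 0 1 (t / (a\<^sup>2 - 1)) = E 1 0 (- t / u\<^sup>2 / (a\<^sup>2 - 1)) * W 0 1 u"
          using nn a1 u by (intro mat_eqI_mact[of _ n]) (auto simp: mat_eq_simps mact_d field_simps power2_eq_square)
      qed auto
    qed auto
    finally have "w * X t * inverse w * w = Y (-t/u\<^sup>2) * w" by simp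
    then have "w * X t = Y (-t/u\<^sup>2) * w" by (simp add: mult.assoc)
    then show "X u * Y (-1/u) * X u * X t = Y (-t/u\<^sup>2) * (X u * Y (-1/u) * X u)"
      by (simp only: w_def)
  qed (simp_all add: add_X add_Y)
  then show ?thesis using is_lift_2I n2 over_X over_Y by blast
qed

text \<open>
  Here all \<open>h u\<close> are central, so any lift of \<open>E 0 1 1\<close> of the right order will do; it exists because
  square and cube roots exist in \<open>Z\<close>. For \<open>u\<^sup>2 = 1\<close> the matrices \<open>W 0 1 u\<close> and \<open>W 0 1 1\<close> differ by a
  sign, so both conjugate \<open>X t\<close> to \<open>Y (-t)\<close>.
\<close>

lemma is_lift_2_small:
  assumes n2: "n = 2" and sq: "\<And>a :: 'a. a \<noteq> 0 \<Longrightarrow> a\<^sup>2 = 1" shows "\<exists>x. is_lift x"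
proof -
  have nn: "0 < n" "1 < n" using n by auto
  have elts: "a = 0 \<or> a = 1 \<or> a = -1" for a :: 'a
    using sq[of a] power2_eq_iff[of a 1] by auto
  \<comment> \<open>The field has two or three elements; the disjuncts are characteristic 2 and
    3.\<close>
  have char: "1 + 1 = (0 :: 'a) \<or> 1 + 1 = (-1 :: 'a) \<and> 1 \<noteq> (-1 :: 'a)"
    using elts[of "1 + 1"] by (metis add_cancel_right_right eq_neg_iff_add_eq_0 zero_neq_one)
  define l0 where "l0 = L (E 0 1 1)"
  have l: "over l0 (E 0 1 1)" unfolding l0_def by (rule over_E) simp
  have E0: "E 0 1 0 = 1\<^sub>m n"
    using nn by (intro mat_eqI_mact[of _ n]) (auto simp: mat_eq_simps mact_one)
  note E_add' = E_add[OF nn zero_neq_one]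
  obtain e where e: "over e (E 0 1 1)" "1 + 1 = (0 :: 'a) \<Longrightarrow> e * e = 1"
    "1 + 1 = (-1 :: 'a) \<Longrightarrow> 1 \<noteq> (-1 :: 'a) \<Longrightarrow> e * e * e = 1"
  proof (cases "1 + 1 = (0 :: 'a)")
    case True
    have "over (l0 * l0) (1\<^sub>m n)" using over_mult[OF l l] by (simp only: E_add' True E0)
    then obtain z where z: "z \<in> Z" "l0 * l0 = z * 1" using over_same over_one by blast
    obtain y where y: "y \<in> Z" "y * y = inverse z" using Z_sqrt[OF Z_inverse[OF z(1)]] by blast
    have "(y * l0) * (y * l0) = y * (l0 * y) * l0" by (simp add: mult.assoc)
    also have "l0 * y = y * l0" using Z_over[OF l y(1)] by simp
    finally have "(y * l0) * (y * l0) = (y * y) * (l0 * l0)" by (simp add: mult.assoc)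
    then have "(y * l0) * (y * l0) = 1" by (simp add: y z)
    moreover have "1 = (-1 :: 'a)" using True by (simp add: add_eq_0_iff)
    ultimately show thesis using that[of "y * l0"] over_Z[OF l y(1)] by blast
  next
    case False
    then have c: "1 + 1 = (-1 :: 'a)" using char by blast
    have "over (l0 * l0 * l0) (1\<^sub>m n)"
      using over_mult[OF over_mult[OF l l] l] by (simp only: E_add' c E0 add.left_inverse)
    then obtain z where z: "z \<in> Z" "l0 * l0 * l0 = z * 1" using over_same over_one by blast
    obtain y where y: "y \<in> Z" "y * y * y = inverse z" using Z_cube_root[OF Z_inverse[OF z(1)]] by blast
    have ly: "l0 * y = y * l0" using Z_over[OF l y(1)] by simp
    have "(y * l0) * (y * l0) * (y * l0) = (y * y * y) * (l0 * l0 * l0)"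
      by (simp add: mult.assoc ly ly[THEN mult_tail])
    then have "(y * l0) * (y * l0) * (y * l0) = 1" by (simp add: y z)
    then show thesis using that[of "y * l0"] over_Z[OF l y(1)] False by blast
  qed
  define X where "X t = (if t = 0 then 1 else if t = 1 then e else inverse e)" for t :: 'a
  have E_inv: "E 0 1 1 * E 0 1 (-1) = 1\<^sub>m n" by (simp only: E_add' E0 add.right_inverse)
  have over_X: "over (X t) (E 0 1 t)" for t
    using elts[of t] e(1) over_one over_inverse[OF e(1) _ E_inv] E0
    by (auto simp: X_def det_addrow_mat)
  have add_X: "X s * X t = X (s + t)" for s t
  proof -
    from char show ?thesis
    proof (elim disjE conjE)
      assume c: "1 + 1 = (0 :: 'a)"
      have m: "-1 = (1 :: 'a)" using c by (metis add_eq_0_iff)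
      have "inverse e = e" using e(2)[OF c] by (rule inverse_unique_mult)
      then show ?thesis using elts[of s] elts[of t] c e(2)[OF c] unfolding m
        by (elim disjE) (simp_all only: X_def add_0_left add_0_right mult_1_left mult_1_right if_True if_False 
            zero_neq_one one_neq_zero simp_thms)
    next
      assume c: "1 + 1 = (-1 :: 'a)" "1 \<noteq> (-1 :: 'a)"
      have e1: "e * (e * e) = 1" using e(3)[OF c] by (simp add: mult.assoc)
      then have inv: "inverse e = e * e" by (rule inverse_unique_mult)
      have c': "-1 + -1 = (1 :: 'a)" "1 + -1 = (0 :: 'a)" "-1 + 1 = (0 :: 'a)" "-1 \<noteq> (0 :: 'a)" "-1 \<noteq> (1 :: 'a)"
        using c by (simp_all flip: minus_add_distrib)
      have e4: "e * e * (e * e) = e" "e * (e * e) = 1" "e * e * e = 1"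
        by (simp_all add: mult.assoc e1)
      show ?thesis using elts[of s] elts[of t]
        by (elim disjE) (simp_all only: X_def add_0_left add_0_right mult_1_left mult_1_right if_True if_False
          zero_neq_one one_neq_zero c c' inv e4 simp_thms)
    qed
  qed
  define w0 where "w0 = L (W 0 1 1)"
  have w0: "over w0 (W 0 1 1)" unfolding w0_def by (intro over_L W_SLc) simp
  have inv_w0: "over (inverse w0) (W 0 1 (-1))"
    using nn by (intro over_inverse[OF w0 W_SLc] mat_eqI_mact[of _ n]) (auto simp: mat_eq_simps mact_one)
  define Y where "Y t = w0 * X (-t) * inverse w0" for t
  have over_Y: "over (Y t) (E 1 0 t)" for t
    unfolding Y_def
    by (rule over_conj[OF w0 over_X addrow_mat_SLc], simp, intro mat_eqI_mact[of _ n])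
      (use nn in \<open>auto simp: mat_eq_simps\<close>)
  have "rank_one X Y"
  proof
    fix u t :: 'a assume u: "u \<noteq> 0"
    define w where "w = X u * Y (-1/u) * X u"
    have w: "over w (W 0 1 u)" unfolding w_def W_def by (intro over_mult over_X over_Y)
    \<comment> \<open>\<open>inverse w0 * w\<close> lies over diag(1/u, u), a scalar matrix because
      \<open>u\<^sup>2 = 1\<close>.\<close>
    have "inverse w0 * w * X t = X t * (inverse w0 * w)"
      by (rule over_commute[OF over_mult[OF inv_w0 w] over_X], intro mat_eqI_mact[of _ n])
        (use nn u sq[OF u] in \<open>auto simp: mat_eq_simps field_simps power2_eq_square\<close>)
    then have "w0 * (inverse w0 * w * X t) = w0 * (X t * (inverse w0 * w))" by simp
    then have "w * X t = Y (-t/u\<^sup>2) * w" using sq[OF u] by (simp add: Y_def mult.assoc)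
    then show "X u * Y (-1/u) * X u * X t = Y (-t/u\<^sup>2) * (X u * Y (-1/u) * X u)"
      by (simp only: w_def)
  qed (simp_all add: add_X Y_def mult.assoc mult_tail[OF add_X] add.commute)
  then show ?thesis using is_lift_2I n2 over_X over_Y by blast
qed

lemma is_lift_exists: "\<exists>x. is_lift x"
proof (cases "n = 2")
  case True
  then show ?thesis using is_lift_2_large is_lift_2_small by blast
next
  case False
  then show ?thesis using is_lift_ge_3 n by simp
qed

end

section \<open>Splitting over the special linear group\<close>

text \<open>A block condition in terms of the action: rows (first clause) and columns (second
  clause) outside \<open>J\<close> are those of the identity matrix.\<close>

definition mact_within :: "nat set \<Rightarrow> nat \<Rightarrow> 'a :: comm_ring_1 mat \<Rightarrow> bool" where
  "mact_within J n M \<longleftrightarrow> (\<forall>v. (\<forall>i. i \<notin> J \<longrightarrow> mact n M v i = v i) \<and> ((\<forall>j\<in>J. v j = 0) \<longrightarrow> mact n M v = v))"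

lemma mact_withinD:
  "mact_within J n M \<Longrightarrow> i \<notin> J \<Longrightarrow> mact n M v i = v i"
  "mact_within J n M \<Longrightarrow> (\<And>j. j \<in> J \<Longrightarrow> v j = 0) \<Longrightarrow> mact n M v = v"
  unfolding mact_within_def by blast+

lemma mact_within_mult:
  assumes "mact_within J n M" "mact_within J n N" "M \<in> carrier_mat n n" "N \<in> carrier_mat n n"
  shows "mact_within J n (M * N)"
  using assms unfolding mact_within_def by (simp add: mact_mult)

context commuting_lift
begin

definition pr where "pr k = (THE g. over k g)"

lemma pr_eq: "over k g \<Longrightarrow> pr k = g"
  unfolding pr_def by (rule the_equality) (auto intro: over_unique)

lemma over_gen:
  assumes "is_lift x" "k \<in> gen {x i j t | i j t. i \<in> {..<n} \<and> j \<in> {..<n} \<and> i \<noteq> j}"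
  shows "over k (pr k)"
proof -
  from assms(2) have "\<exists>g. over k g"
  proof induction
    case gen_one
    then show ?case using over_one by blast
  next
    case (gen_step s k)
    then have "\<exists>g. over s g" using assms(1) unfolding is_lift_def by blast
    then show ?case using gen_step over_mult by blast
  qed
  then show ?thesis using pr_eq by blast
qed

lemma steinberg_lift_is_lift:
  assumes x: "is_lift x"
  shows "steinberg_lift {..<n} x (\<lambda>k. mact n (pr k))"
proof -
  have rank: "rank_one (x i j) (x j i)" and over_x: "over (x i j t) (E i j t)"
    and stb: "k < n \<Longrightarrow> j \<noteq> k \<Longrightarrow> i \<noteq> k \<Longrightarrow> x i j s * x j k t = x i k (s * t) * x j k t * x i j s"
    if "i < n" "j < n" "i \<noteq> j" for i j k s t
    using x that unfolding is_lift_def by blast+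
  show ?thesis
  proof (rule steinberg_lift.intro)
    fix i j k l s t assume "i \<in> {..<n}" "j \<in> {..<n}" "k \<in> {..<n}" "l \<in> {..<n}"
      "i \<noteq> j" "k \<noteq> l" "i \<noteq> l" "j \<noteq> k"
    then show "x i j s * x k l t = x k l t * x i j s"
      by (intro over_commute[OF over_x over_x] E_commute) auto
  next
    fix i j assume ij: "i \<in> {..<n}" "j \<in> {..<n}" "i \<noteq> j"
    interpret rank_one "x i j" "x j i" using rank ij by simp
    have over_h: "over (h u) (W i j u * W i j (-1))" for u
      unfolding h_def w_def W_def using ij by (intro over_mult over_x) auto
    show "rank_one_finite (x i j) (x j i)"
    proof
      fix u v :: 'a assume uv: "u \<noteq> 0" "v \<noteq> 0"
      show "h u * h v = h v * h u"
        by (rule over_commute[OF over_h over_h], rule mat_eqI_mact[of _ n])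
          (use ij uv in \<open>auto simp: mat_eq_simps\<close>)
    qed
    fix s t show "x i j s * x i j t = x i j (s + t)" by (rule x_add)
  next
    show "mact n (pr 1) = id" using pr_eq[OF over_one] by (simp add: mact_one)
  next
    fix k l assume "k \<in> gen {x i j t | i j t. i \<in> {..<n} \<and> j \<in> {..<n} \<and> i \<noteq> j}"
      "l \<in> gen {x i j t | i j t. i \<in> {..<n} \<and> j \<in> {..<n} \<and> i \<noteq> j}"
    then have kl: "over k (pr k)" "over l (pr l)" using over_gen[OF x] by auto
    then show "mact n (pr (k * l)) = mact n (pr k) \<circ> mact n (pr l)"
      using pr_eq[OF over_mult[OF kl]] over_SLc by (auto simp: mact_mult fun_eq_iff)
  next
    fix i j t assume "i \<in> {..<n}" "j \<in> {..<n}" "i \<noteq> j"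
    then show "mact n (pr (x i j t)) = transv i j t"
      using pr_eq[OF over_x] by (simp add: mact_E)
  qed (use stb in auto)
qed

text \<open>Gaussian elimination carried out on lifts inside the block \<open>J\<close>: make column
  \<open>p\<close> a basis vector, clear row \<open>p\<close>, and continue with
  \<open>J - {p}\<close>.\<close>

lemma generated:
  assumes x: "is_lift x" and "J \<subseteq> {..<n}" "g \<in> SLc n" "mact_within J n g"
  shows "\<exists>k\<in>gen {x i j t | i j t. i \<in> J \<and> j \<in> J \<and> i \<noteq> j}. over k g"
proof -
  interpret S: steinberg_lift "{..<n}" x "\<lambda>k. mact n (pr k)"
    by (rule steinberg_lift_is_lift[OF x])
  have over_K: "over k (pr k)" if "k \<in> S.K J" "J \<subseteq> {..<n}" for k J
    using over_gen[OF x] S.K_mono[OF that(2)] that(1) unfolding S.K_def by blast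
  have within_K: "mact_within J n (pr k)" if "k \<in> S.K J" "J \<subseteq> {..<n}" for k J
    unfolding mact_within_def using S.rho_outside[OF that] S.rho_fix[OF that] by blast
  let ?e = "\<lambda>j i. if i = j then 1 else (0 :: 'a)"
  have entry: "g $$ (i, j) = mact n g (?e j) i" if "i < n" "j < n" for g i j
    using that by (simp add: mact_unit)
  have "finite J" using assms(2) finite_subset by blast
  then have "\<exists>k\<in>S.K J. over k g" using assms(2-)
  proof (induction J arbitrary: g rule: finite_psubset_induct)
    case (psubset J)
    have gc: "g \<in> carrier_mat n n" using psubset by simp
    show ?case
    proof (cases "\<exists>p r. p \<in> J \<and> r \<in> J \<and> p \<noteq> r")
      case False
      \<comment> \<open>Only the diagonal entry at \<open>p\<close> can differ from the identity,
        and determinant 1 fixes it. For empty \<open>J\<close> the index 0 stands in.\<close>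
      obtain p where p: "p < n" "J \<subseteq> {p}"
      proof (cases "J = {}")
        case True
        then show thesis using that[of 0] n by auto
      next
        case False
        then obtain p where "p \<in> J" by blast
        then show thesis using that[of p] psubset(3) \<open>\<not> (\<exists>p r. _)\<close> by auto
      qed
      have g: "g $$ (i, j) = (if i = j then 1 else 0)" if "i < n" "j < n" "i \<noteq> p \<or> j \<noteq> p" for i j
      proof (cases "i = p")
        case False
        then have "i \<notin> J" using p by blast
        then show ?thesis using that mact_withinD(1)[OF psubset(5), of i "?e j"] by (simp add: entry)
      next
        case True
        then have "l \<noteq> j" if "l \<in> J" for l using \<open>i \<noteq> p \<or> j \<noteq> p\<close> that p by blast
        with True show ?thesis using that p mact_withinD(2)[OF psubset(5), of "?e j"] by (auto simp: entry)
      qed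
      have "g = multrow_mat n p (g $$ (p, p))"
        using gc p by (intro eq_matI) (auto simp: g)
      then have "det g = g $$ (p, p)" using det_multrow_mat[OF p(1)] by metis
      then have "g $$ (j, j) = 1" if "j < n" for j
        using g[of j j] that psubset(4) by (cases "j = p") auto
      then have "g = 1\<^sub>m n" using gc by (intro eq_matI) (auto simp: g)
      then show ?thesis using over_one S.K_one by blast
    next
      case True
      then obtain p r where pr: "p \<in> J" "r \<in> J" "p \<noteq> r" by blast
      then have pn: "p < n" using psubset by auto
      obtain h where h: "h \<in> SLc n" "h * g = 1\<^sub>m n" using SLc_inverse[OF psubset(4)] by metis
      define f where "f = mact n g (?e p)"
      have "mact n h f = ?e p"
        using mact_mult[of h n g "?e p"] h gc by (simp add: f_def mact_one)
      then have "mact n h f p = 1" by simp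
      then have "\<exists>i. f i \<noteq> 0" by (rule contrapos_pp) (simp add: mact_def)
      moreover have "f i = 0" if "i \<notin> J" for i
        using mact_withinD(1)[OF psubset(5) that] pr that by (auto simp: f_def)
      moreover have "J \<noteq> {p}" using pr by auto
      ultimately obtain k where k: "k \<in> S.K J" "mact n (pr k) (?e p) = f"
        using S.transitive[of J p f] psubset(3) pr by auto
      have ik: "inverse k \<in> S.K J" using S.K_inverse k psubset(3) by blast
      \<comment> \<open>\<open>k\<close> has the same column \<open>p\<close> as \<open>g\<close>,
        so column \<open>p\<close> of the quotient is a basis vector.\<close>
      define g1 where "g1 = pr (inverse k) * g"
      have over_k: "over k (pr k)" "over (inverse k) (pr (inverse k))"
        using over_K k ik psubset(3) by auto
      then have c: "pr k \<in> carrier_mat n n" "pr (inverse k) \<in> carrier_mat n n"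
        using over_SLc by auto
      have inv: "pr k * pr (inverse k) = 1\<^sub>m n" "pr (inverse k) * pr k = 1\<^sub>m n"
        using over_mult[OF over_k] over_mult[OF over_k(2,1)] over_one over_unique by auto
      have g1c: "g1 \<in> carrier_mat n n" using c gc by (simp add: g1_def)
      have g1_within: "mact_within J n g1"
        unfolding g1_def using within_K ik psubset c gc by (intro mact_within_mult) auto
      have g1_p: "mact n g1 (?e p) = ?e p"
        using mact_mult[OF c(2) gc, of "?e p"] mact_mult[OF c(2,1), of "?e p"] k(2)
        by (simp add: g1_def inv mact_one f_def)
      obtain js where js: "distinct js" "set js = J - {p}"
        using S.J_list[of J p r] psubset(3) pr by auto
      \<comment> \<open>Right multiplication by \<open>q\<close> subtracts multiples of column
        \<open>p\<close>, which is a basis vector, so precisely row \<open>p\<close> is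
        cleared.\<close>
      define q where "q = prod_list (map (\<lambda>j. x p j (- (g1 $$ (p, j)))) js)"
      have q: "q \<in> S.K J" "\<And>v. mact n (pr q) v = v(p := v p + (\<Sum>j\<in>J - {p}. - (g1 $$ (p, j)) * v j))"
        using S.row_product[of J p r js "\<lambda>j. - (g1 $$ (p, j))"] psubset(3) pr js by (auto simp: q_def)
      have over_q: "over q (pr q)" using over_K q psubset(3) by blast
      then have qc: "pr q \<in> carrier_mat n n" using over_SLc by auto
      define g2 where "g2 = g1 * pr q"
      have row: "mact n g1 v p = v p + (\<Sum>j\<in>J - {p}. g1 $$ (p, j) * v j)" for v
      proof -
        have z: "g1 $$ (p, j) = 0" if "j < n" "j \<notin> J" for j
        proof -
          have "l \<noteq> j" if "l \<in> J" for l using that \<open>j \<notin> J\<close> by blast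
          then have "mact n g1 (?e j) = ?e j" by (intro mact_withinD(2)[OF g1_within]) auto
          then show ?thesis using that pn pr by (auto simp: entry)
        qed
        have 1: "g1 $$ (p, p) = 1" using g1_p pn by (simp add: entry)
        have "mact n g1 v p = (\<Sum>j = 0..<n. g1 $$ (p, j) * v j)" using pn by (simp add: mact_def)
        also have "\<dots> = (\<Sum>j\<in>J. g1 $$ (p, j) * v j)"
          using psubset(3) z by (intro sum.mono_neutral_right) auto
        also have "\<dots> = v p + (\<Sum>j\<in>J - {p}. g1 $$ (p, j) * v j)"
          using psubset(1) pr 1 by (simp add: sum.remove[of J p])
        finally show ?thesis .
      qed
      have g2: "mact n g2 v = mact n g1 (mact n (pr q) v)" for v
        unfolding g2_def by (rule mact_mult[OF g1c qc])
      have "mact_within (J - {p}) n g2"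
        unfolding mact_within_def g2
      proof (intro allI conjI impI)
        fix v :: "nat \<Rightarrow> 'a" and i assume i: "i \<notin> J - {p}"
        show "mact n g1 (mact n (pr q) v) i = v i"
        proof (cases "i = p")
          case True
          then show ?thesis by (simp add: row q(2) sum_negf cong: sum.cong_simp)
        next
          case False
          then show ?thesis using i mact_withinD(1)[OF g1_within, of i] by (simp add: q(2))
        qed
      next
        fix v :: "nat \<Rightarrow> 'a" assume v: "\<forall>j\<in>J - {p}. v j = 0"
        then have "mact n (pr q) v = v" by (simp add: q(2))
        moreover have "mact n g1 (\<lambda>i. (v p * ?e p i) + (v(p := 0)) i) = (\<lambda>i. (v p * ?e p i) + (v(p := 0)) i)"
        proof -
          have "mact n g1 (\<lambda>i. v p * ?e p i) = (\<lambda>i. v p * mact n g1 (?e p) i)"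
            by (auto simp: mact_def fun_eq_iff sum_distrib_left mult_ac intro!: sum.cong)
          moreover have "mact n g1 (v(p := 0)) = v(p := 0)"
            using v by (intro mact_withinD(2)[OF g1_within]) auto
          ultimately show ?thesis by (simp only: mact_add g1_p)
        qed
        moreover have "(\<lambda>i. (v p * ?e p i) + (v(p := 0)) i) = v" by auto
        ultimately show "mact n g1 (mact n (pr q) v) = v" by metis
      qed
      moreover have "g2 \<in> SLc n"
        unfolding g2_def g1_def using over_SLc over_k over_q psubset(4) by (intro SLc_mult) blast+
      moreover have "J - {p} \<subset> J" "J - {p} \<subseteq> {..<n}" using pr psubset(3) by auto
      ultimately obtain k2 where k2: "k2 \<in> S.K (J - {p})" "over k2 g2"
        using psubset.IH by meson
      have iq: "inverse q \<in> S.K J" using S.K_inverse q psubset(3) by blast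
      have over_iq: "over (inverse q) (pr (inverse q))" using over_K iq psubset(3) by blast
      then have iqc: "pr (inverse q) \<in> carrier_mat n n" using over_SLc by auto
      have qiq: "pr q * pr (inverse q) = 1\<^sub>m n"
        using over_mult[OF over_q over_iq] over_one over_unique by auto
      have "pr k * g2 * pr (inverse q) = pr k * g1 * (pr q * pr (inverse q))"
        using c g1c qc iqc by (simp add: g2_def assoc_mult_mat[of _ n n _ n _ n])
      also have "\<dots> = (pr k * pr (inverse k)) * g"
        using c gc g1c by (simp add: qiq g1_def assoc_mult_mat[of _ n n _ n _ n])
      also have "\<dots> = g" using gc by (simp add: inv)
      finally have "over (k * k2 * inverse q) g"
        using over_mult[OF over_mult[OF over_k(1) k2(2)] over_iq] by simp
      moreover have "k * k2 * inverse q \<in> S.K J"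
        using k k2 iq S.K_mono[of "J - {p}" J] by (intro S.K_mult) auto
      ultimately show ?thesis by blast
    qed
  qed
  then show ?thesis by (simp add: S.K_def)
qed

text \<open>Lifts are chosen inside the generated group. The failure of multiplicativity then lies
  in that group and over the identity matrix, hence is trivial by
  \<open>kernel_trivial\<close>.\<close>

theorem section_exists:
  obtains s where "\<And>g. g \<in> SLc n \<Longrightarrow> over (s g) g"
    and "\<And>g h. g \<in> SLc n \<Longrightarrow> h \<in> SLc n \<Longrightarrow> s (g * h) = s g * s h"
proof -
  obtain x where x: "is_lift x" using is_lift_exists by blast
  interpret S: steinberg_lift "{..<n}" x "\<lambda>k. mact n (pr k)"
    by (rule steinberg_lift_is_lift[OF x])
  let ?K = "S.K {..<n}"
  have "\<exists>k. k \<in> ?K \<and> over k g" if "g \<in> SLc n" for g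
  proof -
    have "mact_within {..<n} n g"
      unfolding mact_within_def by (auto simp: mact_def fun_eq_iff)
    then show ?thesis unfolding S.K_def using generated[OF x order_refl that] by blast
  qed
  then have "\<forall>g\<in>SLc n. \<exists>k. k \<in> ?K \<and> over k g" by blast
  from bchoice[OF this] obtain s where "\<forall>g\<in>SLc n. s g \<in> ?K \<and> over (s g) g" ..
  then have s: "\<And>g. g \<in> SLc n \<Longrightarrow> s g \<in> ?K" "\<And>g. g \<in> SLc n \<Longrightarrow> over (s g) g" by blast+
  have "s (g * h) = s g * s h" if gh: "g \<in> SLc n" "h \<in> SLc n" for g h
  proof -
    define k where "k = s g * s h * inverse (s (g * h))"
    note ghS = SLc_mult[OF gh]
    have over: "over (s g * s h) (g * h)" using s gh by (intro over_mult)
    have kK: "k \<in> ?K" unfolding k_def using s gh ghS by (intro S.K_mult S.K_inverse) auto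
    obtain m where m: "m \<in> SLc n" "g * h * m = 1\<^sub>m n" using SLc_inverse[OF ghS] by metis
    have "over k (1\<^sub>m n)"
      unfolding k_def using over_mult[OF over over_inverse[OF s(2)[OF ghS] m]] m(2) by simp
    then have "mact n (pr k) = id" using pr_eq mact_one by metis
    then have "k = 1" using S.kernel_trivial[OF order_refl kK] by simp
    then have "k * s (g * h) = s (g * h)" by simp
    then show ?thesis by (simp add: k_def mult.assoc)
  qed
  then show thesis using that s by blast
qed

end

section \<open>Pairs of matrices commuting up to a scalar\<close>

text \<open>One family for diagonal matrices (\<open>\<sigma> = id\<close>) and permutation matrices
  (\<open>c\<close> constantly 1).\<close>

definition mono_mat :: "nat \<Rightarrow> (nat \<Rightarrow> nat) \<Rightarrow> (nat \<Rightarrow> 'a) \<Rightarrow> 'a :: comm_ring_1 mat" where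
  "mono_mat n \<sigma> c = mat n n (\<lambda>(i, j). if j = \<sigma> i then c i else 0)"

lemma mono_mat_carrier [simp]: "mono_mat n \<sigma> c \<in> carrier_mat n n"
  by (simp add: mono_mat_def)

lemma mact_mono_mat:
  assumes "i < n" "\<sigma> i < n" shows "mact n (mono_mat n \<sigma> c) v i = c i * v (\<sigma> i)"
proof -
  have "mact n (mono_mat n \<sigma> c) v i = (\<Sum>j = 0..<n. if j = \<sigma> i then c i * v j else 0)"
    unfolding mact_def using assms(1) by (simp only: if_True) (rule sum.cong, auto simp: mono_mat_def)
  then show ?thesis using assms by simp
qed

lemma det_mono_mat_id: "det (mono_mat n id c) = (\<Prod>i = 0..<n. c i)"
proof -
  have "det (mono_mat n id c) = prod_list (diag_mat (mono_mat n id c))"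
    by (rule det_lower_triangular[of n]) (auto simp: mono_mat_def)
  also have "\<dots> = (\<Prod>i = 0..<n. c i)"
    unfolding prod_list_diag_prod by (auto simp: mono_mat_def intro!: prod.cong)
  finally show ?thesis .
qed

lemma mono_mat_scalar: "mono_mat n id (\<lambda>_. z) = z \<cdot>\<^sub>m 1\<^sub>m n"
  by (rule eq_matI) (auto simp: mono_mat_def)

text \<open>Replaces the sign of the permutation: an inverse permutation shows that the determinant
  is a unit, and later constructions divide by it.\<close>

lemma det_mono_mat_nonzero:
  fixes c :: "nat \<Rightarrow> 'a :: field"
  assumes "\<And>i. i < n \<Longrightarrow> \<sigma> i < n" "\<And>i. i < n \<Longrightarrow> \<tau> i < n" "\<And>i. i < n \<Longrightarrow> \<tau> (\<sigma> i) = i"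
  shows "det (mono_mat n \<sigma> (\<lambda>_. 1 :: 'a)) \<noteq> 0"
proof -
  have "mono_mat n \<sigma> (\<lambda>_. 1 :: 'a) * mono_mat n \<tau> (\<lambda>_. 1) = 1\<^sub>m n"
    by (rule mat_eqI_mact_less[of _ n]) (auto simp: mact_mult mact_mono_mat mact_one assms)
  then have "det (mono_mat n \<sigma> (\<lambda>_. 1 :: 'a)) * det (mono_mat n \<tau> (\<lambda>_. 1 :: 'a)) = 1"
    by (metis det_mult det_one mono_mat_carrier)
  then show ?thesis by auto
qed

text \<open>For nonzero \<open>a\<close> an LDU factorisation shows both the action and the
  determinant.\<close>

lemma two_block:
  fixes a b c d :: "'a :: field"
  assumes pq: "p < n" "q < n" "p \<noteq> q" and det: "a * d - b * c \<noteq> 0"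
  obtains R where "R \<in> carrier_mat n n" "det R = a * d - b * c"
    "\<And>v. mact n R v = v(p := a * v p + b * v q, q := c * v p + d * v q)"
proof -
  have main: "\<exists>R. R \<in> carrier_mat n n \<and> det R = a * d - b * c \<and>
      (\<forall>v. mact n R v = v(p := a * v p + b * v q, q := c * v p + d * v q))"
    if a: "a \<noteq> 0" for a b c d :: 'a
  proof (intro exI conjI allI)
    let ?D = "mono_mat n id (\<lambda>i. if i = p then a else if i = q then (a * d - b * c) / a else 1)"
    let ?R = "addrow_mat n (c / a) q p * ?D * addrow_mat n (b / a) p q"
    show "?R \<in> carrier_mat n n" by (intro mult_carrier_mat) auto
    have "(\<Prod>i = 0..<n. if i = p then a else if i = q then (a * d - b * c) / a else 1)
        = (\<Prod>i\<in>{p, q}. if i = p then a else if i = q then (a * d - b * c) / a else 1)"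
      using pq by (intro prod.mono_neutral_right) auto
    then have "det ?D = a * d - b * c" using pq a by (simp add: det_mono_mat_id)
    then show "det ?R = a * d - b * c"
      using pq by (simp add: det_mult[of _ n] det_addrow_mat)
    fix v
    have "mact n ?R v i = (v(p := a * v p + b * v q, q := c * v p + d * v q)) i" if "i < n" for i
      using that pq a
      by (auto simp: mact_mult mact_addrow_mat mact_mono_mat transv_def field_simps)
    then show "mact n ?R v = v(p := a * v p + b * v q, q := c * v p + d * v q)"
      using pq by (auto simp: fun_eq_iff mact_def)
  qed
  show thesis
  proof (cases "a = 0")
    case False
    then show thesis using main that by blast
  next
    case True
    then have "b \<noteq> 0" using det by auto
    \<comment> \<open>(0, b; c, d) is (b, 0; d, -c) times the rotation (0, 1; -1, 0), and the
      rotation is \<open>S * T * S\<close>.\<close>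
    from main[OF this, where b = 0 and c = d and d = "- c"] obtain R where R: "R \<in> carrier_mat n n" "det R = - (b * c)"
      "\<And>v. mact n R v = v(p := b * v p, q := d * v p - c * v q)" by auto
    from main[where a = 1 and b = 1 and c = 0 and d = 1] main[where a = 1 and b = 0 and c = "-1" and d = 1]
    obtain S T :: "'a mat" where
      S: "S \<in> carrier_mat n n" "det S = 1" "\<And>v. mact n S v = v(p := v p + v q, q := v q)"
      and T: "T \<in> carrier_mat n n" "det T = 1" "\<And>v. mact n T v = v(q := v q - v p)"
      by auto
    have c: "R * (S * T * S) \<in> carrier_mat n n" "S * T * S \<in> carrier_mat n n" "S * T \<in> carrier_mat n n"
      using R S T by auto
    show thesis
    proof (rule that)
      show "det (R * (S * T * S)) = a * d - b * c"
        using R S T c True by (simp add: det_mult[of _ n])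
      show "mact n (R * (S * T * S)) v = v(p := a * v p + b * v q, q := c * v p + d * v q)" for v
        using R S T c pq True by (simp add: mact_mult fun_eq_iff)
    qed (rule c)
  qed
qed

text \<open>Clock and shift matrices, the shift being rescaled to determinant 1.\<close>

lemma skew_pair_diag:
  fixes z :: "'a :: field"
  assumes n: "n > 0" and z: "z ^ n = 1" and prod: "(\<Prod>i = 0..<n. z ^ i) = 1"
  shows "\<exists>X\<in>SLc n. \<exists>P\<in>SLc n. X * P = (z \<cdot>\<^sub>m 1\<^sub>m n) * (P * X)"
proof -
  define \<sigma> where "\<sigma> i = (if i = 0 then n - 1 else i - 1)" for i
  define \<tau> where "\<tau> i = (if i = n - 1 then 0 else i + 1)" for i
  have \<sigma>: "\<sigma> i < n" "\<tau> i < n" "\<tau> (\<sigma> i) = i" if "i < n" for i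
    using that n by (auto simp: \<sigma>_def \<tau>_def)
  define \<delta> where "\<delta> = det (mono_mat n \<sigma> (\<lambda>_. 1 :: 'a))"
  have \<delta>: "\<delta> \<noteq> 0" unfolding \<delta>_def using \<sigma> by (intro det_mono_mat_nonzero)
  define X where "X = mono_mat n id (\<lambda>i. z ^ i)"
  \<comment> \<open>The determinant is corrected by a diagonal matrix, which commutes with
    \<open>X\<close> and so leaves the commutation relation intact.\<close>
  define D where "D = mono_mat n id (\<lambda>i. if i = 0 then 1 / \<delta> else 1)"
  define P where "P = mono_mat n \<sigma> (\<lambda>_. 1) * D"
  have "det D = 1 / \<delta>" using n by (simp add: D_def det_mono_mat_id prod.remove[of _ 0])
  then have "P \<in> SLc n" using \<delta> by (simp add: P_def D_def det_mult[of _ n] \<delta>_def)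
  moreover have "X \<in> SLc n" using prod by (simp add: X_def det_mono_mat_id)
  moreover have "X * P = (z \<cdot>\<^sub>m 1\<^sub>m n) * (P * X)"
  proof (rule mat_eqI_mact_less[of _ n])
    fix v :: "nat \<Rightarrow> 'a" and i assume i: "i < n"
    \<comment> \<open>At \<open>i = 0\<close> the shift wraps around to \<open>n - 1\<close>, and
      \<open>z ^ n = 1\<close> is needed.\<close>
    have "z * z ^ \<sigma> i = z ^ i" using i z n by (cases i) (auto simp: \<sigma>_def simp flip: power_Suc)
    then show "mact n (X * P) v i = mact n ((z \<cdot>\<^sub>m 1\<^sub>m n) * (P * X)) v i"
      unfolding X_def P_def D_def mono_mat_scalar[symmetric]
      using i \<sigma>[OF i] by (simp add: mact_mult mact_mono_mat)
  qed (simp_all add: X_def P_def D_def)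
  ultimately show ?thesis by blast
qed

lemma block_diagonal:
  fixes a b c d :: "nat \<Rightarrow> 'a :: field"
  assumes "2 * k \<le> n" "\<And>l. l < k \<Longrightarrow> a l * d l - b l * c l \<noteq> 0"
  shows "\<exists>R \<in> carrier_mat n n. det R = (\<Prod>l<k. a l * d l - b l * c l) \<and>
    (\<forall>v i. mact n R v i = (if i < 2 * k then
       if even i then a (i div 2) * v i + b (i div 2) * v (i + 1)
       else c (i div 2) * v (i - 1) + d (i div 2) * v i else v i))"
  using assms
proof (induction k)
  case 0
  then show ?case by (intro bexI[of _ "1\<^sub>m n"]) (auto simp: mact_one)
next
  case (Suc k)
  then obtain R where R: "R \<in> carrier_mat n n" "det R = (\<Prod>l<k. a l * d l - b l * c l)"
    "\<And>v i. mact n R v i = (if i < 2 * k then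
       if even i then a (i div 2) * v i + b (i div 2) * v (i + 1)
       else c (i div 2) * v (i - 1) + d (i div 2) * v i else v i)" by auto
  obtain Q where Q: "Q \<in> carrier_mat n n" "det Q = a k * d k - b k * c k"
    "\<And>v. mact n Q v = v(2 * k := a k * v (2 * k) + b k * v (2 * k + 1),
       2 * k + 1 := c k * v (2 * k) + d k * v (2 * k + 1))"
    by (rule two_block[of "2 * k" n "2 * k + 1" "a k" "d k" "b k" "c k"]) (use Suc.prems in auto)
  show ?case
  proof (intro bexI[of _ "Q * R"] conjI allI)
    show "det (Q * R) = (\<Prod>l<Suc k. a l * d l - b l * c l)"
      using Q R by (simp add: det_mult[of _ n] mult.commute)
    fix v :: "nat \<Rightarrow> 'a" and i
    consider "i < 2 * k" | "i = 2 * k" | "i = 2 * k + 1" | "i > 2 * k + 1" by linarith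
    then show "mact n (Q * R) v i = (if i < 2 * Suc k then
       if even i then a (i div 2) * v i + b (i div 2) * v (i + 1)
       else c (i div 2) * v (i - 1) + d (i div 2) * v i else v i)"
      by cases (simp_all add: mact_mult[OF Q(1) R(1)] Q(3) R(3))
  qed (use Q R in simp)
qed

text \<open>
  In this case the clock matrix has determinant \<open>-1\<close>. Instead, \<open>P\<close> is block diagonal with blocks
  \<open>z\<^sup>l * (0, z; 1, 0)\<close> and \<open>X\<close> shifts the blocks, modified on one of them by a matrix anticommuting with
  \<open>(0, z; 1, 0)\<close>. Such matrices have determinant \<open>- a\<^sup>2 + b\<^sup>2 / z\<close>, a form that represents every element.
\<close>

lemma skew_pair_blocks:
  fixes z :: "'a :: {field, finite}"
  assumes m: "m > 0" and z: "z ^ m = -1"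
  shows "\<exists>X\<in>SLc (2 * m). \<exists>P\<in>SLc (2 * m). X * P = (z \<cdot>\<^sub>m 1\<^sub>m (2 * m)) * (P * X)"
proof -
  define n where "n = 2 * m"
  have z0: "z \<noteq> 0" using z m by (auto simp: zero_power)
  have "\<exists>P \<in> carrier_mat n n. det P = (\<Prod>l<m. 0 * 0 - z ^ (l + 1) * z ^ l) \<and>
    (\<forall>v i. mact n P v i = (if i < 2 * m then
       if even i then 0 * v i + z ^ (i div 2 + 1) * v (i + 1) else z ^ (i div 2) * v (i - 1) + 0 * v i
     else v i))"
    by (rule block_diagonal[of m n "\<lambda>_. 0" "\<lambda>_. 0" "\<lambda>l. z ^ (l + 1)" "\<lambda>l. z ^ l"])
      (use z0 in \<open>simp_all add: n_def\<close>)
  then obtain P where P: "P \<in> carrier_mat n n" "det P = (\<Prod>l<m. 0 * 0 - z ^ (l + 1) * z ^ l)"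
    "\<And>v i. mact n P v i = (if i < 2 * m then
       if even i then 0 * v i + z ^ (i div 2 + 1) * v (i + 1) else z ^ (i div 2) * v (i - 1) + 0 * v i
     else v i)"
    by blast
  \<comment> \<open>The exponents of \<open>z\<close> are the first \<open>k\<close> odd numbers,
    with sum \<open>k * k\<close>.\<close>
  have "(\<Prod>l<k. 0 * 0 - z ^ (l + 1) * z ^ l) = (-1) ^ k * (z ^ k) ^ k" for k
  proof (induction k)
    case (Suc k)
    have "(z ^ Suc k) ^ Suc k = (z ^ k) ^ k * (z ^ (k + 1) * z ^ k)"
      by (simp add: power_mult_distrib mult_ac flip: power_mult)
    then show ?case by (simp only: prod.lessThan_Suc Suc) simp
  qed simp
  then have "det P = (-1) ^ m * (-1) ^ m" by (simp add: P(2) z)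
  then have P_SL: "P \<in> SLc n" using P(1) by (simp flip: power_add)
  define \<sigma> where "\<sigma> i = (if i < 2 then i + n - 2 else i - 2)" for i
  define \<tau> where "\<tau> i = (if i \<ge> n - 2 then i + 2 - n else i + 2)" for i
  have \<sigma>: "\<sigma> i < n" "\<tau> i < n" "\<tau> (\<sigma> i) = i" if "i < n" for i
    using that m by (auto simp: \<sigma>_def \<tau>_def n_def) arith+
  define S where "S = mono_mat n \<sigma> (\<lambda>_. 1 :: 'a)"
  have S: "S \<in> carrier_mat n n" "\<And>v i. i < n \<Longrightarrow> mact n S v i = v (\<sigma> i)"
    using \<sigma> by (simp_all add: S_def mact_mono_mat)
  have det_S: "det S \<noteq> 0" unfolding S_def using \<sigma> by (intro det_mono_mat_nonzero)
  \<comment> \<open>Around the cycle of blocks the powers of \<open>z\<close> accumulate to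
    \<open>z ^ m = -1\<close> instead of 1. A factor anticommuting with (0, z; 1, 0) in one block
    supplies the missing sign; its determinant is chosen to cancel that of \<open>S\<close>.\<close>
  obtain a b where ab: "-1 * a\<^sup>2 + (1 / z) * b\<^sup>2 = 1 / det S"
    using finite_field_two_squares[of "-1" "1 / z" "1 / det S"] z0 by auto
  have det_ab: "a * (- a) - b * (- b / z) = 1 / det S"
    using ab by (simp add: power2_eq_square)
  have "a * (- a) - b * (- b / z) \<noteq> 0" using det_ab det_S by simp
  then obtain R where R: "R \<in> carrier_mat n n" "det R = a * (- a) - b * (- b / z)"
    "\<And>v. mact n R v = v(n - 2 := a * v (n - 2) + b * v (n - 1), n - 1 := - b / z * v (n - 2) + (- a) * v (n - 1))"
    by (rule two_block[of "n - 2" n "n - 1", rotated 3]) (use m in \<open>auto simp: n_def\<close>)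
  note R = R(1) R(2)[unfolded det_ab] R(3)
  have X_SL: "S * R \<in> SLc n" using S R det_S by (simp add: det_mult[of _ n])
  \<comment> \<open>The block diagonal \<open>P\<close> is the left member of the pair in the
    conclusion, and \<open>S * R\<close> is the right one.\<close>
  have "P * (S * R) = (z \<cdot>\<^sub>m 1\<^sub>m n) * ((S * R) * P)"
  proof (rule mat_eqI_mact_less[of _ n])
    fix v :: "nat \<Rightarrow> 'a" and i assume i: "i < n"
    obtain k where k: "m = Suc k" using m by (cases m) auto
    have zk: "z * z ^ k = -1" using z k by simp
    have lhs: "mact n (P * (S * R)) v i = mact n P (mact n S (mact n R v)) i"
      using P S R by (simp add: mact_mult)
    have rhs: "mact n ((z \<cdot>\<^sub>m 1\<^sub>m n) * ((S * R) * P)) v i = z * mact n S (mact n R (mact n P v)) i"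
      using P S R i by (simp add: mact_mult mact_mono_mat flip: mono_mat_scalar)
    have nk: "n - 2 = 2 * k" "n - 1 = Suc (2 * k)" "n = Suc (Suc (2 * k))" by (auto simp: n_def k)
    have Pe: "mact n P v (2 * l) = z ^ Suc l * v (Suc (2 * l))" "mact n P v (Suc (2 * l)) = z ^ l * v (2 * l)"
      if "l \<le> k" for v l
      using that k by (simp_all add: P(3))
    have P0: "mact n P v 0 = z * v (Suc 0)" "mact n P v (Suc 0) = v 0" for v
      using Pe[of 0] by simp_all
    have PS: "mact n P v (Suc (Suc (2 * l))) = z * z ^ Suc l * v (Suc (Suc (Suc (2 * l))))"
        "mact n P v (Suc (Suc (Suc (2 * l)))) = z ^ Suc l * v (Suc (Suc (2 * l)))" if "l < k" for v l
      using Pe[of "Suc l" v] that by simp_all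
    have Re: "mact n R v (2 * k) = a * v (2 * k) + b * v (Suc (2 * k))"
        "mact n R v (Suc (2 * k)) = - b / z * v (2 * k) + (- a) * v (Suc (2 * k))"
        "i < 2 * k \<Longrightarrow> mact n R v i = v i" for v i
      by (simp_all add: R(3)[unfolded nk(1,2)])
    have Se: "mact n S v 0 = v (2 * k)" "mact n S v (Suc 0) = v (Suc (2 * k))" for v
      using S(2)[of 0 v] S(2)[of 1 v] by (simp_all add: \<sigma>_def nk(1) nk(3)) 
    have SS: "mact n S v (Suc (Suc (2 * l))) = v (2 * l)"
        "mact n S v (Suc (Suc (Suc (2 * l)))) = v (Suc (2 * l))" if "l < k" for v l
      using S(2)[of "Suc (Suc (2 * l))" v] S(2)[of "Suc (Suc (Suc (2 * l)))" v] that nk(3)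
      by (simp_all add: \<sigma>_def)
    consider "i = 0" | "i = Suc 0" | l where "i = Suc (Suc (2 * l))" "l < k"
      | l where "i = Suc (Suc (Suc (2 * l)))" "l < k"
    proof (cases "i < 2")
      case True
      then show thesis using that(1,2) by linarith
    next
      case False
      show thesis
      proof (cases "even i")
        case True
        then show thesis using False i nk(3) that(3)[of "i div 2 - 1"] by (auto elim!: evenE)
      next
        case odd: False
        then show thesis using False i nk(3) that(4)[of "i div 2 - 1"] by (auto elim!: oddE)
      qed
    qed
    then have "mact n P (mact n S (mact n R v)) i = z * mact n S (mact n R (mact n P v)) i"
    proof cases
      case 1
      have "z * (a * (z * z ^ k * v (Suc (2 * k))) + b * (z ^ k * v (2 * k)))
          = z * (a * (z * z ^ k) * v (Suc (2 * k))) + b * (z * z ^ k) * v (2 * k)"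
        by (simp add: algebra_simps)
      then show ?thesis using z0 1
        by (simp add: P0 Se Re Pe zk distrib_left) (simp add: field_simps)
    next
      case 2
      have "z * (- b / z * (z * z ^ k * v (Suc (2 * k))) + - a * (z ^ k * v (2 * k)))
          = - b / z * (z * (z * z ^ k)) * v (Suc (2 * k)) - a * (z * z ^ k) * v (2 * k)"
        by (simp add: algebra_simps)
      then show ?thesis using z0 2
        by (simp add: P0 Se Re Pe zk)
    next
      case (3 l)
      then show ?thesis by (simp add: PS SS Re(3) Pe)
    next
      case (4 l)
      then show ?thesis by (simp add: PS SS Re(3) Pe)
    qed
    then show "mact n (P * (S * R)) v i = mact n ((z \<cdot>\<^sub>m 1\<^sub>m n) * ((S * R) * P)) v i"
      by (simp only: lhs rhs)
  qed (use P S R in simp_all)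
  then show ?thesis using P_SL X_SL unfolding n_def by blast
qed

text \<open>The clock matrix has determinant z^(n(n-1)/2). This is 1 for odd \<open>n\<close>, and
  for even \<open>n\<close> if z^(n/2) = 1; the only other value of z^(n/2) is -1.\<close>

lemma skew_pair:
  fixes z :: "'a :: {field, finite}"
  assumes n: "n > 0" and z: "z ^ n = 1"
  obtains X P where "X \<in> SLc n" "P \<in> SLc n" "X * P = (z \<cdot>\<^sub>m 1\<^sub>m n) * (P * X)"
proof -
  have sum: "(\<Prod>i = 0..<n. z ^ i) = z ^ (n * (n - 1) div 2)"
    by (simp add: Sum_Ico_nat flip: power_sum)
  have "\<exists>X\<in>SLc n. \<exists>P\<in>SLc n. X * P = (z \<cdot>\<^sub>m 1\<^sub>m n) * (P * X)"
  proof (cases "even n")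
    case False
    then obtain m where m: "n = 2 * m + 1" by (auto elim: oddE)
    then have "n * (n - 1) div 2 = n * m" by simp
    then show ?thesis using skew_pair_diag[OF n z] sum z by (simp add: power_mult)
  next
    case True
    then obtain m where m: "n = 2 * m" by (auto elim: evenE)
    then have "(z ^ m)\<^sup>2 = 1" using z by (simp add: mult.commute flip: power_mult)
    then consider "z ^ m = 1" | "z ^ m = -1" by (auto simp: power2_eq_1_iff)
    then show ?thesis
    proof cases
      case 1
      have "n * (n - 1) div 2 = m * (n - 1)" using m by simp
      then show ?thesis using skew_pair_diag[OF n z] sum 1 by (simp add: power_mult)
    next
      case 2
      then show ?thesis using skew_pair_blocks[of m z] m n by simp
    qed
  qed
  then show thesis using that by blast
qed

section \<open>From cocycles to lifts\<close>

text \<open>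
  The cocycle extension acts faithfully on its underlying set by left translations, which places
  it inside an instance of \<open>group_mult\<close>.
\<close>

typedef 'e bijection = "{f :: 'e \<Rightarrow> 'e. bij f}"
  by (rule exI[of _ id]) simp

instantiation bijection :: (type) group_mult
begin

definition "1 = Abs_bijection id"
definition "f * g = Abs_bijection (Rep_bijection f \<circ> Rep_bijection g)"
definition "inverse f = Abs_bijection (inv_into UNIV (Rep_bijection f))"
definition "f div g = f * inverse (g :: 'a bijection)"

instance
proof
  fix f g h :: "'a bijection"
  have bij: "bij (Rep_bijection f)" for f :: "'a bijection" using Rep_bijection by simp
  show "f * g * h = f * (g * h)"
    by (simp add: times_bijection_def Abs_bijection_inverse bij bij_comp comp_assoc)
  show "1 * f = f" "f * 1 = f"
    by (simp_all add: times_bijection_def one_bijection_def Abs_bijection_inverse Rep_bijection_inverse)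
  show "inverse f * f = 1"
    using bij[of f] by (simp add: times_bijection_def one_bijection_def inverse_bijection_def
        Abs_bijection_inverse bij_imp_bij_inv bij_is_inj)
qed

end

locale commuting_cocycle = comm_group A for A :: "('b, 'm) monoid_scheme" (structure) +
  fixes n :: nat and f :: "'a :: {field, finite} mat \<Rightarrow> 'a mat \<Rightarrow> 'b"
  assumes n: "n \<ge> 2"
    and f_closed: "g \<in> SLc n \<Longrightarrow> h \<in> SLc n \<Longrightarrow> f g h \<in> carrier A"
    and f_cocycle: "g \<in> SLc n \<Longrightarrow> h \<in> SLc n \<Longrightarrow> k \<in> SLc n \<Longrightarrow>
      f h k \<otimes> f g (h * k) = f (g * h) k \<otimes> f g h"
    and f_commute: "g \<in> SLc n \<Longrightarrow> h \<in> SLc n \<Longrightarrow> g * h = h * g \<Longrightarrow> f g h = f h g"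
    and sqrt: "a \<in> carrier A \<Longrightarrow> \<exists>b\<in>carrier A. b \<otimes> b = a"
    and cube_root: "a \<in> carrier A \<Longrightarrow> \<exists>b\<in>carrier A. b \<otimes> b \<otimes> b = a"
begin

text \<open>\<open>Lf g\<close> is left translation by \<open>(\<one>, g)\<close> in the extension defined by \<open>f\<close>, and \<open>Tf c\<close> by a central element.\<close>

definition Tf :: "'b \<Rightarrow> 'b \<times> 'a mat \<Rightarrow> 'b \<times> 'a mat" where
  "Tf c = (\<lambda>(a, h). if a \<in> carrier A \<and> h \<in> SLc n then (a \<otimes> c, h) else (a, h))"
definition Lf :: "'a mat \<Rightarrow> 'b \<times> 'a mat \<Rightarrow> 'b \<times> 'a mat" where
  "Lf g = (\<lambda>(a, h). if a \<in> carrier A \<and> h \<in> SLc n then (a \<otimes> f g h, g * h) else (a, h))"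

lemma Tf_comp:
  assumes "c \<in> carrier A" "d \<in> carrier A" shows "Tf c \<circ> Tf d = Tf (d \<otimes> c)"
  using assms by (auto simp: Tf_def fun_eq_iff m_assoc)

lemma Tf_one: "Tf \<one> = id"
  by (auto simp: Tf_def fun_eq_iff)

lemma bij_Tf:
  assumes "c \<in> carrier A" shows "bij (Tf c)"
  using Tf_comp[OF assms inv_closed[OF assms]] Tf_comp[OF inv_closed[OF assms] assms] assms
  by (intro o_bij[of "Tf (inv c)"]) (simp_all add: Tf_one)

lemma Lf_comp:
  assumes "g \<in> SLc n" "h \<in> SLc n" shows "Lf g \<circ> Lf h = Tf (f g h) \<circ> Lf (g * h)"
proof
  fix p :: "'b \<times> 'a mat"
  obtain a k where p: "p = (a, k)" by (cases p)
  show "(Lf g \<circ> Lf h) p = (Tf (f g h) \<circ> Lf (g * h)) p"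
  proof (cases "a \<in> carrier A \<and> k \<in> SLc n")
    case True
    have cl: "f h k \<in> carrier A" "f g (h * k) \<in> carrier A" "f (g * h) k \<in> carrier A" "f g h \<in> carrier A"
      using assms True by (intro f_closed SLc_mult; simp)+
    have "a \<otimes> f h k \<otimes> f g (h * k) = a \<otimes> f (g * h) k \<otimes> f g h"
      using f_cocycle[OF assms, of k] True cl by (simp add: m_assoc)
    moreover have "g * (h * k) = g * h * k"
      using assms True by (simp add: assoc_mult_mat[of _ n n _ n _ n])
    moreover have "h * k \<in> SLc n" "g * h * k \<in> SLc n" using assms True by (intro SLc_mult; simp)+
    ultimately show ?thesis using True cl by (simp add: p Lf_def Tf_def)
  qed (auto simp: p Lf_def Tf_def)
qed

text \<open>The cocycle identity at (1, 1, h); the cocycle is not assumed to be normalised.\<close>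

lemma f_one: 
  assumes "h \<in> SLc n" shows "f (1\<^sub>m n) h = f (1\<^sub>m n) (1\<^sub>m n)"
proof -
  have "1\<^sub>m n * h = h" using assms by (intro left_mult_one_mat[of _ n n]) simp
  then have "f (1\<^sub>m n) h \<otimes> f (1\<^sub>m n) h = f (1\<^sub>m n) h \<otimes> f (1\<^sub>m n) (1\<^sub>m n)"
    using f_cocycle[OF SLc_one SLc_one assms] by simp
  then show ?thesis using f_closed[OF SLc_one assms] f_closed[OF SLc_one SLc_one] by simp
qed

lemma Lf_one: "Lf (1\<^sub>m n) = Tf (f (1\<^sub>m n) (1\<^sub>m n))"
proof
  fix p :: "'b \<times> 'a mat"
  obtain a h where p: "p = (a, h)" by (cases p)
  show "Lf (1\<^sub>m n) p = Tf (f (1\<^sub>m n) (1\<^sub>m n)) p"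
  proof (cases "a \<in> carrier A \<and> h \<in> SLc n")
    case True
    then have "1\<^sub>m n * h = h" by (intro left_mult_one_mat[of _ n n]) simp
    then show ?thesis using True f_one[of h] by (simp add: p Lf_def Tf_def)
  qed (auto simp: p Lf_def Tf_def)
qed

text \<open>For \<open>h\<close> inverse to \<open>g\<close>, both composites of \<open>Lf g\<close>
  and \<open>Lf h\<close> are central translations, hence bijective.\<close>

lemma bij_Lf:
  assumes g: "g \<in> SLc n" shows "bij (Lf g)"
proof -
  have 1: "bij (Lf h \<circ> Lf k)" if "h \<in> SLc n" "k \<in> SLc n" "h * k = 1\<^sub>m n" for h k
    unfolding Lf_comp[OF that(1,2)] that(3) Lf_one
    by (intro bij_comp bij_Tf f_closed that SLc_one)
  obtain h where h: "h \<in> SLc n" "h * g = 1\<^sub>m n" "g * h = 1\<^sub>m n" using SLc_inverse[OF g] .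
  have "inj (Lf g)" using bij_is_inj[OF 1[OF h(1) g h(2)]] by (rule inj_on_imageI2)
  moreover have "surj (Lf g)"
    using bij_is_surj[OF 1[OF g h(1) h(3)]] unfolding surj_def o_def by blast
  ultimately show ?thesis by (rule bijI)
qed

definition T where "T c = Abs_bijection (Tf c)"
definition L where "L g = Abs_bijection (Lf g)"

lemma Rep_T: "c \<in> carrier A \<Longrightarrow> Rep_bijection (T c) = Tf c"
  by (simp add: T_def Abs_bijection_inverse bij_Tf)

lemma Rep_L: "g \<in> SLc n \<Longrightarrow> Rep_bijection (L g) = Lf g"
  by (simp add: L_def Abs_bijection_inverse bij_Lf)

lemma T_mult: "c \<in> carrier A \<Longrightarrow> d \<in> carrier A \<Longrightarrow> T c * T d = T (d \<otimes> c)"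
  by (simp add: times_bijection_def Rep_T Tf_comp) (simp add: T_def)

lemma L_mult: "g \<in> SLc n \<Longrightarrow> h \<in> SLc n \<Longrightarrow> L g * L h = T (f g h) * L (g * h)"
  using Lf_comp[of g h] f_closed[of g h] SLc_mult[of g n h]
  by (simp only: times_bijection_def Rep_L Rep_T)

lemma T_L: "c \<in> carrier A \<Longrightarrow> g \<in> SLc n \<Longrightarrow> T c * L g = L g * T c"
proof -
  assume c: "c \<in> carrier A" and g: "g \<in> SLc n"
  have "Tf c \<circ> Lf g = Lf g \<circ> Tf c"
    using c g f_closed[OF g] SLc_mult[OF g] by (auto simp: Tf_def Lf_def fun_eq_iff m_ac)
  then show ?thesis using c g by (simp add: times_bijection_def Rep_T Rep_L)
qed

lemma T_one: "T \<one> = 1"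
  by (simp add: T_def Tf_one one_bijection_def)

lemma inverse_T: "c \<in> carrier A \<Longrightarrow> inverse (T c) = T (inv c)"
  by (rule inverse_unique_mult) (simp add: T_mult T_one)

lemma T_inj:
  assumes "c \<in> carrier A" "d \<in> carrier A" "T c = T d" shows "c = d"
proof -
  have "Tf c (\<one>, 1\<^sub>m n) = Tf d (\<one>, 1\<^sub>m n)" using Rep_T[OF assms(1)] Rep_T[OF assms(2)] assms(3) by simp
  then show ?thesis using assms by (simp add: Tf_def)
qed

lemma commuting_lift_L: "commuting_lift n L (T ` carrier A)"
proof
  show "1 \<in> T ` carrier A" using T_one by (metis image_eqI one_closed)
  fix g h :: "'a mat" assume g: "g \<in> SLc n" and h: "h \<in> SLc n"
  show "\<exists>z\<in>T ` carrier A. L g * L h = z * L (g * h)"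
    using L_mult f_closed g h by blast
  show "L g * L h = L h * L g" if "g * h = h * g"
    unfolding L_mult[OF g h] L_mult[OF h g] f_commute[OF g h that]
    by (rule arg_cong[OF that, of "\<lambda>k. T (f h g) * L k"])
  show "g = h" if z: "z \<in> T ` carrier A" and eq: "L g = z * L h" for z
  proof -
    obtain c where c: "c \<in> carrier A" "z = T c" using z by auto
    \<comment> \<open>The second component of the image of the base point recovers the
      matrix.\<close>
    have "Lf g (\<one>, 1\<^sub>m n) = Tf c (Lf h (\<one>, 1\<^sub>m n))"
      using arg_cong[OF eq, of Rep_bijection] c g h
      by (simp add: times_bijection_def Rep_T Rep_L Abs_bijection_inverse bij_comp bij_Tf bij_Lf)
    moreover have "f h (1\<^sub>m n) \<in> carrier A" by (rule f_closed[OF h SLc_one])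
    moreover have "h * 1\<^sub>m n = h" "g * 1\<^sub>m n = g"
      using g h by (intro right_mult_one_mat[of _ n n]; simp)+
    ultimately show ?thesis using g h by (simp add: Lf_def Tf_def)
  qed
next
  fix z assume "z \<in> T ` carrier A"
  then obtain c where c: "c \<in> carrier A" "z = T c" by auto
  show "inverse z \<in> T ` carrier A" using c inverse_T by auto
  show "z * L g = L g * z" if "g \<in> SLc n" for g using T_L that c by simp
  show "\<exists>y\<in>T ` carrier A. y * y = z" using sqrt[OF c(1)] T_mult c by fastforce
  obtain b where b: "b \<in> carrier A" "b \<otimes> b \<otimes> b = c" using cube_root[OF c(1)] by blast
  then have "T b * T b * T b = z" using c by (simp add: T_mult m_assoc)
  then show "\<exists>y\<in>T ` carrier A. y * y * y = z" using b by blast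
  fix z' assume "z' \<in> T ` carrier A"
  then obtain d where d: "d \<in> carrier A" "z' = T d" by auto
  show "z * z' \<in> T ` carrier A" using c d T_mult by auto
  show "z * z' = z' * z" using c d T_mult m_comm by auto
qed (rule n)

text \<open>A homomorphic section differs from \<open>L\<close> by central factors
  \<open>c g\<close>, and its multiplicativity says that the inverse of \<open>c\<close> has
  coboundary \<open>f\<close>.\<close>

theorem coboundary_exists:
  obtains c where "\<And>g. g \<in> SLc n \<Longrightarrow> c g \<in> carrier A"
    and "\<And>g h. g \<in> SLc n \<Longrightarrow> h \<in> SLc n \<Longrightarrow> c (g * h) = f g h \<otimes> c g \<otimes> c h"
proof -
  interpret CL: commuting_lift n L "T ` carrier A" by (rule commuting_lift_L)
  obtain s where s: "\<And>g. g \<in> SLc n \<Longrightarrow> CL.over (s g) g"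
    "\<And>g h. g \<in> SLc n \<Longrightarrow> h \<in> SLc n \<Longrightarrow> s (g * h) = s g * s h"
    using CL.section_exists by blast
  then have "\<forall>g\<in>SLc n. \<exists>c. c \<in> carrier A \<and> s g = T c * L g"
    unfolding CL.over_def by blast
  from bchoice[OF this] obtain c where
    c: "\<And>g. g \<in> SLc n \<Longrightarrow> c g \<in> carrier A" "\<And>g. g \<in> SLc n \<Longrightarrow> s g = T (c g) * L g"
    by blast
  have "c (g * h) = f g h \<otimes> c g \<otimes> c h" if g: "g \<in> SLc n" and h: "h \<in> SLc n" for g h
  proof (rule T_inj)
    note cl = c(1)[OF g] c(1)[OF h] c(1)[OF SLc_mult[OF g h]] f_closed[OF g h]
    show "c (g * h) \<in> carrier A" "f g h \<otimes> c g \<otimes> c h \<in> carrier A" using cl by auto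
    have "T (c (g * h)) * L (g * h) = T (c g) * (L g * T (c h)) * L h"
      using s(2)[OF g h] c(2) g h SLc_mult[OF g h] by (simp add: mult.assoc)
    also have "L g * T (c h) = T (c h) * L g" using T_L cl g by simp
    also have "T (c g) * (T (c h) * L g) * L h = T (c g) * T (c h) * T (f g h) * L (g * h)"
      using L_mult[OF g h] by (simp add: mult.assoc)
    also have "T (c g) * T (c h) * T (f g h) = T (f g h \<otimes> c g \<otimes> c h)"
      using cl by (simp add: T_mult m_ac)
    finally show "T (c (g * h)) = T (f g h \<otimes> c g \<otimes> c h)" by (simp add: mult_right_cancel_group)
  qed
  then show thesis using that c(1) by blast
qed

end

section \<open>Roots in the coefficient group, and symmetry of the cocycle from abelian
  subgroups\<close>

lemma rat_mod_int_cases: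
  assumes "a \<in> carrier rat_mod_int"
  obtains q where "a = \<int> #>\<^bsub>rat_group\<^esub> q"
  using assms by (auto simp: rat_mod_int_def FactGroup_def RCOSETS_def)

lemma rat_coset_carrier: "\<int> #>\<^bsub>rat_group\<^esub> q \<in> carrier rat_mod_int"
  by (auto simp: rat_mod_int_def FactGroup_def RCOSETS_def rat_group_def)

lemma rat_coset_mult:
  "(\<int> #>\<^bsub>rat_group\<^esub> p) \<otimes>\<^bsub>rat_mod_int\<^esub> (\<int> #>\<^bsub>rat_group\<^esub> q) = \<int> #>\<^bsub>rat_group\<^esub> (p + q)"
proof -
  interpret R: comm_group rat_group by (rule comm_group_rat_group)
  interpret N: normal \<int> rat_group
    using subgroup_Ints_rat_group R.normal_iff_subgroup by blast
  have "p \<in> carrier rat_group" "q \<in> carrier rat_group" by (simp_all add: rat_group_def)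
  from N.rcos_sum[OF this] show ?thesis by (simp add: rat_mod_int_def FactGroup_def rat_group_def)
qed

lemma rat_mod_int_sqrt:
  assumes "a \<in> carrier rat_mod_int"
  shows "\<exists>b\<in>carrier rat_mod_int. b \<otimes>\<^bsub>rat_mod_int\<^esub> b = a"
proof -
  obtain q where "a = \<int> #>\<^bsub>rat_group\<^esub> q" using assms by (rule rat_mod_int_cases)
  then show ?thesis
    by (intro bexI[of _ "\<int> #>\<^bsub>rat_group\<^esub> (q / 2)"]) (simp_all add: rat_coset_mult rat_coset_carrier)
qed

lemma rat_mod_int_cube_root:
  assumes "a \<in> carrier rat_mod_int"
  shows "\<exists>b\<in>carrier rat_mod_int. b \<otimes>\<^bsub>rat_mod_int\<^esub> b \<otimes>\<^bsub>rat_mod_int\<^esub> b = a"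
proof -
  obtain q where "a = \<int> #>\<^bsub>rat_group\<^esub> q" using assms by (rule rat_mod_int_cases)
  then show ?thesis
    by (intro bexI[of _ "\<int> #>\<^bsub>rat_group\<^esub> (q / 3)"]) (simp_all add: rat_coset_mult rat_coset_carrier)
qed

text \<open>The double centraliser of the pair: it is abelian because the pair lies in its own
  centraliser, and no description of the generated subgroup is needed.\<close>

lemma (in group) commuting_pair_abelian_subgroup:
  assumes x: "x \<in> carrier G" and y: "y \<in> carrier G" and xy: "x \<otimes> y = y \<otimes> x"
  obtains H where "subgroup H G" "comm_group (G\<lparr>carrier := H\<rparr>)" "x \<in> H" "y \<in> H"
proof -
  define C where "C S = {z \<in> carrier G. \<forall>s\<in>S. z \<otimes> s = s \<otimes> z}" for S
  have C: "subgroup (C S) G" if S: "S \<subseteq> carrier G" for S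
  proof
    fix a b assume ab: "a \<in> C S" "b \<in> C S"
    have "a \<otimes> b \<otimes> s = s \<otimes> (a \<otimes> b)" if s: "s \<in> S" for s
    proof -
      have cl: "a \<in> carrier G" "b \<in> carrier G" "s \<in> carrier G" using ab s S by (auto simp: C_def)
      have "b \<otimes> s = s \<otimes> b" "a \<otimes> s = s \<otimes> a" using ab s by (auto simp: C_def)
      then show ?thesis using cl by (metis m_assoc)
    qed
    then show "a \<otimes> b \<in> C S" using ab by (auto simp: C_def)
  next
    fix a assume a: "a \<in> C S"
    then have aG: "a \<in> carrier G" by (simp add: C_def)
    have "inv a \<otimes> s = s \<otimes> inv a" if s: "s \<in> S" for s
    proof -
      have sG: "s \<in> carrier G" using s S by auto
      have "inv a \<otimes> s = inv a \<otimes> (s \<otimes> a) \<otimes> inv a" using aG sG by (simp add: m_assoc)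
      also have "s \<otimes> a = a \<otimes> s" using a s by (auto simp: C_def)
      also have "inv a \<otimes> (a \<otimes> s) \<otimes> inv a = s \<otimes> inv a" using aG sG by (simp flip: m_assoc)
      finally show ?thesis .
    qed
    then show "inv a \<in> C S" using aG by (simp add: C_def)
  qed (use S in \<open>auto simp: C_def\<close>)
  let ?H = "C (C {x, y})"
  have sub: "C {x, y} \<subseteq> carrier G" "?H \<subseteq> carrier G" by (auto simp: C_def)
  have xyH: "x \<in> ?H" "y \<in> ?H" using x y by (auto simp: C_def)
  have "x \<in> C {x, y}" "y \<in> C {x, y}" using x y xy by (auto simp: C_def)
  then have "?H \<subseteq> C {x, y}" by (fastforce simp: C_def)
  then have comm: "a \<otimes> b = b \<otimes> a" if "a \<in> ?H" "b \<in> ?H" for a b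
    using that unfolding C_def[of "C {x, y}"] by blast
  have H: "subgroup ?H G" by (rule C[OF sub(1)])
  then have "group (G\<lparr>carrier := ?H\<rparr>)" by (rule subgroup.subgroup_is_group[OF _ is_group])
  then have "comm_group (G\<lparr>carrier := ?H\<rparr>)"
    by (rule group.group_comm_groupI) (simp add: comm)
  then show thesis using that H xyH by blast
qed

text \<open>Coboundaries on an abelian group are symmetric.\<close>

lemma (in trivial_module) vanishing_restriction_symmetric:
  assumes f: "f \<in> cocycles2 G A" and H: "subgroup H G" "comm_group (G\<lparr>carrier := H\<rparr>)"
    and res: "res2 G A H (coboundaries2 G A #>\<^bsub>cocycle_group2 G A\<^esub> f) = \<one>\<^bsub>H2 (G\<lparr>carrier := H\<rparr>) A\<^esub>"
    and xy: "x \<in> H" "y \<in> H"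
  shows "f (x, y) = f (y, x)"
proof -
  let ?H = "G\<lparr>carrier := H\<rparr>"
  interpret TH: trivial_module ?H A
    by (intro trivial_module.intro A.comm_group_axioms subgroup.subgroup_is_group[OF H(1) G.group_axioms])
  interpret ZH: comm_group "cocycle_group2 ?H A" by (rule TH.comm_group_cocycle_group2)
  have fH: "restrict f (H \<times> H) \<in> carrier (cocycle_group2 ?H A)"
    using restrict_cocycle[OF H(1) f] by (simp add: cocycle_group2_def)
  have "restrict f (H \<times> H) \<in> coboundaries2 ?H A"
    using res ZH.rcos_self[OF fH TH.subgroup_coboundaries2]
    by (simp add: res2_rcoset[OF H(1) f] TH.one_H2)
  then obtain c where c: "c \<in> H \<rightarrow> carrier A" "restrict f (H \<times> H) = coboundary2 ?H A c"
    by (auto simp: coboundaries2_def)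
  have yx: "y \<otimes> x = x \<otimes> y"
    using comm_groupE(4)[OF H(2)] xy by simp
  have cl: "c x \<in> carrier A" "c y \<in> carrier A" "c (x \<otimes> y) \<in> carrier A"
    using c(1) xy subgroup.m_closed[OF H(1)] by auto
  have "f (x, y) = c y \<otimes>\<^bsub>A\<^esub> inv\<^bsub>A\<^esub> c (x \<otimes> y) \<otimes>\<^bsub>A\<^esub> c x"
    "f (y, x) = c x \<otimes>\<^bsub>A\<^esub> inv\<^bsub>A\<^esub> c (x \<otimes> y) \<otimes>\<^bsub>A\<^esub> c y"
    using fun_cong[OF c(2), of "(x, y)"] fun_cong[OF c(2), of "(y, x)"] xy
    by (simp_all add: coboundary2_def yx)
  then show ?thesis using cl by (simp add: A.m_ac)
qed

section \<open>Descent of the trivialising cochain from SL_n to PSL_n\<close>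

lemma PSL_coboundary:
  fixes A :: "('b, 'm) monoid_scheme" (structure)
  assumes A: "comm_group A" and n: "n \<ge> 2"
    and sqrt: "\<And>a. a \<in> carrier A \<Longrightarrow> \<exists>b\<in>carrier A. b \<otimes> b = a"
    and cube_root: "\<And>a. a \<in> carrier A \<Longrightarrow> \<exists>b\<in>carrier A. b \<otimes> b \<otimes> b = a"
    and \<phi>: "\<phi> \<in> cocycles2 (PSL TYPE('a :: {field, finite}) n) A"
    and sym: "\<And>x y. x \<in> carrier (PSL TYPE('a) n) \<Longrightarrow> y \<in> carrier (PSL TYPE('a) n) \<Longrightarrow>
      x \<otimes>\<^bsub>PSL TYPE('a) n\<^esub> y = y \<otimes>\<^bsub>PSL TYPE('a) n\<^esub> x \<Longrightarrow> \<phi> (x, y) = \<phi> (y, x)"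
  shows "\<phi> \<in> coboundaries2 (PSL TYPE('a) n) A"
proof -
  let ?G = "PSL TYPE('a) n" and ?S = "SL TYPE('a) n"
  let ?Z = "group_center ?S"
  interpret trivial_module ?G A by (intro trivial_module.intro group_PSL A)
  interpret S: group ?S by (rule group_SL)
  interpret N: normal ?Z ?S by (rule S.normal_group_center)
  note \<phi>D = cocycles2D[OF \<phi>]
  define \<pi> where "\<pi> g = ?Z #>\<^bsub>?S\<^esub> g" for g
  have S: "carrier ?S = SLc n" "\<And>g h. g \<otimes>\<^bsub>?S\<^esub> h = g * h" by (simp_all add: SL_def)
  have carrier_G: "carrier ?G = \<pi> ` SLc n"
    by (auto simp: PSL_def FactGroup_def RCOSETS_def \<pi>_def S)
  have \<pi>_closed: "\<pi> g \<in> carrier ?G" if "g \<in> SLc n" for g using that carrier_G by blast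
  have \<pi>_mult: "\<pi> g \<otimes>\<^bsub>?G\<^esub> \<pi> h = \<pi> (g * h)" if "g \<in> SLc n" "h \<in> SLc n" for g h
    using N.rcos_sum[of g h] that by (simp add: PSL_def FactGroup_def \<pi>_def S del: mem_Collect_eq)
  have \<pi>_eq: "\<exists>z\<in>?Z. g = z * h" if "g \<in> SLc n" "h \<in> SLc n" "\<pi> g = \<pi> h" for g h
  proof -
    have "g \<in> \<pi> h" using S.rcos_self[of g ?Z] N.is_subgroup that by (simp add: \<pi>_def S del: mem_Collect_eq)
    then show ?thesis by (auto simp: \<pi>_def r_coset_def S)
  qed
  have \<pi>_center: "\<pi> z = \<one>\<^bsub>?G\<^esub>" if "z \<in> ?Z" for z
    using S.coset_join2[of z ?Z] N.is_subgroup that group_centerD(1)[OF that] by (simp add: \<pi>_def PSL_def)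
  define f where "f g h = \<phi> (\<pi> g, \<pi> h)" for g h
  interpret C: commuting_cocycle A n f
  proof (intro commuting_cocycle.intro A commuting_cocycle_axioms.intro n)
    fix g h k :: "'a mat" assume g: "g \<in> SLc n" and h: "h \<in> SLc n"
    show "f g h \<in> carrier A" unfolding f_def by (intro \<phi>D(2) \<pi>_closed g h)
    show "f g h = f h g" if "g * h = h * g"
      unfolding f_def using that by (intro sym) (simp_all add: \<pi>_closed g h \<pi>_mult del: mem_Collect_eq)
    assume k: "k \<in> SLc n"
    show "f h k \<otimes> f g (h * k) = f (g * h) k \<otimes> f g h"
      using \<phi>D(3)[OF \<pi>_closed[OF g] \<pi>_closed[OF h] \<pi>_closed[OF k]]
      by (simp add: f_def \<pi>_mult g h k del: mem_Collect_eq)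
  qed (use sqrt cube_root in auto)
  obtain c where c: "\<And>g. g \<in> SLc n \<Longrightarrow> c g \<in> carrier A"
    and cc: "\<And>g h. g \<in> SLc n \<Longrightarrow> h \<in> SLc n \<Longrightarrow> c (g * h) = f g h \<otimes> c g \<otimes> c h"
    by (rule C.coboundary_exists) blast
  have c_center: "c (z * g) = c g" if z: "z \<in> ?Z" and g: "g \<in> SLc n" for z g
  proof -
    have zS: "z \<in> SLc n" using group_centerD(1)[OF z] by (simp only: S)
    obtain a where a: "z = a \<cdot>\<^sub>m 1\<^sub>m n" "a ^ n = 1"
      using z unfolding group_center_SL by blast
    \<comment> \<open>\<open>f\<close> factors through \<open>\<pi>\<close>, which sends
      \<open>z\<close> to the identity; so multiplication by \<open>z\<close> changes
      \<open>c\<close> by a factor independent of the argument.\<close>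
    have fz: "f z h = f z z" if h: "h \<in> SLc n" for h
    proof -
      have "f z h = f (1\<^sub>m n) h"
        using \<pi>_center[OF z] \<pi>_center[of "1\<^sub>m n"] S.one_closed N.one_closed
        by (simp add: f_def SL_def)
      also have "\<dots> = f (1\<^sub>m n) z" using C.f_one h zS by metis
      also have "\<dots> = f z z"
        using \<pi>_center[OF z] \<pi>_center[of "1\<^sub>m n"] N.one_closed by (simp add: f_def SL_def)
      finally show ?thesis .
    qed
    have cz: "c (z * h) = (f z z \<otimes> c z) \<otimes> c h" if "h \<in> SLc n" for h
      using cc[OF zS that] fz[OF that] by simp
    obtain X P where XP: "X \<in> SLc n" "P \<in> SLc n" "X * P = z * (P * X)"
      using skew_pair[of n a] n a by auto
    have PX: "P * X \<in> SLc n" by (rule SLc_mult[OF XP(2,1)])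
    have "\<pi> X \<otimes>\<^bsub>?G\<^esub> \<pi> P = \<pi> (z * (P * X))"
      unfolding XP(3)[symmetric] by (rule \<pi>_mult[OF XP(1,2)])
    also have "\<dots> = \<pi> z \<otimes>\<^bsub>?G\<^esub> \<pi> (P * X)" by (rule \<pi>_mult[OF zS PX, symmetric])
    also have "\<dots> = \<pi> (P * X)" unfolding \<pi>_center[OF z] by (rule G.l_one[OF \<pi>_closed[OF PX]])
    also have "\<dots> = \<pi> P \<otimes>\<^bsub>?G\<^esub> \<pi> X" by (rule \<pi>_mult[OF XP(2,1), symmetric])
    \<comment> \<open>\<open>X\<close> and \<open>P\<close> need not commute in SL_n, but their
      images do. Evaluating \<open>c\<close> on \<open>X * P = z * (P * X)\<close> now shows that
      the constant factor is 1.\<close>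
    finally have "f X P = f P X" unfolding f_def by (intro sym \<pi>_closed XP)
    then have "c (X * P) = c (P * X)"
      using cc[OF XP(1,2)] cc[OF XP(2,1)] c XP C.f_closed[OF XP(2,1)] by (simp add: A.m_ac)
    then have "(f z z \<otimes> c z) \<otimes> c (P * X) = \<one> \<otimes> c (P * X)"
      using cz[OF PX] c[OF PX] XP(3) by simp
    then have "f z z \<otimes> c z = \<one>"
      using A.right_cancel[OF c[OF PX] _ A.one_closed, of "f z z \<otimes> c z"] c[OF zS] C.f_closed[OF zS zS]
      by simp
    then show ?thesis using cz[OF g] c[OF g] by simp
  qed
  \<comment> \<open>\<open>c\<close> trivialises \<open>f\<close> up to inversion, whence
    \<open>inv\<close>; by \<open>c_center\<close> the chosen representative does not
    matter.\<close>
  define d where "d x = inv (c (SOME g. g \<in> SLc n \<and> \<pi> g = x))" for x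
  have d: "d (\<pi> g) = inv (c g)" if g: "g \<in> SLc n" for g
  proof -
    define h where "h = (SOME h. h \<in> SLc n \<and> \<pi> h = \<pi> g)"
    have "h \<in> SLc n \<and> \<pi> h = \<pi> g" unfolding h_def by (rule someI[of _ g]) (use g in simp)
    then obtain z where "z \<in> ?Z" "h = z * g" using \<pi>_eq g by blast
    then show ?thesis using c_center[OF _ g] by (simp add: d_def h_def)
  qed
  have "\<phi> = coboundary2 ?G A d"
  proof
    fix p
    show "\<phi> p = coboundary2 ?G A d p"
    proof (cases "p \<in> carrier ?G \<times> carrier ?G")
      case False
      then show ?thesis using PiE_arb[OF \<phi>D(1) False] by (auto simp: coboundary2_def)
    next
      case True
      then obtain g h where gh: "g \<in> SLc n" "h \<in> SLc n" "p = (\<pi> g, \<pi> h)"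
        unfolding carrier_G by auto
      note cl = c[OF gh(1)] c[OF gh(2)] C.f_closed[OF gh(1,2)]
      have "coboundary2 ?G A d p = inv (c h) \<otimes> inv (inv (c (g * h))) \<otimes> inv (c g)"
        using True gh d[OF gh(1)] d[OF gh(2)] d[OF SLc_mult[OF gh(1,2)]] \<pi>_mult[OF gh(1,2)]
        by (simp add: coboundary2_def)
      also have "\<dots> = inv (c h) \<otimes> (f g h \<otimes> c g \<otimes> c h) \<otimes> inv (c g)"
        using cl by (simp add: cc[OF gh(1,2)])
      also have "\<dots> = f g h \<otimes> (c g \<otimes> inv (c g)) \<otimes> (c h \<otimes> inv (c h))"
        using cl by (simp only: A.m_ac A.m_closed A.inv_closed)
      also have "\<dots> = \<phi> p" using cl by (simp add: f_def gh(3))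
      finally show ?thesis by simp
    qed
  qed
  moreover have "d \<in> carrier ?G \<rightarrow> carrier A" using d c carrier_G by auto
  ultimately show ?thesis by (auto simp: coboundaries2_def)
qed

theorem theorem5p9:
  fixes n :: nat
  assumes "n \<ge> 2"
  shows "B0 (PSL TYPE('a::{field,finite}) n) =
    {\<one>\<^bsub>H2 (PSL TYPE('a) n) rat_mod_int\<^esub>}"
proof
  let ?G = "PSL TYPE('a) n"
  interpret trivial_module ?G rat_mod_int
    by (intro trivial_module.intro group_PSL comm_group_rat_mod_int)
  interpret Z: comm_group "cocycle_group2 ?G rat_mod_int" by (rule comm_group_cocycle_group2)
  show "{\<one>\<^bsub>H2 ?G rat_mod_int\<^esub>} \<subseteq> B0 ?G"
    using subgroup.one_closed[OF subgroup_B0[OF group_PSL]] by simp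
  show "B0 ?G \<subseteq> {\<one>\<^bsub>H2 ?G rat_mod_int\<^esub>}"
  proof
    fix \<gamma> assume \<gamma>: "\<gamma> \<in> B0 ?G"
    then obtain \<phi> where \<phi>: "\<phi> \<in> cocycles2 ?G rat_mod_int"
      "\<gamma> = coboundaries2 ?G rat_mod_int #>\<^bsub>cocycle_group2 ?G rat_mod_int\<^esub> \<phi>"
      by (auto simp: B0_def carrier_H2)
    have "\<phi> (x, y) = \<phi> (y, x)"
      if xy: "x \<in> carrier ?G" "y \<in> carrier ?G" "x \<otimes>\<^bsub>?G\<^esub> y = y \<otimes>\<^bsub>?G\<^esub> x" for x y
    proof -
      obtain H where H: "subgroup H ?G" "comm_group (?G\<lparr>carrier := H\<rparr>)" "x \<in> H" "y \<in> H"
        using G.commuting_pair_abelian_subgroup[OF xy] .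
      then have "res2 ?G rat_mod_int H \<gamma> = \<one>\<^bsub>H2 (?G\<lparr>carrier := H\<rparr>) rat_mod_int\<^esub>"
        using \<gamma> by (auto simp: B0_def)
      then show ?thesis
        using vanishing_restriction_symmetric[OF \<phi>(1) H(1,2) _ H(3,4)] \<phi>(2) by simp
    qed
    then have "\<phi> \<in> coboundaries2 ?G rat_mod_int"
      using PSL_coboundary[OF comm_group_rat_mod_int assms rat_mod_int_sqrt rat_mod_int_cube_root \<phi>(1)]
      by blast
    moreover have "\<phi> \<in> carrier (cocycle_group2 ?G rat_mod_int)"
      using \<phi>(1) by (simp add: cocycle_group2_def)
    ultimately have "\<gamma> = coboundaries2 ?G rat_mod_int"
      using Z.coset_join2[OF _ subgroup_coboundaries2] \<phi>(2) by blast
    then show "\<gamma> \<in> {\<one>\<^bsub>H2 ?G rat_mod_int\<^esub>}" by (simp add: one_H2)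
  qed
qed

end
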